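(* Let $d\ge 1$ and $n\ge 1$ be natural numbers, let $U_1,\dots,U_n$ be independent random vectors each uniformly distributed on the unit sphere $S^{d-1}$ in $\mathbb{R}^d$, let $Z_d$ be a standard normal random vector in $\mathbb{R}^d$, let $a_1,\dots,a_n$ be any real numbers, and put $$a:=\sqrt{(a_1^2+\dots+a_n^2)/d},\qquad c:=\frac{2e^3}{9}=4.46\dots.$$ Then for all real $u$ $$\mathsf{P}(\|a_1U_1+\dots+a_nU_n\|>u)\le c\,\mathsf{P}(a\|Z_d\|>u).$$ The strict version of this inequality, with the same $c$, also holds: $$\mathsf{P}(\|a_1U_1+\dots+a_nU_n\|>u)< c\,\mathsf{P}(a\|Z_d\|>u)$$ for all real $u$.
   Context: $\|x\|:=\sqrt{x\cdot x}$ is the Euclidean norm on $\mathbb{R}^d$, where $x\cdot y$ is the standard inner product. For $d=1$, the unit sphere is $S^0=\{-1,1\}$, and the uniform distribution on it assigns probability $1/2$ to each point.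
   Formalization: The strict inequality is claimed only when some a_i is nonzero or u < 0, because for a_1 = ... = a_n = 0 and u ≥ 0 both sides are 0 and it would read 0 < 0; the non-strict inequality is stated for all real u without restriction. *)

theory Defs
  imports "HOL-Probability.Probability"
begin

text \<open>
  The normalised surface measure on the unit sphere in its cone form: the measure of a Borel set
  A of directions is the proportion of the volume of the unit ball that lies in the cone over A.
  It is regarded as a Borel measure on the whole space, carried by the sphere.  The origin, where
  the normalisation is the junk value 0, is a null set.  The lemmas below confirm that this is a
  probability measure on the sphere, that it is invariant under orthogonal transformations (with
  the additional sort constraint on the index type under which the library has the invariance of
  Lebesgue measure), and that in dimension one it gives mass 1/2 to each of the two points.
\<close>

definition uniform_sphere :: "'a::euclidean_space measure" where
  "uniform_sphere = distr (uniform_measure lborel (cball 0 1)) borel (\<lambda>x. x /\<^sub>R norm x)"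

definition std_normal_vector :: "'w measure \<Rightarrow> ('w \<Rightarrow> real ^ 'd::finite) \<Rightarrow> bool" where
  "std_normal_vector M Z \<longleftrightarrow>
     prob_space.indep_vars M (\<lambda>_. borel) (\<lambda>j \<omega>. Z \<omega> $ j) UNIV \<and>
     (\<forall>j. distributed M lborel (\<lambda>\<omega>. Z \<omega> $ j) std_normal_density)"

lemma emeasure_cball_01:
  "emeasure lborel (cball (0::'a::euclidean_space) 1) \<noteq> 0"
  "emeasure lborel (cball (0::'a::euclidean_space) 1) \<noteq> \<infinity>"
proof -
  have "unit_ball_vol (real DIM('a)) > 0"
    by simp
  then show "emeasure lborel (cball (0::'a) 1) \<noteq> 0"
    by (simp add: emeasure_cball ennreal_eq_0_iff del: unit_ball_vol_pos)
  show "emeasure lborel (cball (0::'a) 1) \<noteq> \<infinity>"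
    by (simp add: emeasure_cball)
qed

lemma prob_space_uniform_sphere: "prob_space (uniform_sphere :: 'a::euclidean_space measure)"
  unfolding uniform_sphere_def
  by (intro prob_space.prob_space_distr prob_space_uniform_measure emeasure_cball_01) measurable

lemma emeasure_uniform_sphere:
  assumes "A \<in> sets (borel :: 'a::euclidean_space measure)"
  shows "emeasure uniform_sphere A =
    emeasure lborel (cball 0 1 \<inter> {x. x /\<^sub>R norm x \<in> A}) / emeasure lborel (cball (0::'a) 1)"
proof -
  have m: "(\<lambda>x::'a. x /\<^sub>R norm x) \<in> borel_measurable borel" by measurable
  have "(\<lambda>x::'a. x /\<^sub>R norm x) -` A \<in> sets borel"
    using measurable_sets[OF m assms] by simp
  then show ?thesis
    unfolding uniform_sphere_def using assms m
    by (simp add: emeasure_distr vimage_def)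
qed

lemma AE_uniform_sphere: "AE x in uniform_sphere. x \<in> sphere (0::'a::euclidean_space) 1"
proof -
  have "AE x in uniform_measure lborel (cball 0 1). x \<noteq> (0::'a)"
    by (rule AE_uniform_measureI) (use AE_lborel_singleton[of "0::'a"] in auto)
  then show ?thesis
    unfolding uniform_sphere_def
    by (subst AE_distr_iff) (auto elim!: eventually_mono simp: sphere_def)
qed

lemma uniform_sphere_orthogonal_invariant:
  fixes f :: "real ^ 'd::{finite,wellorder} \<Rightarrow> real ^ 'd::{finite,wellorder}"
  assumes f: "orthogonal_transformation f"
  shows "distr uniform_sphere borel f = uniform_sphere"
proof (rule measure_eqI)
  have fm: "f \<in> borel_measurable borel"
    using f by (intro borel_measurable_continuous_onI linear_continuous_on)
      (simp add: orthogonal_transformation_linear linear_conv_bounded_linear[symmetric])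
  fix A assume "A \<in> sets (distr uniform_sphere borel f)"
  then have A: "A \<in> sets borel" by simp
  have fA: "f -` A \<in> sets borel"
    using measurable_sets[OF fm A] by simp
  let ?S = "\<lambda>A. cball 0 1 \<inter> {x::real ^ 'd::{finite,wellorder}. x /\<^sub>R norm x \<in> A}"
  have S: "?S B \<in> sets borel" if "B \<in> sets borel" for B
  proof -
    have "(\<lambda>x::real ^ 'd::{finite,wellorder}. x /\<^sub>R norm x) -` B \<in> sets borel"
      using measurable_sets[of "\<lambda>x::real ^ 'd::{finite,wellorder}. x /\<^sub>R norm x" borel borel B] that by simp
    then show ?thesis by (auto simp: vimage_def)
  qed
  have lin: "linear f" and nf: "\<And>x. norm (f x) = norm x"
    using f by (auto simp: orthogonal_transformation)
  have "f ` ?S (f -` A) = ?S A"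
  proof
    show "f ` ?S (f -` A) \<subseteq> ?S A"
      by (auto simp: nf linear_scale[OF lin])
    show "?S A \<subseteq> f ` ?S (f -` A)"
    proof
      fix y assume y: "y \<in> ?S A"
      obtain x where x: "y = f x"
        using orthogonal_transformation_surj[OF f] by (auto elim: surjE)
      with y show "y \<in> f ` ?S (f -` A)"
        by (auto simp: nf linear_scale[OF lin])
    qed
  qed
  moreover have "?S (f -` A) \<in> lmeasurable"
  proof (rule bounded_set_imp_lmeasurable)
    show "bounded (?S (f -` A))" by (rule bounded_subset[of "cball 0 1"]) auto
    show "?S (f -` A) \<in> sets lebesgue" using S[OF fA] by simp
  qed
  ultimately have eq: "measure lebesgue (?S A) = measure lebesgue (?S (f -` A))"
    using measure_orthogonal_image[OF f, of "?S (f -` A)"] by metis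
  have em: "emeasure lborel (?S B) = ennreal (measure lebesgue (?S B))"
    if "B \<in> sets borel" for B
  proof -
    have "?S B \<in> fmeasurable lborel"
      by (rule fmeasurableI2[of "cball 0 1"])
        (use S[OF that] in \<open>auto simp: fmeasurable_def emeasure_cball\<close>)
    then show ?thesis
      using S[OF that] by (simp add: emeasure_eq_measure2 measure_completion)
  qed
  have "emeasure lborel (?S A) = emeasure lborel (?S (f -` A))"
    by (simp only: em[OF A] em[OF fA] eq)
  then show "emeasure (distr uniform_sphere borel f) A = emeasure uniform_sphere A"
    using A fA fm
    by (simp add: emeasure_distr emeasure_uniform_sphere uniform_sphere_def vimage_def)
qed (simp add: uniform_sphere_def)

lemma uniform_sphere_real:
  assumes "x \<in> {-1, 1 :: real}"
  shows "measure uniform_sphere {x} = 1/2"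
proof -
  have c: "cball (0::real) 1 = {-1..1}" by (simp add: cball_eq_atLeastAtMost)
  have 1: "cball 0 1 \<inter> {y::real. y /\<^sub>R norm y \<in> {1}} = {0<..1}"
    by (auto simp: c field_simps abs_if split: if_splits)
  have 2: "cball 0 1 \<inter> {y::real. y /\<^sub>R norm y \<in> {-1}} = {-1..<0}"
    by (auto simp: c field_simps abs_if split: if_splits)
  have "emeasure uniform_sphere {x} = ennreal 1 / ennreal 2"
    using assms 1 2
    by (auto simp: emeasure_uniform_sphere c)
  also have "\<dots> = ennreal (1 / 2)"
    by (rule divide_ennreal) auto
  finally have "emeasure uniform_sphere {x} = ennreal (1 / 2)" .
  then show ?thesis
    by (subst measure_def, simp only:, subst enn2real_ennreal, simp_all)
qed

end

theory Submission
  imports Defs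
begin

text \<open>
  Write \<open>Z\<close> for a standard normal vector and \<open>q u\<close> for the probability that its norm exceeds \<open>u\<close>.
  The cases \<open>a = 0\<close> and \<open>u < 0\<close> are immediate, and otherwise scaling reduces the theorem to \<open>a = 1\<close>.
  The proof first compares moments of the two norms and then turns the comparison of moments into one
  of tails.

  The moments are expectations of \<open>C\<^sup>2\<close> functions \<open>f\<close> with convex Laplacian.  For such \<open>f\<close>, replacing one
  vector \<open>b U\<close> by \<open>(b / sqrt d) Z\<close>, which has the same covariance, does not decrease the expectation
  of \<open>f (x + \<cdot>)\<close> (\<open>sphere_mean_le_gaussian_mean\<close>).  The reason is that the mean \<open>B r\<close> of \<open>f\<close> over the ball
  of radius \<open>r\<close> about \<open>x\<close> is a convex function of \<open>r\<^sup>2\<close> (\<open>convex_ball_mean_sqrt\<close>): the divergence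
  theorem gives \<open>B' r = r K r\<close>, where \<open>K r\<close> averages the convex Laplacian against a radial kernel on
  that ball and so increases with \<open>r\<close>.  This convexity is used at both ends.  The sphere is the
  limit of thin shells, so the spherical mean is \<open>B b + (b / d) B' b\<close>, which by convexity is at most
  \<open>B (b sqrt (1 + 2 / d))\<close> (\<open>sphere_mean_le_ball_mean\<close>); the Gaussian law is a mixture of uniform laws
  on balls whose squared radius has mean \<open>d + 2\<close>, so by Jensen's inequality the same number is at
  most the Gaussian mean.  Since Gaussian laws are closed under convolution
  (\<open>gaussian_convolution\<close>), the vectors can be replaced one at a time
  (\<open>sum_sphere_mean_le_gaussian_mean\<close>).  The comparison is applied to the square of the norm and, for
  \<open>t > 0\<close>, to the cube of the positive part of the norm minus \<open>t\<close>.

  For the tails, \<open>q\<close> is log-concave, hence \<open>q x \<le> q u * exp (l * (u - x))\<close> with the hazard rate \<open>l\<close> at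
  \<open>u\<close> (\<open>norm_tail_le_exponential\<close>).  Integrating this, the \<open>k\<close>-th moment of the positive part of
  \<open>norm Z - t\<close> is at most \<open>q u * exp (l * (u - t)) * k! / l\<^sup>k\<close> (\<open>gaussian_pos_part_moment_le\<close>).
  Markov's inequality with \<open>k = 3\<close> and \<open>t = u - 3 / l\<close> gives the factor \<open>3! (e / 3)\<^sup>3 = 2 e\<^sup>3 / 9\<close>.
  That choice has \<open>t > 0\<close> only if \<open>y = l u > 3\<close>.  For smaller \<open>y\<close> Chebyshev's inequality gives the
  factor \<open>2 e\<^sup>y / y\<^sup>2\<close>, which equals \<open>2 e\<^sup>3 / 9\<close> at \<open>y = 3\<close> and stays below it down to \<open>y = 7 / 5\<close>;
  and for \<open>y \<le> 7 / 5\<close> it suffices that a probability is at most \<open>1 = q 0 \<le> e\<^sup>y q u\<close>.  The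
  inequality is strict because Markov's inequality is strict for the event that the norm exceeds \<open>u\<close>,
  and because \<open>e\<^sup>y < 2 e\<^sup>3 / 9\<close> for \<open>y \<le> 7 / 5\<close> (\<open>tail_less_gaussian_norm_tail\<close>).
\<close>

section \<open>Differentiation under the integral and uniform measure on the ball\<close>

text \<open>
  Only a Lipschitz bound near \<open>r\<close> and differentiability almost everywhere at \<open>r\<close> itself are asked
  for: the integration by parts below differentiates an integrand that has a kink on the unit sphere.
\<close>

lemma has_real_derivative_lebesgue_integral:
  fixes F :: "real \<Rightarrow> 'b \<Rightarrow> real"
  assumes \<delta>: "\<delta> > 0"
    and int: "\<And>s. \<bar>s - r\<bar> < \<delta> \<Longrightarrow> integrable M (F s)"
    and w: "integrable M w"
    and lip: "\<And>s. \<bar>s - r\<bar> < \<delta> \<Longrightarrow> AE v in M. \<bar>F s v - F r v\<bar> \<le> w v * \<bar>s - r\<bar>"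
    and D: "AE v in M. ((\<lambda>s. F s v) has_real_derivative D v) (at r)"
    and Dm: "D \<in> borel_measurable M"
  shows "((\<lambda>s. \<integral>v. F s v \<partial>M) has_real_derivative (\<integral>v. D v \<partial>M)) (at r)"
  unfolding has_field_derivative_iff tendsto_at_iff_sequentially comp_def
proof (intro allI impI)
  fix X :: "nat \<Rightarrow> real"
  assume X: "\<forall>i. X i \<in> UNIV - {r}" and lim: "X \<longlonglongrightarrow> r"
  \<comment> \<open>The first terms of the sequence may lie outside the neighbourhood where the bounds hold.\<close>
  obtain N where N: "\<And>i. i \<ge> N \<Longrightarrow> \<bar>X i - r\<bar> < \<delta>"
    using LIMSEQ_D[OF lim \<delta>] by auto
  define Y where "Y i = X (i + N)" for i
  have Y: "\<bar>Y i - r\<bar> < \<delta>" "Y i \<noteq> r" for i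
    using N X by (auto simp: Y_def)
  have Ylim: "Y \<longlonglongrightarrow> r" unfolding Y_def by (rule LIMSEQ_ignore_initial_segment[OF lim])
  have ir: "integrable M (F r)" using int[of r] \<delta> by simp
  have "(\<lambda>i. \<integral>v. (F (Y i) v - F r v) / (Y i - r) \<partial>M) \<longlonglongrightarrow> (\<integral>v. D v \<partial>M)"
  proof (rule integral_dominated_convergence[OF Dm _ w])
    show "(\<lambda>v. (F (Y i) v - F r v) / (Y i - r)) \<in> borel_measurable M" for i
      using int[OF Y(1)] ir by measurable
    show "AE v in M. (\<lambda>i. (F (Y i) v - F r v) / (Y i - r)) \<longlonglongrightarrow> D v"
      using D
    proof eventually_elim
      case (elim v)
      then show ?case
        using Y(2) Ylim unfolding has_field_derivative_iff tendsto_at_iff_sequentially comp_def by blast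
    qed
    show "AE v in M. norm ((F (Y i) v - F r v) / (Y i - r)) \<le> w v" for i
      using lip[OF Y(1)[of i]]
    proof eventually_elim
      case (elim v)
      have "\<bar>Y i - r\<bar> > 0" using Y(2)[of i] by simp
      then show ?case using elim by (simp add: divide_le_eq)
    qed
  qed
  also have "(\<lambda>i. \<integral>v. (F (Y i) v - F r v) / (Y i - r) \<partial>M)
      = (\<lambda>i. ((\<integral>v. F (Y i) v \<partial>M) - (\<integral>v. F r v \<partial>M)) / (Y i - r))"
    using int[OF Y(1)] ir by (simp add: Bochner_Integration.integral_diff)
  finally show "(\<lambda>i. ((\<integral>v. F (X i) v \<partial>M) - (\<integral>v. F r v \<partial>M)) / (X i - r)) \<longlonglongrightarrow> (\<integral>v. D v \<partial>M)"
    unfolding Y_def by (rule LIMSEQ_offset)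
qed

lemma nn_integral_lborel_affine:
  fixes g :: "'a::euclidean_space \<Rightarrow> ennreal"
  assumes [measurable]: "g \<in> borel_measurable borel" and c: "c \<noteq> 0"
  shows "(\<integral>\<^sup>+z. g z \<partial>lborel) = ennreal (\<bar>c\<bar> ^ DIM('a)) * (\<integral>\<^sup>+z. g (t + c *\<^sub>R z) \<partial>lborel)"
  by (subst lborel_affine[OF c, of t])
    (simp add: nn_integral_density nn_integral_distr nn_integral_cmult)

lemma integral_lborel_affine:
  fixes g :: "'a::euclidean_space \<Rightarrow> real"
  assumes [measurable]: "g \<in> borel_measurable borel" and c: "c \<noteq> 0"
  shows "(\<integral>z. g z \<partial>lborel) = \<bar>c\<bar> ^ DIM('a) * (\<integral>z. g (t + c *\<^sub>R z) \<partial>lborel)"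
  by (subst lborel_affine[OF c, of t])
    (simp add: integral_density integral_distr)

abbreviation uniform_ball :: "'a::euclidean_space measure" where
  "uniform_ball \<equiv> uniform_measure lborel (cball 0 1)"

abbreviation ball_vol :: "'a::euclidean_space itself \<Rightarrow> real" where
  "ball_vol _ \<equiv> measure lborel (cball (0::'a) 1)"

lemma ball_vol_pos: "ball_vol TYPE('a::euclidean_space) > 0"
proof -
  have "unit_ball_vol (real DIM('a)) > 0" by simp
  then show ?thesis by (simp add: content_cball)
qed

lemma emeasure_lborel_cball: "r \<ge> 0 \<Longrightarrow>
  emeasure lborel (cball (0::'a::euclidean_space) r) = ennreal (ball_vol TYPE('a) * r ^ DIM('a))"
  by (simp add: emeasure_cball content_cball)

lemma prob_space_uniform_ball: "prob_space (uniform_ball :: 'a::euclidean_space measure)"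
  by (rule prob_space_uniform_measure[OF emeasure_cball_01])

lemma AE_uniform_ball: "AE v in (uniform_ball :: 'a::euclidean_space measure). norm v \<le> 1"
  by (rule AE_uniform_measureI) auto

lemma nn_integral_uniform_ball:
  fixes g :: "'a::euclidean_space \<Rightarrow> ennreal"
  assumes "g \<in> borel_measurable borel"
  shows "(\<integral>\<^sup>+v. g v * indicator (cball 0 1) v \<partial>lborel) = ennreal (ball_vol TYPE('a)) * (\<integral>\<^sup>+v. g v \<partial>uniform_ball)"
proof -
  have e: "emeasure lborel (cball (0::'a) 1) = ennreal (ball_vol TYPE('a))"
    using emeasure_lborel_cball[of 1, where 'a='a] by simp
  show ?thesis
    using assms ball_vol_pos[where 'a='a]
    by (subst nn_integral_uniform_measure) 
      (auto simp: e mult.commute[of "ennreal _"] ennreal_divide_times ennreal_mult_divide_eq)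
qed

lemma integral_uniform_ball:
  fixes g :: "'a::euclidean_space \<Rightarrow> real"
  assumes [measurable]: "g \<in> borel_measurable borel"
  shows "(\<integral>v. indicator (cball 0 1) v * g v \<partial>lborel) = ball_vol TYPE('a) * (\<integral>v. g v \<partial>uniform_ball)"
proof -
  have "density lborel (\<lambda>v. indicator (cball (0::'a) 1) v / emeasure lborel (cball (0::'a) 1))
      = density lborel (\<lambda>v. ennreal (indicator (cball (0::'a) 1) v / ball_vol TYPE('a)))"
    using ball_vol_pos[where 'a='a] emeasure_lborel_cball[of 1, where 'a='a] 
    by (intro arg_cong[of _ _ "density lborel"] ext) (auto simp: indicator_def divide_ennreal[symmetric])
  then show ?thesis
    using ball_vol_pos[where 'a='a]
    unfolding uniform_measure_def by (simp only:) (subst integral_density; measurable; simp)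
qed

lemma integrable_uniform_ball:
  fixes g :: "'a::euclidean_space \<Rightarrow> real"
  assumes "continuous_on UNIV g"
  shows "integrable uniform_ball g"
proof -
  interpret prob_space "uniform_ball :: 'a measure" by (rule prob_space_uniform_ball)
  have "compact (g ` cball 0 1)"
    using assms by (intro compact_continuous_image continuous_on_subset[OF assms]) auto
  then obtain C where C: "\<forall>y \<in> g ` cball 0 1. norm y \<le> C"
    by (meson bounded_iff compact_imp_bounded)
  show ?thesis
  proof (rule integrable_const_bound)
    show "AE v in uniform_ball. norm (g v) \<le> C"
      using AE_uniform_ball by eventually_elim (use C in auto)
    show "g \<in> borel_measurable uniform_ball"
      using borel_measurable_continuous_onI[OF assms] by simp
  qed
qed

lemma integral_uniform_ball_uminus:
  fixes g :: "'a::euclidean_space \<Rightarrow> real"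
  assumes [measurable]: "g \<in> borel_measurable borel"
  shows "(\<integral>v. g (- v) \<partial>uniform_ball) = (\<integral>v. g v \<partial>uniform_ball)"
proof -
  have "(\<integral>v. indicator (cball 0 1) v * g v \<partial>lborel) = (\<integral>v. indicator (cball 0 1) v * g (- v) \<partial>lborel)"
    by (subst integral_lborel_affine[of _ "-1" 0]) (auto simp: indicator_def)
  then show ?thesis
    using ball_vol_pos[where 'a='a] by (simp add: integral_uniform_ball)
qed

lemma abs_half_one_minus_norm_power2_le:
  assumes "norm (v :: 'a::real_normed_vector) \<le> 1"
  shows "\<bar>(1 - (norm v)\<^sup>2) / 2\<bar> \<le> 1"
proof -
  have "\<bar>(1 - s) / 2\<bar> \<le> 1" if "0 \<le> s" "s \<le> 1" for s :: real
    using that by (simp only: abs_divide abs_of_nonneg divide_le_eq_numeral1)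
  then show ?thesis using assms by (simp only: power_le_one zero_le_power2 norm_ge_zero)
qed

text \<open>
  The divergence theorem on the unit ball, in one direction \<open>e\<close>, without boundary term: the factor
  \<open>(1 - (norm v)\<^sup>2) / 2\<close> vanishes on the sphere and has derivative \<open>- v \<bullet> e\<close>.  The function \<open>G\<close>, which is the product of \<open>p\<close> with that factor cut off
  at zero, is Lipschitz with compact support, the integral of a translate \<open>G (v + s e)\<close> does not depend
  on \<open>s\<close>, and its derivative at \<open>s = 0\<close> is the difference of the two sides.
\<close>

lemma uniform_ball_integration_by_parts:
  fixes p D :: "'a::euclidean_space \<Rightarrow> real"
  assumes p: "continuous_on UNIV p" and Dm[measurable]: "D \<in> borel_measurable borel"
    and lip: "\<And>v w. v \<in> cball 0 3 \<Longrightarrow> w \<in> cball 0 3 \<Longrightarrow> \<bar>p v - p w\<bar> \<le> L * norm (v - w)"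
    and D: "\<And>v. ((\<lambda>\<tau>. p (v + \<tau> *\<^sub>R e)) has_real_derivative D v) (at 0)"
    and e: "norm e = 1"
    and Dint: "integrable uniform_ball D"
  shows "(\<integral>v. (v \<bullet> e) * p v \<partial>uniform_ball) = (\<integral>v. (1 - (norm v)\<^sup>2) / 2 * D v \<partial>uniform_ball)"
proof -
  have pm[measurable]: "p \<in> borel_measurable borel" by (rule borel_measurable_continuous_onI[OF p])
  define \<Psi> where "\<Psi> v = max 0 ((1 - (norm v)\<^sup>2) / 2)" for v :: 'a
  define G where "G v = \<Psi> v * p v" for v
  have \<Psi>_cont: "continuous_on UNIV \<Psi>" unfolding \<Psi>_def by (intro continuous_intros) auto
  have G_cont: "continuous_on UNIV G" unfolding G_def by (intro continuous_intros \<Psi>_cont p)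
  have Gm[measurable]: "G \<in> borel_measurable borel" by (rule borel_measurable_continuous_onI[OF G_cont])
  have L: "L \<ge> 0" using lip[of e 0] e by (metis abs_ge_zero diff_zero mem_cball_0 mult.right_neutral norm_zero
        order_trans zero_le_numeral numeral_le_iff one_le_numeral)
  have \<Psi>_lip: "\<bar>\<Psi> v - \<Psi> w\<bar> \<le> 3 * norm (v - w)" if "norm v \<le> 3" "norm w \<le> 3" for v w
  proof -
    have "\<bar>max 0 ((1 - s) / 2) - max 0 ((1 - t) / 2)\<bar> \<le> \<bar>s - t\<bar> / 2" for s t :: real
      by (simp add: max_def abs_if field_simps)
    then have "\<bar>\<Psi> v - \<Psi> w\<bar> \<le> \<bar>(norm v)\<^sup>2 - (norm w)\<^sup>2\<bar> / 2"
      unfolding \<Psi>_def .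
    also have "(norm v)\<^sup>2 - (norm w)\<^sup>2 = (norm v + norm w) * (norm v - norm w)"
      by (simp add: power2_eq_square algebra_simps)
    also have "\<bar>(norm v + norm w) * (norm v - norm w)\<bar> / 2 \<le> 6 * norm (v - w) / 2"
      unfolding abs_mult using that norm_triangle_ineq3[of v w]
      by (intro divide_right_mono mult_mono) auto
    finally show ?thesis by simp
  qed
  have \<Psi>_bd: "0 \<le> \<Psi> v" "\<Psi> v \<le> 1" for v
  proof -
    show "0 \<le> \<Psi> v" by (simp add: \<Psi>_def)
    have "(1 - s) / 2 \<le> 1" if "0 \<le> s" for s :: real
      using that by (simp only: divide_le_eq_numeral1)
    from this[OF zero_le_power2] show "\<Psi> v \<le> 1" unfolding \<Psi>_def by (rule max.boundedI[OF zero_le_one])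
  qed
  define C where "C = L + 3 * (\<bar>p 0\<bar> + 3 * L)"
  \<comment> \<open>Radius 3 leaves room for translating a point of the ball of radius 2 by less than 1.\<close>
  have G_lip: "\<bar>G v - G w\<bar> \<le> C * norm (v - w)" if vw: "norm v \<le> 3" "norm w \<le> 3" for v w
  proof -
    have "G v - G w = \<Psi> v * (p v - p w) + (\<Psi> v - \<Psi> w) * p w"
      by (simp add: G_def algebra_simps)
    then have "\<bar>G v - G w\<bar> \<le> \<Psi> v * \<bar>p v - p w\<bar> + \<bar>\<Psi> v - \<Psi> w\<bar> * \<bar>p w\<bar>"
      using \<Psi>_bd(1)[of v] abs_triangle_ineq[of "\<Psi> v * (p v - p w)" "(\<Psi> v - \<Psi> w) * p w"]
      by (simp add: abs_mult)
    also have "\<dots> \<le> 1 * (L * norm (v - w)) + (3 * norm (v - w)) * (\<bar>p 0\<bar> + 3 * L)"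
    proof (intro add_mono mult_mono)
      show "\<bar>p v - p w\<bar> \<le> L * norm (v - w)" using lip[of v w] vw by simp
      show "\<bar>\<Psi> v - \<Psi> w\<bar> \<le> 3 * norm (v - w)" by (rule \<Psi>_lip[OF vw])
      have "\<bar>p w - p 0\<bar> \<le> L * norm w" using lip[of w 0] vw by simp
      also have "\<dots> \<le> L * 3" by (rule mult_left_mono) (use vw L in auto)
      finally show "\<bar>p w\<bar> \<le> \<bar>p 0\<bar> + 3 * L" by linarith
    qed (use \<Psi>_bd L in auto)
    finally show ?thesis by (simp add: C_def algebra_simps)
  qed
  have G0: "G v = 0" if "norm v \<ge> 1" for v
    using that by (simp add: G_def \<Psi>_def max_def field_simps power_le_one_iff)
  define D' where "D' v = indicator (cball 0 1) v * ((1 - (norm v)\<^sup>2) / 2 * D v - (v \<bullet> e) * p v)" for v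
  have "((\<lambda>s. \<integral>v. G (v + s *\<^sub>R e) \<partial>lborel) has_real_derivative (\<integral>v. D' v \<partial>lborel)) (at 0)"
  proof (rule has_real_derivative_lebesgue_integral[where \<delta> = 1 and w = "\<lambda>v. C * indicator (cball 0 2) v"])
    show "integrable lborel (\<lambda>v. G (v + s *\<^sub>R e))" if "\<bar>s - 0\<bar> < 1" for s
    proof -
      have "integrable lborel (\<lambda>v. indicator (cball 0 3) v *\<^sub>R G (v + s *\<^sub>R e))"
        by (rule borel_integrable_compact) 
          (auto intro!: continuous_on_compose2[OF G_cont] continuous_intros)
      moreover have "indicator (cball 0 3) v *\<^sub>R G (v + s *\<^sub>R e) = G (v + s *\<^sub>R e)" for v
      proof (cases "v \<in> cball 0 3")
        case False
        have "norm v \<le> norm (v + s *\<^sub>R e) + norm (s *\<^sub>R e)"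
          by (metis add_diff_cancel norm_triangle_ineq4)
        then have "norm (v + s *\<^sub>R e) \<ge> 1" using False that e by simp
        then show ?thesis using G0 by simp
      qed simp
      ultimately show ?thesis by (simp only:)
    qed
    show "integrable lborel (\<lambda>v. C * indicator (cball (0::'a) 2) v)"
      by (simp add: emeasure_cball)
    show "AE v in lborel. \<bar>G (v + s *\<^sub>R e) - G (v + 0 *\<^sub>R e)\<bar> \<le> C * indicator (cball 0 2) v * \<bar>s - 0\<bar>"
      if s: "\<bar>s - 0\<bar> < 1" for s
    proof (rule AE_I2)
      fix v :: 'a
      show "\<bar>G (v + s *\<^sub>R e) - G (v + 0 *\<^sub>R e)\<bar> \<le> C * indicator (cball 0 2) v * \<bar>s - 0\<bar>"
      proof (cases "norm v \<le> 2")
        case True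
        have "norm (v + s *\<^sub>R e) \<le> norm v + norm (s *\<^sub>R e)" by (rule norm_triangle_ineq)
        also have "\<dots> \<le> 3" using True s e by simp
        finally show ?thesis using G_lip[of "v + s *\<^sub>R e" v] True e by simp
      next
        case False
        have "norm v \<le> norm (v + s *\<^sub>R e) + norm (s *\<^sub>R e)"
          by (metis add_diff_cancel norm_triangle_ineq4)
        then have "norm (v + s *\<^sub>R e) \<ge> 1" using False s e by simp
        then show ?thesis using G0 False by simp
      qed
    qed
    have "AE v in lborel. v \<notin> sphere (0::'a) 1"
      using negligible_sphere[of "0::'a" 1] 
      by (intro AE_not_in) (simp add: negligible_iff_null_sets null_sets_completion_iff)
    then show "AE v in lborel. ((\<lambda>s. G (v + s *\<^sub>R e)) has_real_derivative D' v) (at 0)"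
    proof eventually_elim
      case (elim v)
      have cont: "((\<lambda>s. norm (v + s *\<^sub>R e)) \<longlongrightarrow> norm (v + 0 *\<^sub>R e)) (at 0)"
        by (intro tendsto_intros)
      consider "norm v < 1" | "norm v > 1" using elim by fastforce
      then show ?case
      proof cases
        case 1
        have ev: "\<forall>\<^sub>F s in at 0. norm (v + s *\<^sub>R e) < 1"
          using order_tendstoD(2)[OF cont, of 1] 1 by simp
        have "((\<lambda>s. (1 - (norm (v + s *\<^sub>R e))\<^sup>2) / 2 * p (v + s *\<^sub>R e)) has_real_derivative
            ((1 - (norm (v + 0 *\<^sub>R e))\<^sup>2) / 2 * D v + (- (v \<bullet> e)) * p (v + 0 *\<^sub>R e))) (at 0)"
        proof (rule DERIV_mult'[OF _ D])
          have "(\<lambda>s. (1 - (norm (v + s *\<^sub>R e))\<^sup>2) / 2) = (\<lambda>s. (1 - (norm v)\<^sup>2 - 2 * s * (v \<bullet> e) - s\<^sup>2) / 2)"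
            unfolding power2_norm_eq_inner using e by (auto simp: inner_add_left inner_add_right inner_commute
                power2_eq_square norm_eq_1 algebra_simps)
          then show "((\<lambda>s. (1 - (norm (v + s *\<^sub>R e))\<^sup>2) / 2) has_real_derivative - (v \<bullet> e)) (at 0)"
            by (auto intro!: derivative_eq_intros)
        qed
        then have "((\<lambda>s. (1 - (norm (v + s *\<^sub>R e))\<^sup>2) / 2 * p (v + s *\<^sub>R e)) has_real_derivative D' v) (at 0)"
          using 1 by (simp add: D'_def)
        moreover have "\<forall>\<^sub>F s in nhds 0. (1 - (norm (v + s *\<^sub>R e))\<^sup>2) / 2 * p (v + s *\<^sub>R e) = G (v + s *\<^sub>R e)"
        proof -
          have "\<forall>\<^sub>F s in nhds 0. norm (v + s *\<^sub>R e) < 1"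
            using ev 1 by (simp add: eventually_nhds_conv_at)
          then show ?thesis
          proof eventually_elim
            case (elim s)
            then have "(norm (v + s *\<^sub>R e))\<^sup>2 \<le> 1" by (simp add: power_le_one)
            then show ?case by (simp add: G_def \<Psi>_def max_def)
          qed
        qed
        ultimately show ?thesis
          by (subst (asm) DERIV_cong_ev[OF refl _ refl]) 
      next
        case 2
        have ev: "\<forall>\<^sub>F s in at 0. norm (v + s *\<^sub>R e) > 1"
          using order_tendstoD(1)[OF cont, of 1] 2 by simp
        then have "\<forall>\<^sub>F s in nhds 0. 0 = G (v + s *\<^sub>R e)"
          using 2 G0 by (simp add: eventually_nhds_conv_at) (auto elim!: eventually_mono)
        then have "((\<lambda>s. G (v + s *\<^sub>R e)) has_real_derivative 0) (at 0)"
          using DERIV_cong_ev[OF refl _ refl, of "\<lambda>_. 0" "\<lambda>s. G (v + s *\<^sub>R e)" 0 0] DERIV_const by blast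
        then show ?thesis using 2 by (simp add: D'_def)
      qed
    qed
    show "D' \<in> borel_measurable lborel"
      unfolding D'_def by (intro borel_measurable_times borel_measurable_indicator) (simp, measurable)
  qed simp
  moreover have "(\<lambda>s. \<integral>v. G (v + s *\<^sub>R e) \<partial>lborel) = (\<lambda>s. \<integral>v. G v \<partial>lborel)"
  proof
    fix s
    show "(\<integral>v. G (v + s *\<^sub>R e) \<partial>lborel) = (\<integral>v. G v \<partial>lborel)"
      by (subst integral_lborel_affine[of G 1 "s *\<^sub>R e"]) (auto simp: add.commute)
  qed
  ultimately have "(\<integral>v. D' v \<partial>lborel) = 0"
    using DERIV_unique[OF _ DERIV_const] by metis
  then have "(\<integral>v. (1 - (norm v)\<^sup>2) / 2 * D v - (v \<bullet> e) * p v \<partial>uniform_ball) = 0"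
    unfolding D'_def using ball_vol_pos[where 'a='a] by (subst (asm) integral_uniform_ball) auto
  moreover have "integrable uniform_ball (\<lambda>v. (1 - (norm v)\<^sup>2) / 2 * D v)"
  proof (rule Bochner_Integration.integrable_bound[OF Dint])
    show "AE v in uniform_ball. norm ((1 - (norm v)\<^sup>2) / 2 * D v) \<le> norm (D v)"
      using AE_uniform_ball
    proof eventually_elim
      case (elim v)
      then have "\<bar>(1 - (norm v)\<^sup>2) / 2\<bar> \<le> 1" by (rule abs_half_one_minus_norm_power2_le)
      then show ?case using mult_right_mono[of "\<bar>(1 - (norm v)\<^sup>2) / 2\<bar>" 1 "\<bar>D v\<bar>"] by (simp add: abs_mult)
    qed
  qed measurable
  moreover have "integrable uniform_ball (\<lambda>v. (v \<bullet> e) * p v)"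
    by (intro integrable_uniform_ball continuous_intros p)
  ultimately show ?thesis
    by (simp add: Bochner_Integration.integral_diff)
qed

section \<open>Ball means of functions with convex Laplacian\<close>

text \<open>
  Here \<open>P\<close> is the gradient of \<open>f\<close>, \<open>P'\<close> its Hessian and \<open>h\<close> its Laplacian.  Bounds on the
  Hessian on bounded sets give the Lipschitz bounds under which integrals are differentiated below.
\<close>

locale convex_laplacian =
  fixes f :: "'a::euclidean_space \<Rightarrow> real" and P :: "'a \<Rightarrow> 'a" and P' :: "'a \<Rightarrow> 'a \<Rightarrow> 'a"
    and h :: "'a \<Rightarrow> real"
  assumes f_deriv: "\<And>y. (f has_derivative (\<lambda>w. P y \<bullet> w)) (at y)"
    and P_deriv: "\<And>y. (P has_derivative P' y) (at y)"
    and P'_bound: "\<And>R. \<exists>C. \<forall>y. norm y \<le> R \<longrightarrow> (\<forall>w. norm (P' y w) \<le> C * norm w)"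
    and P'_meas: "\<And>e. (\<lambda>y. P' y e) \<in> borel_measurable borel"
    and h_eq: "\<And>y. h y = (\<Sum>e\<in>Basis. P' y e \<bullet> e)"
    and h_convex: "convex_on UNIV h"
    and f_nonneg: "\<And>y. f y \<ge> 0"
begin

lemma f_cont: "continuous_on UNIV f"
  by (rule has_derivative_continuous_on[where f' = "\<lambda>y w. P y \<bullet> w"]) (use f_deriv in auto)

lemma P_cont: "continuous_on UNIV P"
  by (rule has_derivative_continuous_on[where f' = P']) (use P_deriv in auto)

lemma h_cont: "continuous_on UNIV h"
  by (rule convex_on_continuous[OF open_UNIV h_convex])

lemma f_meas [measurable]: "f \<in> borel_measurable borel"
  by (rule borel_measurable_continuous_onI[OF f_cont])

lemma P_Lipschitz: "\<exists>L. L \<ge> 0 \<and> (\<forall>y z. norm y \<le> R \<longrightarrow> norm z \<le> R \<longrightarrow> norm (P y - P z) \<le> L * norm (y - z))"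
proof -
  obtain C where C: "\<And>y w. norm y \<le> R \<Longrightarrow> norm (P' y w) \<le> C * norm w"
    using P'_bound[of R] by blast
  have "norm (P y - P z) \<le> max C 0 * norm (y - z)" if yz: "norm y \<le> R" "norm z \<le> R" for y z
  proof (rule differentiable_bound[of "cball 0 R"])
    show "(P has_derivative P' x) (at x within cball 0 R)" for x
      using P_deriv has_derivative_at_withinI by blast
    show "onorm (P' x) \<le> max C 0" if "x \<in> cball 0 R" for x
    proof (rule onorm_le)
      fix w
      have "norm (P' x w) \<le> C * norm w" using C that by simp
      also have "\<dots> \<le> max C 0 * norm w" by (rule mult_right_mono) auto
      finally show "norm (P' x w) \<le> max C 0 * norm w" .
    qed
  qed (use yz in auto)
  then show ?thesis by (intro exI[of _ "max C 0"]) auto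
qed

lemma f_Lipschitz: "\<exists>L. L \<ge> 0 \<and> (\<forall>y z. norm y \<le> R \<longrightarrow> norm z \<le> R \<longrightarrow> \<bar>f y - f z\<bar> \<le> L * norm (y - z))"
proof -
  have "compact (P ` cball 0 R)"
    by (intro compact_continuous_image continuous_on_subset[OF P_cont]) auto
  then obtain C where C: "\<And>y. norm y \<le> R \<Longrightarrow> norm (P y) \<le> C"
    using bounded_iff[of "P ` cball 0 R"] compact_imp_bounded by (metis image_eqI mem_cball_0)
  have "norm (f y - f z) \<le> max C 0 * norm (y - z)" if yz: "norm y \<le> R" "norm z \<le> R" for y z
  proof (rule differentiable_bound[of "cball 0 R"])
    show "(f has_derivative (\<lambda>w. P x \<bullet> w)) (at x within cball 0 R)" for x
      using f_deriv has_derivative_at_withinI by blast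
    show "onorm (\<lambda>w. P x \<bullet> w) \<le> max C 0" if "x \<in> cball 0 R" for x
    proof (rule onorm_le)
      fix w
      have "norm (P x \<bullet> w) \<le> norm (P x) * norm w" by (simp add: Cauchy_Schwarz_ineq2)
      also have "\<dots> \<le> max C 0 * norm w" by (rule mult_right_mono) (use C[of x] that in auto)
      finally show "norm (P x \<bullet> w) \<le> max C 0 * norm w" .
    qed
  qed (use yz in auto)
  then show ?thesis by (intro exI[of _ "max C 0"]) auto
qed

definition ball_mean :: "'a \<Rightarrow> real \<Rightarrow> real" where
  "ball_mean x r = (\<integral>v. f (x + r *\<^sub>R v) \<partial>uniform_ball)"

text \<open>
  The weight is the kernel that the integration by parts produces: its gradient is the negative of the
  radial field along which the ball is dilated when \<open>r\<close> grows.
\<close>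

definition weighted_laplacian_mean :: "'a \<Rightarrow> real \<Rightarrow> real" where
  "weighted_laplacian_mean x r = (\<integral>v. (1 - (norm v)\<^sup>2) / 2 * h (x + r *\<^sub>R v) \<partial>uniform_ball)"

lemma affine_cont: "continuous_on UNIV g \<Longrightarrow> continuous_on UNIV (\<lambda>v. g (x + r *\<^sub>R v))" for g :: "'a \<Rightarrow> 'b::topological_space" and x :: 'a
  by (rule continuous_on_compose2[of UNIV g]) (auto intro!: continuous_intros)

text \<open>
  The left-hand side is the derivative of \<open>ball_mean x\<close> at \<open>r\<close>.  Integrating by parts in every
  coordinate direction, the derivatives of the gradient add up to the Laplacian, and the chain rule
  contributes the factor \<open>r\<close>.
\<close>

lemma integral_gradient:
  "(\<integral>v. P (x + r *\<^sub>R v) \<bullet> v \<partial>uniform_ball) = r * weighted_laplacian_mean x r"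
proof -
  interpret prob_space "uniform_ball :: 'a measure" by (rule prob_space_uniform_ball)
  note [measurable] = P'_meas
  define D where "D e v = r * (P' (x + r *\<^sub>R v) e \<bullet> e)" for e v
  have Dint: "integrable uniform_ball (D e)" if e: "e \<in> Basis" for e
  proof -
    obtain C where C: "\<And>y w. norm y \<le> norm x + \<bar>r\<bar> \<Longrightarrow> norm (P' y w) \<le> C * norm w"
      using P'_bound[of "norm x + \<bar>r\<bar>"] by blast
    show ?thesis
    proof (rule integrable_const_bound)
      show "AE v in uniform_ball. norm (D e v) \<le> \<bar>r\<bar> * C"
        using AE_uniform_ball
      proof eventually_elim
        case (elim v)
        have "norm (x + r *\<^sub>R v) \<le> norm x + norm (r *\<^sub>R v)" by (rule norm_triangle_ineq)
        also have "\<dots> \<le> norm x + \<bar>r\<bar>" using elim by (simp add: mult_left_le)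
        finally have "norm (P' (x + r *\<^sub>R v) e) \<le> C" using C[of _ e] e by simp
        moreover have "\<bar>P' (x + r *\<^sub>R v) e \<bullet> e\<bar> \<le> norm (P' (x + r *\<^sub>R v) e)"
          using Basis_le_norm[OF e] by simp
        ultimately show ?case unfolding D_def by (simp add: abs_mult mult_left_mono)
      qed
      show "D e \<in> borel_measurable uniform_ball" unfolding D_def by simp
    qed
  qed
  have parts: "(\<integral>v. (v \<bullet> e) * (P (x + r *\<^sub>R v) \<bullet> e) \<partial>uniform_ball)
      = (\<integral>v. (1 - (norm v)\<^sup>2) / 2 * D e v \<partial>uniform_ball)" if e: "e \<in> Basis" for e
  proof -
    obtain L where L: "L \<ge> 0" "\<And>y z. norm y \<le> norm x + 3 * \<bar>r\<bar> \<Longrightarrow> norm z \<le> norm x + 3 * \<bar>r\<bar>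
        \<Longrightarrow> norm (P y - P z) \<le> L * norm (y - z)"
      using P_Lipschitz[of "norm x + 3 * \<bar>r\<bar>"] by blast
    show ?thesis
    proof (rule uniform_ball_integration_by_parts[where L = "L * \<bar>r\<bar>"])
      show "continuous_on UNIV (\<lambda>v. P (x + r *\<^sub>R v) \<bullet> e)"
        by (intro continuous_intros affine_cont P_cont)
      show "D e \<in> borel_measurable borel" unfolding D_def by simp
      fix v w :: 'a
      show "\<bar>P (x + r *\<^sub>R v) \<bullet> e - P (x + r *\<^sub>R w) \<bullet> e\<bar> \<le> L * \<bar>r\<bar> * norm (v - w)"
        if "v \<in> cball 0 3" "w \<in> cball 0 3"
      proof -
        have bd: "norm (x + r *\<^sub>R v) \<le> norm x + 3 * \<bar>r\<bar>" if "norm v \<le> 3" for v :: 'a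
        proof -
          have "norm (x + r *\<^sub>R v) \<le> norm x + norm (r *\<^sub>R v)" by (rule norm_triangle_ineq)
          also have "norm (r *\<^sub>R v) \<le> 3 * \<bar>r\<bar>"
            using mult_left_mono[OF that, of "\<bar>r\<bar>"] by (simp add: mult.commute)
          finally show ?thesis by simp
        qed
        have "\<bar>(P (x + r *\<^sub>R v) - P (x + r *\<^sub>R w)) \<bullet> e\<bar> \<le> norm (P (x + r *\<^sub>R v) - P (x + r *\<^sub>R w))"
          by (rule Basis_le_norm[OF e])
        also have "\<dots> \<le> L * norm ((x + r *\<^sub>R v) - (x + r *\<^sub>R w))"
          using that by (intro L(2) bd) auto
        also have "(x + r *\<^sub>R v) - (x + r *\<^sub>R w) = r *\<^sub>R (v - w)" by (simp add: algebra_simps)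
        finally show ?thesis by (simp add: inner_diff_left mult.assoc)
      qed
      show "((\<lambda>\<tau>. P (x + r *\<^sub>R (v + \<tau> *\<^sub>R e)) \<bullet> e) has_real_derivative D e v) (at 0)"
      proof -
        have "((\<lambda>\<tau>. x + r *\<^sub>R (v + \<tau> *\<^sub>R e)) has_derivative (\<lambda>\<tau>. r *\<^sub>R \<tau> *\<^sub>R e)) (at 0)"
          by (auto intro!: derivative_eq_intros)
        then have "((\<lambda>\<tau>. P (x + r *\<^sub>R (v + \<tau> *\<^sub>R e))) has_derivative (\<lambda>\<tau>. P' (x + r *\<^sub>R v) (r *\<^sub>R \<tau> *\<^sub>R e))) (at 0)"
          by (rule has_derivative_compose) (use P_deriv[of "x + r *\<^sub>R v"] in simp)
        then have "((\<lambda>\<tau>. P (x + r *\<^sub>R (v + \<tau> *\<^sub>R e)) \<bullet> e) has_derivative (\<lambda>\<tau>. P' (x + r *\<^sub>R v) (r *\<^sub>R \<tau> *\<^sub>R e) \<bullet> e)) (at 0)"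
          by (rule has_derivative_inner_left)
        moreover have "P' (x + r *\<^sub>R v) (r *\<^sub>R \<tau> *\<^sub>R e) \<bullet> e = D e v * \<tau>" for \<tau>
        proof -
          have "linear (P' (x + r *\<^sub>R v))"
            using P_deriv has_derivative_linear by blast
          then show ?thesis by (simp add: linear_cmul D_def)
        qed
        ultimately show ?thesis by (simp add: has_field_derivative_def)
      qed
    qed (use e Dint in auto)
  qed
  have "(\<integral>v. P (x + r *\<^sub>R v) \<bullet> v \<partial>uniform_ball)
      = (\<integral>v. (\<Sum>e\<in>Basis. (v \<bullet> e) * (P (x + r *\<^sub>R v) \<bullet> e)) \<partial>uniform_ball)"
    by (subst euclidean_inner) (simp add: mult.commute)
  also have "\<dots> = (\<Sum>e\<in>Basis. \<integral>v. (v \<bullet> e) * (P (x + r *\<^sub>R v) \<bullet> e) \<partial>uniform_ball)"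
    by (intro Bochner_Integration.integral_sum integrable_uniform_ball continuous_intros affine_cont P_cont)
  also have "\<dots> = (\<Sum>e\<in>Basis. \<integral>v. (1 - (norm v)\<^sup>2) / 2 * D e v \<partial>uniform_ball)"
    by (intro sum.cong refl parts)
  also have "\<dots> = (\<integral>v. (\<Sum>e\<in>Basis. (1 - (norm v)\<^sup>2) / 2 * D e v) \<partial>uniform_ball)"
  proof (rule Bochner_Integration.integral_sum[symmetric])
    fix e :: 'a assume e: "e \<in> Basis"
    show "integrable uniform_ball (\<lambda>v. (1 - (norm v)\<^sup>2) / 2 * D e v)"
    proof (rule Bochner_Integration.integrable_bound[OF Dint[OF e]])
      show "AE v in uniform_ball. norm ((1 - (norm v)\<^sup>2) / 2 * D e v) \<le> norm (D e v)"
        using AE_uniform_ball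
      proof eventually_elim
        case (elim v)
        then have "\<bar>(1 - (norm v)\<^sup>2) / 2\<bar> \<le> 1" by (rule abs_half_one_minus_norm_power2_le)
        then show ?case using mult_right_mono[of "\<bar>(1 - (norm v)\<^sup>2) / 2\<bar>" 1 "\<bar>D e v\<bar>"] by (simp add: abs_mult)
      qed
    qed (simp add: D_def)
  qed
  also have "\<dots> = (\<integral>v. r * ((1 - (norm v)\<^sup>2) / 2 * h (x + r *\<^sub>R v)) \<partial>uniform_ball)"
  proof -
    have "(\<Sum>e\<in>Basis. w * D e v) = r * (w * h (x + r *\<^sub>R v))" for w v
      by (simp add: D_def h_eq sum_distrib_left mult_ac)
    then show ?thesis by (simp only:)
  qed
  finally show ?thesis by (simp add: weighted_laplacian_mean_def)
qed

lemma ball_mean_deriv: "(ball_mean x has_real_derivative r * weighted_laplacian_mean x r) (at r)"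
proof -
  interpret prob_space "uniform_ball :: 'a measure" by (rule prob_space_uniform_ball)
  define R where "R = norm x + \<bar>r\<bar> + 1"
  obtain L where L: "L \<ge> 0" "\<And>y z. norm y \<le> R \<Longrightarrow> norm z \<le> R \<Longrightarrow> \<bar>f y - f z\<bar> \<le> L * norm (y - z)"
    using f_Lipschitz[of R] by blast
  have "((\<lambda>s. \<integral>v. f (x + s *\<^sub>R v) \<partial>uniform_ball) has_real_derivative (\<integral>v. P (x + r *\<^sub>R v) \<bullet> v \<partial>uniform_ball)) (at r)"
  proof (rule has_real_derivative_lebesgue_integral[where \<delta> = 1 and w = "\<lambda>_. L"])
    show "integrable uniform_ball (\<lambda>v. f (x + s *\<^sub>R v))" for s
      by (intro integrable_uniform_ball affine_cont f_cont)
    show "AE v in uniform_ball. \<bar>f (x + s *\<^sub>R v) - f (x + r *\<^sub>R v)\<bar> \<le> L * \<bar>s - r\<bar>" if s: "\<bar>s - r\<bar> < 1" for s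
      using AE_uniform_ball
    proof eventually_elim
      case (elim v)
      have bd: "norm (x + t *\<^sub>R v) \<le> R" if "\<bar>t\<bar> \<le> \<bar>r\<bar> + 1" for t
      proof -
        have "norm (x + t *\<^sub>R v) \<le> norm x + norm (t *\<^sub>R v)" by (rule norm_triangle_ineq)
        also have "norm (t *\<^sub>R v) \<le> \<bar>r\<bar> + 1"
          using mult_mono[OF that elim] by simp
        finally show ?thesis by (simp add: R_def)
      qed
      have "\<bar>f (x + s *\<^sub>R v) - f (x + r *\<^sub>R v)\<bar> \<le> L * norm ((x + s *\<^sub>R v) - (x + r *\<^sub>R v))"
        by (rule L(2)[OF bd bd]) (use s in linarith)+
      also have "(x + s *\<^sub>R v) - (x + r *\<^sub>R v) = (s - r) *\<^sub>R v" by (simp add: algebra_simps)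
      also have "L * norm ((s - r) *\<^sub>R v) \<le> L * \<bar>s - r\<bar>"
        using elim L(1) by (intro mult_left_mono) (auto simp: mult_left_le)
      finally show ?case .
    qed
    show "AE v in uniform_ball. ((\<lambda>s. f (x + s *\<^sub>R v)) has_real_derivative P (x + r *\<^sub>R v) \<bullet> v) (at r)"
    proof (rule AE_I2)
      fix v
      have "((\<lambda>s. x + s *\<^sub>R v) has_derivative (\<lambda>s. s *\<^sub>R v)) (at r)"
        by (auto intro!: derivative_eq_intros)
      then have "((\<lambda>s. f (x + s *\<^sub>R v)) has_derivative (\<lambda>s. P (x + r *\<^sub>R v) \<bullet> (s *\<^sub>R v))) (at r)"
        by (rule has_derivative_compose) (rule f_deriv)
      then show "((\<lambda>s. f (x + s *\<^sub>R v)) has_real_derivative P (x + r *\<^sub>R v) \<bullet> v) (at r)"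
        by (simp add: has_field_derivative_def mult_commute_abs)
    qed
    show "(\<lambda>v. P (x + r *\<^sub>R v) \<bullet> v) \<in> borel_measurable uniform_ball"
      using borel_measurable_continuous_onI[of "\<lambda>v. P (x + r *\<^sub>R v) \<bullet> v"]
      by (simp add: continuous_intros affine_cont P_cont)
  qed auto
  then show ?thesis by (simp add: integral_gradient ball_mean_def[abs_def])
qed

text \<open>
  Since \<open>h\<close> is convex and the weighted ball is symmetric, \<open>r \<mapsto> weighted_laplacian_mean x r\<close> is convex
  and even.
\<close>

lemma weighted_laplacian_mean_mono:
  assumes "0 \<le> r" "r \<le> s"
  shows "weighted_laplacian_mean x r \<le> weighted_laplacian_mean x s"
proof (cases "s = 0")
  case False
  then have s: "s > 0" using assms by simp
  \<comment> \<open>The weight that makes r a convex combination of s and - s.\<close>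
  define \<theta> where "\<theta> = (s + r) / (2 * s)"
  have \<theta>: "0 \<le> \<theta>" "\<theta> \<le> 1" "r = \<theta> * s + (1 - \<theta>) * (- s)"
    using s assms by (auto simp: \<theta>_def field_simps)
  define g where "g v = (1 - (norm v)\<^sup>2) / 2 * h (x + s *\<^sub>R v)" for v
  have g_cont: "continuous_on UNIV g" unfolding g_def by (intro continuous_intros affine_cont h_cont) auto
  have gm_cont: "continuous_on UNIV (\<lambda>v. g (- v))" 
    by (rule continuous_on_compose2[OF g_cont]) (auto intro!: continuous_intros)
  have "weighted_laplacian_mean x r \<le> (\<integral>v. \<theta> * g v + (1 - \<theta>) * g (- v) \<partial>uniform_ball)"
    unfolding weighted_laplacian_mean_def
  proof (rule integral_mono_AE)
    show "integrable uniform_ball (\<lambda>v. (1 - (norm v)\<^sup>2) / 2 * h (x + r *\<^sub>R v))"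
      by (intro integrable_uniform_ball continuous_intros affine_cont h_cont) auto
    show "integrable uniform_ball (\<lambda>v. \<theta> * g v + (1 - \<theta>) * g (- v))"
      by (intro integrable_uniform_ball continuous_intros g_cont gm_cont)
    show "AE v in uniform_ball. (1 - (norm v)\<^sup>2) / 2 * h (x + r *\<^sub>R v) \<le> \<theta> * g v + (1 - \<theta>) * g (- v)"
      using AE_uniform_ball
    proof eventually_elim
      case (elim v)
      have "x + r *\<^sub>R v = \<theta> *\<^sub>R (x + s *\<^sub>R v) + (1 - \<theta>) *\<^sub>R (x + s *\<^sub>R (- v))"
        by (rule euclidean_eqI, subst \<theta>(3)) (simp add: inner_add_left algebra_simps)
      also have "h \<dots> \<le> \<theta> * h (x + s *\<^sub>R v) + (1 - \<theta>) * h (x + s *\<^sub>R (- v))"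
        using h_convex \<theta> unfolding convex_on_def by auto
      finally have "(1 - (norm v)\<^sup>2) / 2 * h (x + r *\<^sub>R v) 
          \<le> (1 - (norm v)\<^sup>2) / 2 * (\<theta> * h (x + s *\<^sub>R v) + (1 - \<theta>) * h (x + s *\<^sub>R (- v)))"
        using elim by (intro mult_left_mono) (auto simp: power_le_one)
      moreover have "w * (\<theta> * a + (1 - \<theta>) * b) = \<theta> * (w * a) + (1 - \<theta>) * (w * b)" for w a b :: real
        by (simp add: algebra_simps)
      ultimately show ?case by (simp only: g_def norm_minus_cancel)
    qed
  qed
  also have "\<dots> = \<theta> * (\<integral>v. g v \<partial>uniform_ball) + (1 - \<theta>) * (\<integral>v. g (- v) \<partial>uniform_ball)"
    by (simp add: integrable_uniform_ball g_cont gm_cont)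
  also have "\<dots> = (\<integral>v. g v \<partial>uniform_ball)"
    using borel_measurable_continuous_onI[OF g_cont]
    by (simp add: integral_uniform_ball_uminus algebra_simps)
  finally show ?thesis by (simp add: weighted_laplacian_mean_def g_def)
qed (use assms in auto)

lemma ball_mean_even: "ball_mean x (- r) = ball_mean x r"
proof -
  have "(\<lambda>v. f (x + r *\<^sub>R v)) \<in> borel_measurable borel"
    by (intro borel_measurable_continuous_onI affine_cont f_cont)
  from integral_uniform_ball_uminus[OF this] show ?thesis by (simp add: ball_mean_def)
qed

lemma ball_mean_sqrt: "ball_mean x (sqrt (r\<^sup>2)) = ball_mean x r"
  by (simp add: abs_if ball_mean_even)

text \<open>
  In the variable \<open>s = r\<^sup>2\<close> the factor \<open>r\<close> of the derivative cancels, and what remains is increasing.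
  This is why ball means are convex as functions of the squared radius.
\<close>

lemma ball_mean_sqrt_deriv:
  assumes "s > 0"
  shows "((\<lambda>s. ball_mean x (sqrt s)) has_real_derivative weighted_laplacian_mean x (sqrt s) / 2) (at s)"
proof -
  have "((\<lambda>s. ball_mean x (sqrt s)) has_real_derivative 
      sqrt s * weighted_laplacian_mean x (sqrt s) * (inverse (sqrt s) / 2)) (at s)"
    by (rule DERIV_chain2[OF ball_mean_deriv DERIV_real_sqrt]) (use assms in simp)
  then show ?thesis using assms by (simp add: field_simps)
qed

lemma convex_ball_mean_sqrt: "convex_on {0<..} (\<lambda>s. ball_mean x (sqrt s))"
proof (rule convex_on_realI)
  fix s t :: real
  show "((\<lambda>s. ball_mean x (sqrt s)) has_real_derivative weighted_laplacian_mean x (sqrt s) / 2) (at s)"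
    if "s \<in> {0<..}"
    using that by (intro ball_mean_sqrt_deriv) simp
  show "weighted_laplacian_mean x (sqrt s) / 2 \<le> weighted_laplacian_mean x (sqrt t) / 2"
    if "s \<in> {0<..}" "s \<le> t"
    using that by (intro divide_right_mono weighted_laplacian_mean_mono) auto
qed simp

end

section \<open>Spherical means as limits of shell means\<close>

lemma integral_cball_scale:
  fixes g :: "'a::euclidean_space \<Rightarrow> real"
  assumes [measurable]: "g \<in> borel_measurable borel" and r: "r > 0"
  shows "(\<integral>v. indicator (cball 0 r) v * g v \<partial>lborel)
    = r ^ DIM('a) * (ball_vol TYPE('a) * (\<integral>v. g (r *\<^sub>R v) \<partial>uniform_ball))"
proof -
  have m: "(\<lambda>v. indicator (cball 0 r) v * g v) \<in> borel_measurable borel"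
    by (intro borel_measurable_times borel_measurable_indicator) auto
  have ind: "indicator (cball 0 r) (0 + r *\<^sub>R v) = (indicator (cball 0 1) v :: real)" for v :: 'a
    using r by (simp add: indicator_def mult_le_cancel_left1)
  show ?thesis
    using r by (subst integral_lborel_affine[OF m, of r 0]) (auto simp only: ind integral_uniform_ball, simp_all add: integral_uniform_ball)
qed

lemma nn_integral_cball_scale:
  fixes g :: "'a::euclidean_space \<Rightarrow> ennreal"
  assumes [measurable]: "g \<in> borel_measurable borel" and r: "r > 0"
  shows "(\<integral>\<^sup>+v. g v * indicator (cball 0 r) v \<partial>lborel)
    = ennreal (r ^ DIM('a)) * (ennreal (ball_vol TYPE('a)) * (\<integral>\<^sup>+v. g (r *\<^sub>R v) \<partial>uniform_ball))"
proof -
  have m: "(\<lambda>v. g v * indicator (cball 0 r) v) \<in> borel_measurable borel"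
    by (intro borel_measurable_times_ennreal borel_measurable_indicator) auto
  have ind: "indicator (cball 0 r) (0 + r *\<^sub>R v) = (indicator (cball 0 1) v :: ennreal)" for v :: 'a
    using r by (simp add: indicator_def mult_le_cancel_left1)
  show ?thesis
    using r by (subst nn_integral_lborel_affine[OF m, of r 0]) (auto simp only: ind, simp_all add: nn_integral_uniform_ball)
qed

lemma integrable_cball_bounded:
  fixes g :: "'a::euclidean_space \<Rightarrow> real"
  assumes [measurable]: "g \<in> borel_measurable borel" and C: "\<And>v. norm v \<le> r \<Longrightarrow> \<bar>g v\<bar> \<le> C"
  shows "integrable lborel (\<lambda>v. indicator (cball 0 r) v * g v)"
proof (rule Bochner_Integration.integrable_bound[where f = "\<lambda>v. C * indicator (cball 0 r) v"])
  show "integrable lborel (\<lambda>v. C * indicator (cball (0::'a) r) v)"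
    by (cases "r \<ge> 0") (auto simp: emeasure_cball)
  show "(\<lambda>v. indicator (cball 0 r) v * g v) \<in> borel_measurable lborel"
    by (intro borel_measurable_times borel_measurable_indicator) auto
  show "AE v in lborel. norm (indicator (cball 0 r) v * g v) \<le> norm (C * indicator (cball 0 r) v)"
  proof (rule AE_I2)
    fix v :: 'a
    show "norm (indicator (cball 0 r) v * g v) \<le> norm (C * indicator (cball 0 r) v)"
      using C[of v] by (auto simp: indicator_def)
  qed
qed

lemma integral_uniform_sphere:
  fixes g :: "'a::euclidean_space \<Rightarrow> real"
  assumes [measurable]: "g \<in> borel_measurable borel"
  shows "(\<integral>u. g u \<partial>uniform_sphere) = (\<integral>v. g (v /\<^sub>R norm v) \<partial>uniform_ball)"
  unfolding uniform_sphere_def by (subst integral_distr) auto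

text \<open>
  The shell \<open>1 < norm v \<le> \<kappa>\<close> carries the mass \<open>\<kappa> ^ d - 1\<close> relative to the ball, its radial projection is
  uniform on the sphere because \<open>uniform_sphere\<close> is defined by cones, and the projection moves a point
  of the shell by at most \<open>\<kappa> - 1\<close>.
\<close>

lemma sphere_mean_le_shell_mean:
  fixes \<phi> :: "'a::euclidean_space \<Rightarrow> real"
  assumes cont: "continuous_on UNIV \<phi>"
    and L: "L \<ge> 0" "\<And>v w. norm v \<le> 2 \<Longrightarrow> norm w \<le> 2 \<Longrightarrow> \<bar>\<phi> v - \<phi> w\<bar> \<le> L * norm (v - w)"
    and \<kappa>: "1 < \<kappa>" "\<kappa> \<le> 2"
  shows "(\<kappa> ^ DIM('a) - 1) * (\<integral>u. \<phi> u \<partial>uniform_sphere) \<le>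
    \<kappa> ^ DIM('a) * (\<integral>v. \<phi> (\<kappa> *\<^sub>R v) \<partial>uniform_ball) - (\<integral>v. \<phi> v \<partial>uniform_ball)
      + L * (\<kappa> - 1) * (\<kappa> ^ DIM('a) - 1)"
proof -
  interpret prob_space "uniform_ball :: 'a measure" by (rule prob_space_uniform_ball)
  define V where "V = ball_vol TYPE('a)"
  have V: "V > 0" unfolding V_def by (rule ball_vol_pos)
  have [measurable]: "\<phi> \<in> borel_measurable borel" by (rule borel_measurable_continuous_onI[OF cont])
  define C where "C = \<bar>\<phi> 0\<bar> + L * 2"
  have C: "\<bar>\<phi> v\<bar> \<le> C" if "norm v \<le> 2" for v
  proof -
    have "\<bar>\<phi> v - \<phi> 0\<bar> \<le> L * norm (v - 0)" by (rule L(2)) (use that in auto)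
    also have "\<dots> \<le> L * 2" using that L(1) by (intro mult_left_mono) auto
    finally show ?thesis by (simp add: C_def)
  qed
  \<comment> \<open>The function of degree zero that agrees with \<open>\<phi>\<close> on the sphere; on the shell it is compared with \<open>\<phi>\<close>.\<close>
  define \<psi> where "\<psi> v = \<phi> (v /\<^sub>R norm v)" for v
  have \<psi>m[measurable]: "\<psi> \<in> borel_measurable borel" unfolding \<psi>_def by measurable
  have \<psi>C: "\<bar>\<psi> v\<bar> \<le> C" for v
    unfolding \<psi>_def by (rule C) (cases "v = 0", auto)
  let ?I = "\<lambda>r (v::'a). indicator (cball 0 r) v :: real"
  have int: "integrable lborel (\<lambda>v. ?I r v * g v)" if "r \<le> 2" "g \<in> {\<phi>, \<psi>, \<lambda>_. L * (\<kappa> - 1)}" for r g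
  proof (rule integrable_cball_bounded[where C = "max C (L * (\<kappa> - 1))"])
    show "g \<in> borel_measurable borel" using that by auto
    fix v :: 'a assume "norm v \<le> r"
    then have "\<bar>\<phi> v\<bar> \<le> C" using that(1) by (intro C) simp
    moreover have "\<bar>L * (\<kappa> - 1)\<bar> = L * (\<kappa> - 1)" using L(1) \<kappa> by simp
    ultimately show "\<bar>g v\<bar> \<le> max C (L * (\<kappa> - 1))"
      using that(2) \<psi>C[of v] by (auto simp: le_max_iff_disj)
  qed
  have mono: "(\<integral>v. (?I \<kappa> v * \<psi> v - ?I 1 v * \<psi> v) - (?I \<kappa> v * \<phi> v - ?I 1 v * \<phi> v) \<partial>lborel)
      \<le> (\<integral>v. ?I \<kappa> v * (L * (\<kappa> - 1)) - ?I 1 v * (L * (\<kappa> - 1)) \<partial>lborel)"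
  proof (rule integral_mono)
    show "integrable lborel (\<lambda>v. (?I \<kappa> v * \<psi> v - ?I 1 v * \<psi> v) - (?I \<kappa> v * \<phi> v - ?I 1 v * \<phi> v))"
      using \<kappa> by (intro Bochner_Integration.integrable_diff int) auto
    show "integrable lborel (\<lambda>v. ?I \<kappa> v * (L * (\<kappa> - 1)) - ?I 1 v * (L * (\<kappa> - 1)))"
      using \<kappa> by (intro Bochner_Integration.integrable_diff int) auto
    fix v :: 'a
    show "(?I \<kappa> v * \<psi> v - ?I 1 v * \<psi> v) - (?I \<kappa> v * \<phi> v - ?I 1 v * \<phi> v)
        \<le> ?I \<kappa> v * (L * (\<kappa> - 1)) - ?I 1 v * (L * (\<kappa> - 1))"
    proof (cases "1 < norm v \<and> norm v \<le> \<kappa>")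
      case True
      have "v \<noteq> 0" using True by auto
      then have n: "norm (v /\<^sub>R norm v) \<le> 2" "norm v \<le> 2" using True \<kappa> by simp_all
      have "\<psi> v - \<phi> v \<le> L * norm (v /\<^sub>R norm v - v)"
        using L(2)[OF n] unfolding \<psi>_def by linarith
      also have "v /\<^sub>R norm v - v = (inverse (norm v) - 1) *\<^sub>R v" by (simp add: algebra_simps)
      also have "norm ((inverse (norm v) - 1) *\<^sub>R v) = norm v - 1"
      proof -
        have "inverse (norm v) \<le> 1" using True by (intro inverse_le_1_iff[THEN iffD2]) auto
        then have "\<bar>inverse (norm v) - 1\<bar> = 1 - inverse (norm v)" by simp
        then show ?thesis using \<open>v \<noteq> 0\<close> by (simp only: norm_scaleR) (simp add: left_diff_distrib)
      qed
      also have "L * (norm v - 1) \<le> L * (\<kappa> - 1)" using True L(1) by (intro mult_left_mono) auto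
      finally show ?thesis using True by simp
    next
      case False
      then consider "norm v \<le> 1" | "norm v > \<kappa>" by linarith
      then show ?thesis using \<kappa> by cases auto
    qed
  qed
  have e1: "(\<integral>v. (?I \<kappa> v * \<psi> v - ?I 1 v * \<psi> v) - (?I \<kappa> v * \<phi> v - ?I 1 v * \<phi> v) \<partial>lborel)
     = ((\<integral>v. ?I \<kappa> v * \<psi> v \<partial>lborel) - (\<integral>v. ?I 1 v * \<psi> v \<partial>lborel)) - ((\<integral>v. ?I \<kappa> v * \<phi> v \<partial>lborel) - (\<integral>v. ?I 1 v * \<phi> v \<partial>lborel))"
    using \<kappa> by (subst Bochner_Integration.integral_diff Bochner_Integration.integral_diff; (intro Bochner_Integration.integrable_diff int)?; simp)+
  have e2: "(\<integral>v. ?I \<kappa> v * (L * (\<kappa> - 1)) - ?I 1 v * (L * (\<kappa> - 1)) \<partial>lborel)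
     = (\<integral>v. ?I \<kappa> v * (L * (\<kappa> - 1)) \<partial>lborel) - (\<integral>v. ?I 1 v * (L * (\<kappa> - 1)) \<partial>lborel)"
    using \<kappa> by (intro Bochner_Integration.integral_diff int) auto
  have i1: "(\<integral>v. ?I r v * (L * (\<kappa> - 1)) \<partial>lborel) = r ^ DIM('a) * (V * (L * (\<kappa> - 1)))" if "r > 0" for r
    using that prob_space by (subst integral_cball_scale) (auto simp: V_def)
  have i2: "(\<integral>v. ?I r v * \<psi> v \<partial>lborel) = r ^ DIM('a) * (V * (\<integral>u. \<phi> u \<partial>uniform_sphere))" if r: "r > 0" for r
  proof -
    have "inverse (norm (r *\<^sub>R v)) * r = inverse (norm v)" for v :: 'a
      using r by (cases "v = 0") (auto simp: field_simps)
    then have "\<psi> (r *\<^sub>R v) = \<psi> v" for v by (simp only: \<psi>_def scaleR_scaleR)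
    then show ?thesis
      by (subst integral_cball_scale[OF \<psi>m r]) (simp add: V_def integral_uniform_sphere \<psi>_def)
  qed
  have i3: "(\<integral>v. ?I r v * \<phi> v \<partial>lborel) = r ^ DIM('a) * (V * (\<integral>v. \<phi> (r *\<^sub>R v) \<partial>uniform_ball))" if r: "r > 0" for r
    unfolding V_def by (rule integral_cball_scale[OF _ r]) simp
  have k: "(1 :: real) > 0" "\<kappa> > 0" using \<kappa> by auto
  have "V * ((\<kappa> ^ DIM('a) - 1) * (\<integral>u. \<phi> u \<partial>uniform_sphere)) \<le> V * (
    \<kappa> ^ DIM('a) * (\<integral>v. \<phi> (\<kappa> *\<^sub>R v) \<partial>uniform_ball) - (\<integral>v. \<phi> v \<partial>uniform_ball)
      + L * (\<kappa> - 1) * (\<kappa> ^ DIM('a) - 1))"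
    using mono unfolding e1 e2 i1[OF k(1)] i1[OF k(2)] i2[OF k(1)] i2[OF k(2)] i3[OF k(1)] i3[OF k(2)]
    by (simp add: algebra_simps)
  then show ?thesis using V by simp
qed

context convex_laplacian
begin

text \<open>
  With \<open>\<beta> s = ball_mean x (sqrt s)\<close>, letting the shell shrink to the sphere shows that the spherical mean
  is \<open>\<beta> (b\<^sup>2) + (2 b\<^sup>2 / d) \<beta>' (b\<^sup>2)\<close>: the tangent of \<open>\<beta>\<close> at \<open>b\<^sup>2\<close>, evaluated at \<open>b\<^sup>2 (1 + 2 / d)\<close>.
  A convex function lies above its tangents.  The proof replaces the tangent by chords to which the
  shell estimate applies directly.
\<close>

lemma sphere_mean_le_ball_mean:
  "(\<integral>u. f (x + b *\<^sub>R u) \<partial>uniform_sphere) \<le> ball_mean x (sqrt (b\<^sup>2 * (1 + 2 / DIM('a))))"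
proof (cases "b = 0")
  case True
  interpret prob_space "uniform_ball :: 'a measure" by (rule prob_space_uniform_ball)
  have "prob_space (uniform_sphere :: 'a measure)" by (rule prob_space_uniform_sphere)
  then have "measure (uniform_sphere :: 'a measure) (space uniform_sphere) = 1" by (rule prob_space.prob_space)
  then show ?thesis using True prob_space by (simp add: ball_mean_def)
next
  case b: False
  define d where "d = DIM('a)"
  have d: "d > 0" by (simp add: d_def)
  define E where "E = (\<integral>u. f (x + b *\<^sub>R u) \<partial>uniform_sphere)"
  define B0 where "B0 = ball_mean x b"
  define B1 where "B1 = ball_mean x (sqrt (b\<^sup>2 * (1 + 2 / d)))"
  define R where "R = norm x + \<bar>b\<bar> * 2"
  obtain L0 where L0: "L0 \<ge> 0" "\<And>y z. norm y \<le> R \<Longrightarrow> norm z \<le> R \<Longrightarrow> \<bar>f y - f z\<bar> \<le> L0 * norm (y - z)"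
    using f_Lipschitz[of R] by blast
  define L where "L = L0 * \<bar>b\<bar>"
  have L: "\<bar>f (x + b *\<^sub>R v) - f (x + b *\<^sub>R w)\<bar> \<le> L * norm (v - w)" if "norm v \<le> 2" "norm w \<le> 2" for v w
  proof -
    have bd: "norm (x + b *\<^sub>R v) \<le> R" if "norm v \<le> 2" for v
    proof -
      have "norm (x + b *\<^sub>R v) \<le> norm x + norm (b *\<^sub>R v)" by (rule norm_triangle_ineq)
      also have "norm (b *\<^sub>R v) \<le> \<bar>b\<bar> * 2" using that by (simp add: mult_left_mono)
      finally show ?thesis by (simp add: R_def)
    qed
    have "\<bar>f (x + b *\<^sub>R v) - f (x + b *\<^sub>R w)\<bar> \<le> L0 * norm ((x + b *\<^sub>R v) - (x + b *\<^sub>R w))"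
      by (rule L0(2)[OF bd bd]) fact+
    also have "(x + b *\<^sub>R v) - (x + b *\<^sub>R w) = b *\<^sub>R (v - w)" by (simp add: algebra_simps)
    finally show ?thesis by (simp add: L_def mult.assoc)
  qed
  \<comment> \<open>This is \<open>\<kappa> ^ d * \<theta> / (\<kappa> ^ d - 1)\<close> for the \<open>\<theta>\<close> below, with the factor \<open>\<kappa> - 1\<close> cancelled; it tends to 1.\<close>
  define G where "G \<kappa> = (\<kappa> + 1) * (d / 2) * \<kappa> ^ d / (\<Sum>i<d. \<kappa> ^ i)" for \<kappa> :: real
  have key: "E \<le> B0 + G \<kappa> * (B1 - B0) + L * (\<kappa> - 1)" if \<kappa>: "1 < \<kappa>" "\<kappa> < min 2 (sqrt (1 + 2 / d))" for \<kappa>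
  proof -
    have ld: "\<kappa> ^ d > 1" using \<kappa> d by simp
    have sum_pos: "(\<Sum>i<d. \<kappa> ^ i) > 0" using \<kappa> d by (intro sum_pos) auto
    have ld_eq: "\<kappa> ^ d - 1 = (\<kappa> - 1) * (\<Sum>i<d. \<kappa> ^ i)" by (rule power_diff_1_eq)
    have "\<kappa>\<^sup>2 < (sqrt (1 + 2 / d))\<^sup>2" using \<kappa> by (intro power_strict_mono) auto
    then have l2: "\<kappa>\<^sup>2 < 1 + 2 / d" by simp
    \<comment> \<open>The position of \<open>(\<kappa> b)\<^sup>2\<close> between \<open>b\<^sup>2\<close> and \<open>b\<^sup>2 (1 + 2 / d)\<close>.\<close>
    define \<theta> where "\<theta> = (\<kappa>\<^sup>2 - 1) * (d / 2)"
    have \<theta>: "0 \<le> \<theta>" "\<theta> \<le> 1" 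
      using l2 \<kappa> d by (auto simp: \<theta>_def field_simps)
    have "(1 - \<theta>) * b\<^sup>2 + \<theta> * (b\<^sup>2 * (1 + 2 / d)) = b\<^sup>2 * (1 + \<theta> * (2 / d))"
      by (simp add: algebra_simps)
    also have "\<theta> * (2 / d) = \<kappa>\<^sup>2 - 1" using d by (simp add: \<theta>_def)
    finally have comb: "(\<kappa> * b)\<^sup>2 = (1 - \<theta>) * b\<^sup>2 + \<theta> * (b\<^sup>2 * (1 + 2 / d))"
      by (simp add: power_mult_distrib)
    have "ball_mean x (sqrt ((1 - \<theta>) *\<^sub>R b\<^sup>2 + \<theta> *\<^sub>R (b\<^sup>2 * (1 + 2 / d)))) 
        \<le> (1 - \<theta>) * ball_mean x (sqrt (b\<^sup>2)) + \<theta> * B1"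
      unfolding B1_def using b \<theta>
      by (intro convex_onD[OF convex_ball_mean_sqrt]) (auto simp: zero_less_mult_iff add_pos_nonneg)
    then have "ball_mean x (\<kappa> * b) \<le> (1 - \<theta>) * B0 + \<theta> * B1"
      by (simp only: real_scaleR_def comb[symmetric] ball_mean_sqrt B0_def)
    then have conv: "ball_mean x (\<kappa> * b) \<le> B0 + \<theta> * (B1 - B0)"
      by (simp add: algebra_simps)
    have "(\<kappa> ^ d - 1) * E \<le> \<kappa> ^ d * ball_mean x (\<kappa> * b) - B0 + L * (\<kappa> - 1) * (\<kappa> ^ d - 1)"
      using sphere_mean_le_shell_mean[of "\<lambda>v. f (x + b *\<^sub>R v)" L \<kappa>] L L0(1) \<kappa> 
      by (simp add: affine_cont f_cont E_def B0_def ball_mean_def d_def L_def mult.commute)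
    also have "\<dots> \<le> \<kappa> ^ d * (B0 + \<theta> * (B1 - B0)) - B0 + L * (\<kappa> - 1) * (\<kappa> ^ d - 1)"
      using ld conv by (intro add_right_mono diff_right_mono mult_left_mono) auto
    also have "\<dots> = (\<kappa> ^ d - 1) * B0 + \<kappa> ^ d * \<theta> * (B1 - B0) + L * (\<kappa> - 1) * (\<kappa> ^ d - 1)"
      by (simp add: algebra_simps)
    also have "\<kappa> ^ d * \<theta> = (\<kappa> ^ d - 1) * G \<kappa>"
      using sum_pos unfolding ld_eq by (simp add: G_def \<theta>_def power2_eq_square field_simps)
    finally have "(\<kappa> ^ d - 1) * E \<le> (\<kappa> ^ d - 1) * (B0 + G \<kappa> * (B1 - B0) + L * (\<kappa> - 1))"
      by (simp add: algebra_simps)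
    then show ?thesis using ld by simp
  qed
  have "((\<lambda>\<kappa>. B0 + G \<kappa> * (B1 - B0) + L * (\<kappa> - 1)) \<longlongrightarrow> B0 + G 1 * (B1 - B0) + L * (1 - 1)) (at_right 1)"
    unfolding G_def using d by (intro tendsto_intros) auto
  moreover have "G 1 = 1" using d by (simp add: G_def)
  ultimately have lim: "((\<lambda>\<kappa>. B0 + G \<kappa> * (B1 - B0) + L * (\<kappa> - 1)) \<longlongrightarrow> B1) (at_right 1)"
    by simp
  have "\<forall>\<^sub>F \<kappa> in at_right 1. E \<le> B0 + G \<kappa> * (B1 - B0) + L * (\<kappa> - 1)"
    unfolding eventually_at_right_field
    by (rule exI[of _ "min 2 (sqrt (1 + 2 / d))"]) (use key d in auto)
  then have "E \<le> B1"
    by (intro tendsto_lowerbound[OF lim]) auto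
  then show ?thesis by (simp add: E_def B1_def d_def)
qed

end

section \<open>The Gaussian measure as a mixture of balls\<close>

definition gauss_tail :: "nat \<Rightarrow> real \<Rightarrow> real" where
  "gauss_tail k u = (\<integral>x. indicator {u<..} x * (x ^ k * exp (- x\<^sup>2 / 2)) \<partial>lborel)"

lemma integrable_power_gauss: "integrable lborel (\<lambda>x::real. x ^ k * exp (- x\<^sup>2 / 2))"
proof -
  have "integrable lborel (\<lambda>x. sqrt (2 * pi) * (std_normal_density x * x ^ k))"
    by (intro integrable_mult_right integrable_std_normal_moment)
  also have "(\<lambda>x. sqrt (2 * pi) * (std_normal_density x * x ^ k)) = (\<lambda>x. x ^ k * exp (- x\<^sup>2 / 2))"
    by (simp add: std_normal_density_def fun_eq_iff)
  finally show ?thesis .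
qed

lemma integrable_gauss_tail: "integrable lborel (\<lambda>x. indicator {u<..} x * (x ^ k * exp (- x\<^sup>2 / 2)) :: real)"
  using integrable_mult_indicator[OF _ integrable_power_gauss, of "{u<..}" k] by simp

lemma power_gauss_tendsto_0: "((\<lambda>x::real. x ^ k * exp (- x\<^sup>2 / 2)) \<longlongrightarrow> 0) at_top"
proof (rule tendsto_sandwich[where f = "\<lambda>_. 0" and h = "\<lambda>x. x ^ k / exp x"])
  show "\<forall>\<^sub>F x in at_top. 0 \<le> x ^ k * exp (- x\<^sup>2 / (2::real))"
    using eventually_ge_at_top[of 0] by eventually_elim auto
  show "\<forall>\<^sub>F x in at_top. x ^ k * exp (- x\<^sup>2 / (2::real)) \<le> x ^ k / exp x" for k :: nat
    using eventually_ge_at_top[of "2::real"]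
  proof eventually_elim
    case (elim x)
    have "2 * x \<le> x * x" using elim by (intro mult_right_mono) auto
    then have "exp (- x\<^sup>2 / 2) \<le> exp (- x)" by (simp add: power2_eq_square)
    then have "x ^ k * exp (- x\<^sup>2 / 2) \<le> x ^ k * exp (- x)" using elim by (intro mult_left_mono) auto
    then show ?case by (simp add: exp_minus field_simps)
  qed
qed (use tendsto_power_div_exp_0[of k] in auto)

text \<open>
  Integration by parts.  At \<open>u = 0\<close> it gives the second moment of the radius of the ball mixture, and
  for general \<open>u\<close> it reduces the tail of the Gaussian norm to the chi density.
\<close>

lemma gauss_tail_rec:
  assumes u: "u \<ge> 0"
  shows "gauss_tail (k + 2) u = u ^ (k + 1) * exp (- u\<^sup>2 / 2) + real (k + 1) * gauss_tail k u"
proof -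
  define F where "F x = - (x ^ (k + 1) * exp (- x\<^sup>2 / 2))" for x :: real
  define g where "g x = x ^ (k + 2) * exp (- x\<^sup>2 / 2) - real (k + 1) * (x ^ k * exp (- x\<^sup>2 / 2))" for x :: real
  have gint: "integrable lborel g"
    unfolding g_def by (intro Bochner_Integration.integrable_diff integrable_mult_right integrable_power_gauss)
  have "(LBINT x=ereal u..\<infinity>. g x) = 0 - F u"
  proof (rule interval_integral_FTC_integrable)
    show "(F has_vector_derivative g x) (at x)" for x
    proof -
      have 1: "((\<lambda>x. x ^ (k + 1)) has_real_derivative real (k + 1) * x ^ k) (at x)"
        using DERIV_pow[of "k + 1" x] by simp
      have 2: "((\<lambda>x. exp (- x\<^sup>2 / 2)) has_real_derivative - x * exp (- x\<^sup>2 / 2)) (at x)"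
        by (auto intro!: derivative_eq_intros)
      show ?thesis
        using DERIV_minus[OF DERIV_mult[OF 1 2]]
        unfolding F_def g_def has_real_derivative_iff_has_vector_derivative[symmetric]
        by (simp add: algebra_simps)
    qed
    show "isCont g x" for x unfolding g_def by (intro continuous_intros) auto
    show "set_integrable lborel (einterval (ereal u) \<infinity>) g"
      unfolding set_integrable_def by (intro integrable_mult_indicator gint) auto
    have "isCont F u" unfolding F_def by (intro continuous_intros) auto
    then show "((F \<circ> real_of_ereal) \<longlongrightarrow> F u) (at_right (ereal u))"
      unfolding ereal_tendsto_simps by (simp add: continuous_at filterlim_at_split)
    show "((F \<circ> real_of_ereal) \<longlongrightarrow> 0) (at_left \<infinity>)"
      unfolding ereal_tendsto_simps F_def using tendsto_minus[OF power_gauss_tendsto_0[of "k + 1"]] by simp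
  qed auto
  moreover have "(LBINT x=ereal u..\<infinity>. g x) = (\<integral>x. indicator {u<..} x * g x \<partial>lborel)"
    by (simp add: interval_integral_to_infinity_eq set_lebesgue_integral_def)
  moreover have "(\<integral>x. indicator {u<..} x * g x \<partial>lborel) = 
      (\<integral>x. indicator {u<..} x * (x ^ (k + 2) * exp (- x\<^sup>2 / 2)) 
        - real (k + 1) * (indicator {u<..} x * (x ^ k * exp (- x\<^sup>2 / 2))) \<partial>lborel)"
    unfolding g_def by (intro Bochner_Integration.integral_cong refl) (simp only: right_diff_distrib mult_ac)
  moreover have "\<dots> = gauss_tail (k + 2) u - real (k + 1) * gauss_tail k u"
    unfolding gauss_tail_def
    by (subst Bochner_Integration.integral_diff) (intro integrable_mult_right integrable_gauss_tail, intro integrable_mult_right integrable_gauss_tail, subst integral_mult_right_zero, rule refl)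
  ultimately show ?thesis by (simp add: F_def)
qed

lemma nn_integral_Ici_times_gauss:
  assumes u: "u \<ge> 0"
  shows "(\<integral>\<^sup>+x. ennreal (x * exp (- x\<^sup>2 / 2)) * indicator {u..} x \<partial>lborel) = ennreal (exp (- u\<^sup>2 / 2))"
proof -
  have "(\<integral>\<^sup>+x. ennreal (x * exp (- x\<^sup>2 / 2)) * indicator {u..} x \<partial>lborel) = ennreal (0 - (- exp (- u\<^sup>2 / 2)))"
  proof (rule nn_integral_FTC_atLeast)
    show "((\<lambda>x. - exp (- x\<^sup>2 / 2)) has_real_derivative x * exp (- x\<^sup>2 / 2)) (at x)" for x :: real
      by (auto intro!: derivative_eq_intros simp: power2_eq_square)
    show "((\<lambda>x. - exp (- x\<^sup>2 / 2)) \<longlongrightarrow> (0::real)) at_top"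
      using tendsto_minus[OF power_gauss_tendsto_0[of 0]] by simp
  qed (use u in auto)
  then show ?thesis by simp
qed

lemma nn_integral_gauss_tail:
  assumes u: "u \<ge> 0"
  shows "(\<integral>\<^sup>+x. ennreal (indicator {u<..} x * (x ^ k * exp (- x\<^sup>2 / 2))) \<partial>lborel) = ennreal (gauss_tail k u)"
  unfolding gauss_tail_def
  using u by (intro nn_integral_eq_integral integrable_gauss_tail AE_I2) (auto simp: indicator_def)

lemma gauss_tail_nonneg: "u \<ge> 0 \<Longrightarrow> gauss_tail k u \<ge> 0"
  unfolding gauss_tail_def by (intro integral_nonneg_AE AE_I2) (auto simp: indicator_def)

lemma gauss_tail_pos:
  assumes "u \<ge> 0" shows "gauss_tail k u > 0"
proof -
  have "gauss_tail k u \<noteq> 0"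
  proof
    assume "gauss_tail k u = 0"
    then have "AE x in lborel. indicator {u<..} x * (x ^ k * exp (- x\<^sup>2 / 2)) = (0::real)"
      unfolding gauss_tail_def using assms
      by (subst (asm) integral_nonneg_eq_0_iff_AE[OF integrable_gauss_tail]) (auto simp: indicator_def)
    then have "AE x in lborel. x \<notin> {u<..}"
      by eventually_elim (use assms in auto)
    then have "emeasure lborel {u<..} = 0"
      by (subst (asm) AE_iff_measurable[OF _ refl]) (auto simp: greaterThan_def)
    moreover have "emeasure lborel {u<..<u+1} \<le> emeasure lborel {u<..}" by (intro emeasure_mono) auto
    ultimately show False by simp
  qed
  with gauss_tail_nonneg[OF assms, of k] show ?thesis by simp
qed

text \<open>
  The layer cake formula: \<open>exp (- (norm z)\<^sup>2 / 2)\<close> is the integral of \<open>r * exp (- r\<^sup>2 / 2)\<close> over \<open>r \<ge> norm z\<close>.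
  This takes the place of polar coordinates throughout.
\<close>

lemma gauss_as_ball_mixture:
  fixes g :: "'a::euclidean_space \<Rightarrow> ennreal"
  assumes [measurable]: "g \<in> borel_measurable borel"
  shows "(\<integral>\<^sup>+z. g z * ennreal (exp (- (norm z)\<^sup>2 / 2)) \<partial>lborel)
    = (\<integral>\<^sup>+r. ennreal (r * exp (- r\<^sup>2 / 2)) * (\<integral>\<^sup>+z. g z * indicator (cball 0 r) z \<partial>lborel) \<partial>lborel)"
proof -
  have "(\<integral>\<^sup>+z. g z * ennreal (exp (- (norm z)\<^sup>2 / 2)) \<partial>lborel)
      = (\<integral>\<^sup>+z. (\<integral>\<^sup>+r. g z * (ennreal (r * exp (- r\<^sup>2 / 2)) * indicator {p. norm (fst p) \<le> snd p} (z, r)) \<partial>lborel) \<partial>lborel)"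
  proof (rule nn_integral_cong)
    fix z :: 'a
    have "indicator {p. norm (fst p) \<le> snd p} (z, r) = (indicator {norm z..} r :: ennreal)" for r
      by (simp add: indicator_def)
    moreover have "(\<integral>\<^sup>+r. g z * (ennreal (r * exp (- r\<^sup>2 / 2)) * indicator {norm z..} r) \<partial>lborel)
        = g z * (\<integral>\<^sup>+r. ennreal (r * exp (- r\<^sup>2 / 2)) * indicator {norm z..} r \<partial>lborel)"
      by (rule nn_integral_cmult) measurable
    ultimately show "g z * ennreal (exp (- (norm z)\<^sup>2 / 2)) = 
        (\<integral>\<^sup>+r. g z * (ennreal (r * exp (- r\<^sup>2 / 2)) * indicator {p. norm (fst p) \<le> snd p} (z, r)) \<partial>lborel)"
      by (simp only: nn_integral_Ici_times_gauss[OF norm_ge_zero])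
  qed
  also have "\<dots> = (\<integral>\<^sup>+r. (\<integral>\<^sup>+z. g z * (ennreal (r * exp (- r\<^sup>2 / 2)) * indicator {p. norm (fst p) \<le> snd p} (z, r)) \<partial>lborel) \<partial>lborel)"
    by (rule lborel_pair.Fubini'[symmetric]) measurable
  also have "\<dots> = (\<integral>\<^sup>+r. ennreal (r * exp (- r\<^sup>2 / 2)) * (\<integral>\<^sup>+z. g z * indicator (cball 0 r) z \<partial>lborel) \<partial>lborel)"
  proof (rule nn_integral_cong)
    fix r :: real
    have "(\<lambda>z. g z * indicator (cball 0 r) z) \<in> borel_measurable borel"
      by (intro borel_measurable_times_ennreal borel_measurable_indicator) auto
    then have "ennreal (r * exp (- r\<^sup>2 / 2)) * (\<integral>\<^sup>+z. g z * indicator (cball 0 r) z \<partial>lborel)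
        = (\<integral>\<^sup>+z. ennreal (r * exp (- r\<^sup>2 / 2)) * (g z * indicator (cball 0 r) z) \<partial>lborel)"
      by (simp add: nn_integral_cmult)
    also have "\<dots> = (\<integral>\<^sup>+z. g z * (ennreal (r * exp (- r\<^sup>2 / 2)) * indicator {p. norm (fst p) \<le> snd p} (z, r)) \<partial>lborel)"
      by (intro nn_integral_cong) (auto simp: indicator_def mult.commute)
    finally show "(\<integral>\<^sup>+z. g z * (ennreal (r * exp (- r\<^sup>2 / 2)) * indicator {p. norm (fst p) \<le> snd p} (z, r)) \<partial>lborel)
      = ennreal (r * exp (- r\<^sup>2 / 2)) * (\<integral>\<^sup>+z. g z * indicator (cball 0 r) z \<partial>lborel)" by simp
  qed
  finally show ?thesis .
qed

text \<open>
  The integral of \<open>exp (- (norm z)\<^sup>2 / 2)\<close>, in the form in which the ball mixture yields it.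
\<close>

definition gauss_normalizer :: "'a::euclidean_space itself \<Rightarrow> real" where
  "gauss_normalizer _ = ball_vol TYPE('a) * gauss_tail (DIM('a) + 1) 0"

lemma gauss_normalizer_pos: "gauss_normalizer TYPE('a::euclidean_space) > 0"
  unfolding gauss_normalizer_def by (intro mult_pos_pos ball_vol_pos gauss_tail_pos) auto

lemma nn_integral_gauss_uniform_ball:
  fixes g :: "'a::euclidean_space \<Rightarrow> ennreal"
  assumes [measurable]: "g \<in> borel_measurable borel"
  shows "(\<integral>\<^sup>+z. g z * ennreal (exp (- (norm z)\<^sup>2 / 2)) \<partial>lborel)
    = ennreal (ball_vol TYPE('a)) *
      (\<integral>\<^sup>+r. ennreal (indicator {0<..} r * (r ^ (DIM('a) + 1) * exp (- r\<^sup>2 / 2))) * (\<integral>\<^sup>+v. g (r *\<^sub>R v) \<partial>uniform_ball) \<partial>lborel)"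
proof -
  have "(\<integral>\<^sup>+z. g z * ennreal (exp (- (norm z)\<^sup>2 / 2)) \<partial>lborel)
    = (\<integral>\<^sup>+r. ennreal (ball_vol TYPE('a)) * (ennreal (indicator {0<..} r * (r ^ (DIM('a) + 1) * exp (- r\<^sup>2 / 2))) * (\<integral>\<^sup>+v. g (r *\<^sub>R v) \<partial>uniform_ball)) \<partial>lborel)"
    unfolding gauss_as_ball_mixture[OF assms]
  proof (rule nn_integral_cong)
    fix r :: real
    show "ennreal (r * exp (- r\<^sup>2 / 2)) * (\<integral>\<^sup>+z. g z * indicator (cball 0 r) z \<partial>lborel) =
      ennreal (ball_vol TYPE('a)) * (ennreal (indicator {0<..} r * (r ^ (DIM('a) + 1) * exp (- r\<^sup>2 / 2))) * (\<integral>\<^sup>+v. g (r *\<^sub>R v) \<partial>uniform_ball))"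
    proof (cases "r > 0")
      case True
      then show ?thesis
        by (simp add: nn_integral_cball_scale ennreal_mult'' ennreal_mult mult_ac)
    next
      case False
      then show ?thesis by (simp add: ennreal_neg mult_le_0_iff)
    qed
  qed
  also have "\<dots> = ennreal (ball_vol TYPE('a)) *
      (\<integral>\<^sup>+r. ennreal (indicator {0<..} r * (r ^ (DIM('a) + 1) * exp (- r\<^sup>2 / 2))) * (\<integral>\<^sup>+v. g (r *\<^sub>R v) \<partial>uniform_ball) \<partial>lborel)"
  proof (rule nn_integral_cmult)
    interpret prob_space "uniform_ball :: 'a measure" by (rule prob_space_uniform_ball)
    have s: "sets (uniform_ball :: 'a measure) = sets borel" by simp
    show "(\<lambda>r. ennreal (indicator {0<..} r * (r ^ (DIM('a) + 1) * exp (- r\<^sup>2 / 2))) * (\<integral>\<^sup>+v. g (r *\<^sub>R v) \<partial>uniform_ball)) \<in> borel_measurable lborel"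
      by measurable
  qed
  finally show ?thesis .
qed

lemma nn_integral_gauss: "(\<integral>\<^sup>+z. ennreal (exp (- (norm z)\<^sup>2 / 2)) \<partial>(lborel :: 'a::euclidean_space measure)) = ennreal (gauss_normalizer TYPE('a))"
proof -
  interpret prob_space "uniform_ball :: 'a measure" by (rule prob_space_uniform_ball)
  have one: "(\<integral>\<^sup>+v. 1 \<partial>(uniform_ball :: 'a measure)) = 1"
    by (simp only: nn_integral_const emeasure_space_1 mult_1)
  show ?thesis
    using nn_integral_gauss_uniform_ball[of "\<lambda>_::'a. 1", OF borel_measurable_const] ball_vol_pos[where 'a = 'a]
    by (simp only: one mult_1 mult_1_right nn_integral_gauss_tail order_refl) (simp only: gauss_normalizer_def ennreal_mult' less_imp_le)
qed

definition gaussian :: "'a::euclidean_space measure" where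
  "gaussian = density lborel (\<lambda>z. ennreal (exp (- (norm z)\<^sup>2 / 2) / gauss_normalizer TYPE('a)))"

lemma sets_gaussian [simp, measurable_cong]: "sets gaussian = sets borel"
  by (simp add: gaussian_def)

lemma space_gaussian [simp]: "space gaussian = UNIV"
  by (simp add: gaussian_def)

lemma nn_integral_gaussian:
  fixes g :: "'a::euclidean_space \<Rightarrow> ennreal"
  assumes [measurable]: "g \<in> borel_measurable borel"
  shows "(\<integral>\<^sup>+z. g z \<partial>gaussian) = (\<integral>\<^sup>+z. g z * ennreal (exp (- (norm z)\<^sup>2 / 2)) \<partial>lborel) / ennreal (gauss_normalizer TYPE('a))"
proof -
  have "(\<integral>\<^sup>+z. g z \<partial>gaussian) = (\<integral>\<^sup>+z. g z * ennreal (exp (- (norm z)\<^sup>2 / 2)) / ennreal (gauss_normalizer TYPE('a)) \<partial>lborel)"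
    unfolding gaussian_def using gauss_normalizer_pos[where 'a='a]
    by (subst nn_integral_density) (auto simp: divide_ennreal[symmetric] ennreal_times_divide mult.commute intro!: nn_integral_cong)
  also have "\<dots> = (\<integral>\<^sup>+z. g z * ennreal (exp (- (norm z)\<^sup>2 / 2)) \<partial>lborel) / ennreal (gauss_normalizer TYPE('a))"
    by (rule nn_integral_divide) measurable
  finally show ?thesis .
qed

lemma prob_space_gaussian: "prob_space (gaussian :: 'a::euclidean_space measure)"
proof
  have "emeasure (gaussian :: 'a measure) UNIV = (\<integral>\<^sup>+z. 1 \<partial>(gaussian :: 'a measure))"
    by simp
  also have "\<dots> = 1"
    using gauss_normalizer_pos[where 'a='a]
    by (subst nn_integral_gaussian) (simp, simp only: mult_1 nn_integral_gauss, simp add: ennreal_divide_self)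
  finally show "emeasure (gaussian :: 'a measure) (space gaussian) = 1" by simp
qed

text \<open>
  By the layer cake formula the unnormalised left-hand side is the integral over \<open>r > u\<close> of
  \<open>r * exp (- r\<^sup>2 / 2)\<close> times the volume \<open>V * (r ^ d - u ^ d)\<close> of the spherical shell between \<open>u\<close> and \<open>r\<close>,
  and integration by parts turns this into \<open>V * d\<close> times the integral of the chi density.
\<close>

lemma gaussian_norm_tail:
  assumes u: "u \<ge> 0"
  shows "emeasure gaussian {z::'a::euclidean_space. norm z > u} 
    = ennreal (gauss_tail (DIM('a) - 1) u / gauss_tail (DIM('a) - 1) 0)"
proof -
  define d where "d = DIM('a)"
  define V where "V = ball_vol TYPE('a)"
  have V: "V > 0" unfolding V_def by (rule ball_vol_pos)
  have d: "d \<ge> 1" by (simp add: d_def Suc_leI)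
  then obtain k where k: "d = Suc k" by (cases d) auto
  have "(\<integral>\<^sup>+z. indicator {z::'a. norm z > u} z * ennreal (exp (- (norm z)\<^sup>2 / 2)) \<partial>lborel)
    = (\<integral>\<^sup>+r. ennreal (V * (indicator {u<..} r * (r ^ (d + 1) * exp (- r\<^sup>2 / 2))  - u ^ d * (indicator {u<..} r * (r ^ 1 * exp (- r\<^sup>2 / 2))))) \<partial>lborel)"
  proof (subst gauss_as_ball_mixture, simp, rule nn_integral_cong)
    fix r :: real
    have "(\<integral>\<^sup>+z. indicator {z::'a. norm z > u} z * indicator (cball 0 r) z \<partial>lborel)
       = (\<integral>\<^sup>+z. indicator (cball (0::'a) r - cball 0 u) z \<partial>lborel)"
      by (intro nn_integral_cong) (auto simp: indicator_def)
    also have "\<dots> = emeasure lborel (cball (0::'a) r - cball 0 u)" by simp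
    also have "\<dots> = ennreal (indicator {u<..} r * (V * (r ^ d - u ^ d)))"
    proof (cases "r > u")
      case True
      then have "emeasure lborel (cball (0::'a) r - cball 0 u) = emeasure lborel (cball (0::'a) r) - emeasure lborel (cball (0::'a) u)"
        using u by (intro emeasure_Diff) (auto simp: emeasure_lborel_cball)
      then show ?thesis using True u V
        by (simp add: emeasure_lborel_cball V_def d_def ennreal_minus right_diff_distrib)
    next
      case False
      then have "cball (0::'a) r - cball 0 u = {}" by auto
      with False show ?thesis by (simp only: emeasure_empty) simp
    qed
    finally have *: "(\<integral>\<^sup>+z. indicator {z::'a. norm z > u} z * indicator (cball 0 r) z \<partial>lborel) = ennreal (indicator {u<..} r * (V * (r ^ d - u ^ d)))" .
    show "ennreal (r * exp (- r\<^sup>2 / 2)) * (\<integral>\<^sup>+z. indicator {z::'a. norm z > u} z * indicator (cball 0 r) z \<partial>lborel) =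
      ennreal (V * (indicator {u<..} r * (r ^ (d + 1) * exp (- r\<^sup>2 / 2))  - u ^ d * (indicator {u<..} r * (r ^ 1 * exp (- r\<^sup>2 / 2)))))"
    proof (cases "r > u")
      case True
      then have "ennreal (r * exp (- r\<^sup>2 / 2)) * ennreal (V * (r ^ d - u ^ d)) = ennreal ((r * exp (- r\<^sup>2 / 2)) * (V * (r ^ d - u ^ d)))"
        using u by (intro ennreal_mult'[symmetric]) auto
      also have "(r * exp (- r\<^sup>2 / 2)) * (V * (r ^ d - u ^ d)) = V * (r ^ (d + 1) * exp (- r\<^sup>2 / 2) - u ^ d * (r ^ 1 * exp (- r\<^sup>2 / 2)))"
        by (simp add: algebra_simps)
      finally show ?thesis using True unfolding * by simp
    qed (simp add: *)
  qed
  also have "\<dots> = ennreal (V * (gauss_tail (d + 1) u - u ^ d * gauss_tail 1 u))"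
  proof (subst nn_integral_eq_integral)
    have i: "integrable lborel (\<lambda>r. u ^ d * (indicator {u<..} r * (r ^ 1 * exp (- r\<^sup>2 / 2))))"
      by (intro integrable_mult_right integrable_gauss_tail)
    then show "integrable lborel (\<lambda>r. V * (indicator {u<..} r * (r ^ (d + 1) * exp (- r\<^sup>2 / 2))  - u ^ d * (indicator {u<..} r * (r ^ 1 * exp (- r\<^sup>2 / 2)))))"
      by (intro integrable_mult_right Bochner_Integration.integrable_diff integrable_gauss_tail)
    show "AE r in lborel. 0 \<le> V * (indicator {u<..} r * (r ^ (d + 1) * exp (- r\<^sup>2 / 2))  - u ^ d * (indicator {u<..} r * (r ^ 1 * exp (- r\<^sup>2 / 2))))"
    proof (rule AE_I2)
      fix r :: real
      have "u ^ d * (r * exp (- r\<^sup>2 / 2)) \<le> r ^ d * (r * exp (- r\<^sup>2 / 2))" if "r > u"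
        using u that by (intro mult_right_mono power_mono) auto
      then show "0 \<le> V * (indicator {u<..} r * (r ^ (d + 1) * exp (- r\<^sup>2 / 2))  - u ^ d * (indicator {u<..} r * (r ^ 1 * exp (- r\<^sup>2 / 2))))"
        using V by (auto simp: indicator_def mult_ac)
    qed
    show "ennreal (\<integral>r. V * (indicator {u<..} r * (r ^ (d + 1) * exp (- r\<^sup>2 / 2))  - u ^ d * (indicator {u<..} r * (r ^ 1 * exp (- r\<^sup>2 / 2)))) \<partial>lborel)
        = ennreal (V * (gauss_tail (d + 1) u - u ^ d * gauss_tail 1 u))"
      unfolding gauss_tail_def by (simp only: integral_mult_right_zero Bochner_Integration.integral_diff[OF integrable_gauss_tail i])
  qed
  also have "gauss_tail 1 u = exp (- u\<^sup>2 / 2)"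
  proof -
    have "ennreal (gauss_tail 1 u) = (\<integral>\<^sup>+x. ennreal (x * exp (- x\<^sup>2 / 2)) * indicator {u..} x \<partial>lborel)"
      unfolding nn_integral_gauss_tail[OF u, symmetric]
      by (intro nn_integral_cong_AE eventually_mono[OF AE_lborel_singleton[of u]]) (auto simp: indicator_def)
    then have "ennreal (gauss_tail 1 u) = ennreal (exp (- u\<^sup>2 / 2))" by (simp only: nn_integral_Ici_times_gauss[OF u])
    then show ?thesis using gauss_tail_nonneg[OF u, of 1] by (simp only: ennreal_inj exp_ge_zero)
  qed
  also have "gauss_tail (d + 1) u - u ^ d * exp (- u\<^sup>2 / 2) = d * gauss_tail (d - 1) u"
    using gauss_tail_rec[OF u, of k] by (simp add: k)
  finally have 1: "(\<integral>\<^sup>+z. indicator {z::'a. norm z > u} z * ennreal (exp (- (norm z)\<^sup>2 / 2)) \<partial>lborel) = ennreal (V * (d * gauss_tail (d - 1) u))" .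
  have 2: "gauss_normalizer TYPE('a) = V * (d * gauss_tail (d - 1) 0)"
    using gauss_tail_rec[of 0 k] by (simp add: gauss_normalizer_def V_def d_def[symmetric] k)
  have "emeasure gaussian {z::'a. norm z > u} = (\<integral>\<^sup>+z. indicator {z::'a. norm z > u} z \<partial>gaussian)"
    by (subst nn_integral_indicator) auto
  also have "\<dots> = ennreal (V * (d * gauss_tail (d - 1) u)) / ennreal (V * (d * gauss_tail (d - 1) 0))"
    by (subst nn_integral_gaussian) (simp, simp only: 1 2)
  also have "\<dots> = ennreal (gauss_tail (d - 1) u / gauss_tail (d - 1) 0)"
    using V d gauss_tail_pos[of 0 "d - 1"] gauss_tail_nonneg[OF u, of "d - 1"] by (subst divide_ennreal) auto
  finally show ?thesis by (simp add: d_def)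
qed

section \<open>Comparison of spherical and Gaussian means\<close>

lemma ennreal_integral_le_nn_integral:
  assumes "integrable M g" and [measurable]: "h \<in> borel_measurable M"
    and le: "\<And>x. x \<in> space M \<Longrightarrow> ennreal (g x) \<le> h x"
  shows "ennreal (\<integral>x. g x \<partial>M) \<le> (\<integral>\<^sup>+x. h x \<partial>M)"
proof -
  have i: "integrable M (\<lambda>x. max 0 (g x))" using assms(1) by simp
  have "ennreal (\<integral>x. g x \<partial>M) \<le> ennreal (\<integral>x. max 0 (g x) \<partial>M)"
    by (intro ennreal_leI integral_mono assms(1) i) auto
  also have "\<dots> = (\<integral>\<^sup>+x. ennreal (max 0 (g x)) \<partial>M)"
    by (intro nn_integral_eq_integral[symmetric] i) auto
  also have "\<dots> \<le> (\<integral>\<^sup>+x. h x \<partial>M)"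
    by (intro nn_integral_mono) (use le in \<open>auto simp: max_def ennreal_neg\<close>)
  finally show ?thesis .
qed

lemma sets_uniform_sphere [simp, measurable_cong]: "sets uniform_sphere = sets borel"
  by (simp add: uniform_sphere_def)

lemma space_uniform_sphere [simp]: "space uniform_sphere = UNIV"
  by (simp add: uniform_sphere_def)

context convex_laplacian
begin

lemma nn_integral_uniform_sphere_eq:
  "(\<integral>\<^sup>+u. ennreal (f (x + b *\<^sub>R u)) \<partial>uniform_sphere) = ennreal (\<integral>u. f (x + b *\<^sub>R u) \<partial>uniform_sphere)"
proof -
  interpret prob_space "uniform_sphere :: 'a measure" by (rule prob_space_uniform_sphere)
  have cont: "continuous_on UNIV (\<lambda>u. f (x + b *\<^sub>R u))" by (intro affine_cont f_cont)
  then have "compact ((\<lambda>u. f (x + b *\<^sub>R u)) ` sphere 0 1)"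
    by (intro compact_continuous_image continuous_on_subset[OF cont]) auto
  then obtain C where C: "\<forall>y \<in> (\<lambda>u. f (x + b *\<^sub>R u)) ` sphere 0 1. norm y \<le> C"
    by (meson bounded_iff compact_imp_bounded)
  have "integrable uniform_sphere (\<lambda>u. f (x + b *\<^sub>R u))"
  proof (rule integrable_const_bound)
    show "AE u in uniform_sphere. norm (f (x + b *\<^sub>R u)) \<le> C"
      using AE_uniform_sphere by eventually_elim (use C in auto)
  qed simp
  then show ?thesis by (intro nn_integral_eq_integral) (auto simp: f_nonneg)
qed

lemma nn_integral_uniform_ball_eq:
  "(\<integral>\<^sup>+v. ennreal (f (x + r *\<^sub>R v)) \<partial>uniform_ball) = ennreal (ball_mean x r)"
  unfolding ball_mean_def
  by (intro nn_integral_eq_integral integrable_uniform_ball affine_cont f_cont) (auto simp: f_nonneg)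

lemma ball_mean_cont: "continuous_on UNIV (ball_mean x)"
  by (rule DERIV_continuous_on[OF has_field_derivative_at_within[OF ball_mean_deriv]])

text \<open>
  The number \<open>\<beta> s0\<close> separates the two sides.  It bounds the spherical mean, and it is a lower bound
  for the Gaussian mean because the Gaussian law is the mixture of uniform laws on balls of random
  radius \<open>R\<close> with density proportional to \<open>r ^ (d + 1) * exp (- r\<^sup>2 / 2)\<close>: as \<open>R\<^sup>2\<close> has mean \<open>d + 2\<close>, the
  squared radius \<open>b\<^sup>2 R\<^sup>2 / d\<close> has mean \<open>s0\<close>, and Jensen's inequality applies to the convex function \<open>\<beta>\<close>.
  Jensen's inequality is carried out with the tangent at \<open>s0\<close>, so that an infinite Gaussian mean needs
  no separate treatment.
\<close>

lemma sphere_mean_le_gaussian_mean: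
  "(\<integral>\<^sup>+u. ennreal (f (x + b *\<^sub>R u)) \<partial>uniform_sphere)
    \<le> (\<integral>\<^sup>+z. ennreal (f (x + (b / sqrt DIM('a)) *\<^sub>R z)) \<partial>gaussian)"
proof (cases "b = 0")
  case True
  interpret s: prob_space "uniform_sphere :: 'a measure" by (rule prob_space_uniform_sphere)
  interpret g: prob_space "gaussian :: 'a measure" by (rule prob_space_gaussian)
  show ?thesis using True s.emeasure_space_1 g.emeasure_space_1 by simp
next
  case b: False
  define d where "d = DIM('a)"
  have d: "d \<ge> 1" by (simp add: d_def Suc_leI)
  define V where "V = ball_vol TYPE('a)"
  have V: "V > 0" unfolding V_def by (rule ball_vol_pos)
  define W where "W = gauss_tail (d + 1) 0"
  have W: "W > 0" unfolding W_def by (rule gauss_tail_pos) simp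
  have N: "gauss_normalizer TYPE('a) = V * W" by (simp add: gauss_normalizer_def V_def W_def d_def)
  define \<beta> where "\<beta> = (\<lambda>s. ball_mean x (sqrt s))"
  define s0 where "s0 = b\<^sup>2 * (1 + 2 / d)"
  have s0: "s0 > 0" unfolding s0_def using b by (intro mult_pos_pos add_pos_nonneg) auto
  define m where "m = weighted_laplacian_mean x (sqrt s0) / 2"
  have tangent: "\<beta> s \<ge> \<beta> s0 + m * (s - s0)" if "s > 0" for s
  proof -
    have "(\<beta> has_real_derivative m) (at s0 within {0<..})"
      unfolding \<beta>_def m_def by (rule has_field_derivative_at_within[OF ball_mean_sqrt_deriv[OF s0]])
    moreover have "convex_on {0<..} \<beta>" unfolding \<beta>_def by (rule convex_ball_mean_sqrt)
    ultimately have "\<beta> s - \<beta> s0 \<ge> m * (s - s0)"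
      using s0 that by (intro convex_on_imp_above_tangent[of "{0<..}"]) (auto simp: interior_open)
    then show ?thesis by simp
  qed
  let ?w = "\<lambda>k r::real. indicator {0<..} r * (r ^ k * exp (- r\<^sup>2 / 2)) :: real"
  \<comment> \<open>The tangent of \<open>\<beta>\<close> at \<open>s0\<close>, evaluated at \<open>b\<^sup>2 r\<^sup>2 / d\<close> and weighted by the unnormalised density of the radius.\<close>
  let ?lower = "\<lambda>r. (\<beta> s0 - m * s0) * ?w (d + 1) r + (m * b\<^sup>2 / d) * ?w (d + 3) r"
  have int: "integrable lborel ?lower"
    by (intro Bochner_Integration.integrable_add integrable_mult_right integrable_gauss_tail)
  have "(\<integral>r. ?lower r \<partial>lborel) = (\<beta> s0 - m * s0) * W + (m * b\<^sup>2 / d) * gauss_tail (d + 3) 0"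
    unfolding W_def gauss_tail_def
    by (subst Bochner_Integration.integral_add; (intro integrable_mult_right integrable_gauss_tail)?) simp
  also have "gauss_tail (d + 3) 0 = (d + 2) * W"
  proof -
    have "d + 3 = (d + 1) + 2" by simp
    then show ?thesis using gauss_tail_rec[of 0 "d + 1"] by (simp only: W_def) simp
  qed
  also have "(\<beta> s0 - m * s0) * W + (m * b\<^sup>2 / d) * ((d + 2) * W) = \<beta> s0 * W"
  proof -
    have "s0 = b\<^sup>2 / d * (d + 2)" using d by (simp add: s0_def field_simps)
    then have "m * s0 * W = (m * b\<^sup>2 / d) * ((d + 2) * W)" by (simp add: mult_ac)
    then show ?thesis by (simp only: left_diff_distrib)
  qed
  finally have lower: "(\<integral>r. ?lower r \<partial>lborel) = \<beta> s0 * W" .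
  define B where "B r = ball_mean x (b / sqrt d * r)" for r
  have Bm[measurable]: "B \<in> borel_measurable borel"
    unfolding B_def
    by (rule borel_measurable_continuous_onI, rule continuous_on_compose2[OF ball_mean_cont[of x]])
      (use d in \<open>auto intro!: continuous_intros\<close>)
  have le: "ennreal (\<beta> s0 * W) \<le> (\<integral>\<^sup>+r. ennreal (?w (d + 1) r) * ennreal (B r) \<partial>lborel)"
    unfolding lower[symmetric]
  proof (rule ennreal_integral_le_nn_integral[OF int])
    fix r :: real
    show "ennreal (?lower r) \<le> ennreal (?w (d + 1) r) * ennreal (B r)"
    proof (cases "r > 0")
      case True
      define s where "s = b\<^sup>2 * r\<^sup>2 / d"
      have s: "s > 0" using True b d by (simp add: s_def)
      have "(b / sqrt d * r)\<^sup>2 = s" using d by (simp add: s_def power_mult_distrib power_divide)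
      then have "B r = \<beta> s" using ball_mean_sqrt[of x "b / sqrt d * r"] by (simp add: B_def \<beta>_def)
      then have t: "\<beta> s0 + m * (s - s0) \<le> B r" using tangent[OF s] by simp
      have "?lower r = ?w (d + 1) r * (\<beta> s0 + m * (s - s0))"
      proof -
        have "d + 3 = (d + 1) + 2" by simp
        then have p: "r ^ (d + 3) = r ^ (d + 1) * r\<^sup>2" by (simp only: power_add[of r "d + 1" 2])
        show ?thesis using True by (simp only: p s_def) (simp add: algebra_simps)
      qed
      also have "\<dots> \<le> ?w (d + 1) r * B r" using True t by (intro mult_left_mono) auto
      finally have "ennreal (?lower r) \<le> ennreal (?w (d + 1) r * B r)" by (rule ennreal_leI)
      also have "\<dots> = ennreal (?w (d + 1) r) * ennreal (B r)" using True by (intro ennreal_mult') auto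
      finally show ?thesis .
    qed simp
  qed measurable
  have "(\<integral>\<^sup>+z. ennreal (f (x + (b / sqrt d) *\<^sub>R z)) * ennreal (exp (- (norm z)\<^sup>2 / 2)) \<partial>lborel)
     = ennreal V * (\<integral>\<^sup>+r. ennreal (?w (d + 1) r) * ennreal (B r) \<partial>lborel)"
  proof -
    have "(\<integral>\<^sup>+v. ennreal (f (x + (b / sqrt d) *\<^sub>R (r *\<^sub>R v))) \<partial>uniform_ball) = ennreal (B r)" for r
      unfolding B_def scaleR_scaleR by (rule nn_integral_uniform_ball_eq)
    then show ?thesis unfolding V_def d_def by (subst nn_integral_gauss_uniform_ball) simp_all
  qed
  then have "(\<integral>\<^sup>+z. ennreal (f (x + (b / sqrt d) *\<^sub>R z)) \<partial>gaussian)
     = ennreal V * (\<integral>\<^sup>+r. ennreal (?w (d + 1) r) * ennreal (B r) \<partial>lborel) / ennreal (V * W)"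
    by (subst nn_integral_gaussian) (simp_all add: N)
  moreover have "ennreal V * ennreal (\<beta> s0 * W) / ennreal (V * W)
    \<le> ennreal V * (\<integral>\<^sup>+r. ennreal (?w (d + 1) r) * ennreal (B r) \<partial>lborel) / ennreal (V * W)"
    by (intro divide_right_mono_ennreal mult_left_mono le) auto
  moreover have "ennreal V * ennreal (\<beta> s0 * W) / ennreal (V * W) = ennreal (\<beta> s0)"
  proof -
    have "\<beta> s0 \<ge> 0" unfolding \<beta>_def ball_mean_def by (intro integral_nonneg_AE AE_I2 f_nonneg)
    then have "ennreal V * ennreal (\<beta> s0 * W) / ennreal (V * W) = ennreal (V * (\<beta> s0 * W) / (V * W))"
      using V W by (simp add: ennreal_mult[symmetric] divide_ennreal)
    then show ?thesis using V W by simp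
  qed
  moreover have "(\<integral>\<^sup>+u. ennreal (f (x + b *\<^sub>R u)) \<partial>uniform_sphere) \<le> ennreal (\<beta> s0)"
    unfolding nn_integral_uniform_sphere_eq \<beta>_def s0_def d_def
    by (intro ennreal_leI sphere_mean_le_ball_mean)
  ultimately show ?thesis by (simp add: d_def)
qed

end

text \<open>
  Completing the square, \<open>z\<close> and \<open>A z y\<close> play symmetric roles: with \<open>w = A z y\<close> the argument
  \<open>s z + t w\<close> becomes \<open>r y\<close>, and the product density at \<open>(z, A z y)\<close> equals the one at \<open>(y, A y z)\<close>.
  So after the substitution \<open>w = A z y\<close> the variable \<open>z\<close> is integrated out by the same substitution
  with the roles exchanged, which uses up the Jacobian factor \<open>c\<close>.
\<close>

lemma gaussian_convolution:
  fixes g :: "'a::euclidean_space \<Rightarrow> ennreal"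
  assumes g[measurable]: "g \<in> borel_measurable borel" and s: "s \<ge> 0"
  shows "(\<integral>\<^sup>+z. \<integral>\<^sup>+w. g (x + s *\<^sub>R z + t *\<^sub>R w) \<partial>gaussian \<partial>gaussian) = (\<integral>\<^sup>+z. g (x + sqrt (s\<^sup>2 + t\<^sup>2) *\<^sub>R z) \<partial>gaussian)"
proof (cases "t = 0")
  case True
  interpret g: prob_space "gaussian :: 'a measure" by (rule prob_space_gaussian)
  show ?thesis using True s g.emeasure_space_1 by simp
next
  case t: False
  define N where "N = gauss_normalizer TYPE('a)"
  have N: "N > 0" unfolding N_def by (rule gauss_normalizer_pos)
  define r where "r = sqrt (s\<^sup>2 + t\<^sup>2)"
  have r2: "r\<^sup>2 = s\<^sup>2 + t\<^sup>2" by (simp add: r_def)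
  have r: "r > 0" using t by (simp add: r_def sum_power2_gt_zero_iff)
  define c where "c = ennreal (\<bar>r / t\<bar> ^ DIM('a))"
  define E where "E z = ennreal (exp (- (norm z)\<^sup>2 / 2))" for z :: 'a
  have Em[measurable]: "E \<in> borel_measurable borel" unfolding E_def by measurable
  define A where "A z y = - (s / t) *\<^sub>R z + (r / t) *\<^sub>R y" for z y :: 'a
  have Am[measurable]: "(\<lambda>p. A (fst p) (snd p)) \<in> borel_measurable (borel \<Otimes>\<^sub>M borel)" unfolding A_def by measurable
  have exponent: "E z * E (A z y) = E y * E (A y z)" for z y
  proof -
    have "t\<^sup>2 * ((norm z)\<^sup>2 + (norm (A z y))\<^sup>2) = t\<^sup>2 * (norm z)\<^sup>2 + (norm (t *\<^sub>R A z y))\<^sup>2" for z y :: 'a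
      by (simp add: power_mult_distrib algebra_simps)
    moreover have "t *\<^sub>R A z y = r *\<^sub>R y - s *\<^sub>R z" for z y
      using t by (simp add: A_def scaleR_add_right scaleR_diff_right)
    moreover have "t\<^sup>2 * (norm z)\<^sup>2 + (norm (r *\<^sub>R y - s *\<^sub>R z))\<^sup>2 = r\<^sup>2 * (norm z)\<^sup>2 + r\<^sup>2 * (norm y)\<^sup>2 - 2 * r * s * (y \<bullet> z)" for z y :: 'a
    proof -
      have "(norm (r *\<^sub>R y - s *\<^sub>R z))\<^sup>2 = r\<^sup>2 * (norm y)\<^sup>2 + s\<^sup>2 * (norm z)\<^sup>2 - 2 * r * s * (y \<bullet> z)"
        unfolding power2_norm_eq_inner
        by (simp add: inner_diff_left inner_diff_right inner_commute power2_eq_square algebra_simps)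
      then show ?thesis by (simp add: r2 algebra_simps)
    qed
    ultimately have "t\<^sup>2 * ((norm z)\<^sup>2 + (norm (A z y))\<^sup>2) = t\<^sup>2 * ((norm y)\<^sup>2 + (norm (A y z))\<^sup>2)"
      by (simp add: inner_commute)
    then have eq: "(norm z)\<^sup>2 + (norm (A z y))\<^sup>2 = (norm y)\<^sup>2 + (norm (A y z))\<^sup>2" using t by simp
    have "E z * E w = ennreal (exp (- ((norm z)\<^sup>2 + (norm w)\<^sup>2) / 2))" for z w
      by (simp add: E_def ennreal_mult[symmetric] exp_add[symmetric] add_divide_distrib diff_divide_distrib)
    then show ?thesis by (simp only: eq)
  qed
  have affine: "(\<integral>\<^sup>+w. h w \<partial>lborel) = c * (\<integral>\<^sup>+y. h (A z y) \<partial>lborel)" if "h \<in> borel_measurable borel" for h :: "'a \<Rightarrow> ennreal" and z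
    using nn_integral_lborel_affine[OF that, of "r / t" "- (s / t) *\<^sub>R z"] r t by (simp add: c_def A_def)
  have shift: "x + s *\<^sub>R z + t *\<^sub>R A z y = x + r *\<^sub>R y" for z y
    using t by (simp add: A_def scaleR_add_right scaleR_diff_right)
  have total: "(\<integral>\<^sup>+z. E z \<partial>lborel) = ennreal N" by (simp only: E_def nn_integral_gauss N_def)
  have gauss: "(\<integral>\<^sup>+z. h z \<partial>gaussian) = (\<integral>\<^sup>+z. h z * E z \<partial>lborel) / ennreal N" if "h \<in> borel_measurable borel" for h :: "'a \<Rightarrow> ennreal"
    unfolding E_def N_def by (rule nn_integral_gaussian[OF that])
  have "(\<integral>\<^sup>+z. \<integral>\<^sup>+w. g (x + s *\<^sub>R z + t *\<^sub>R w) \<partial>gaussian \<partial>gaussian)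
      = (\<integral>\<^sup>+z. (\<integral>\<^sup>+w. g (x + s *\<^sub>R z + t *\<^sub>R w) * E w \<partial>lborel) / ennreal N \<partial>gaussian)"
    by (intro nn_integral_cong gauss) measurable
  also have "\<dots> = (\<integral>\<^sup>+z. (\<integral>\<^sup>+w. g (x + s *\<^sub>R z + t *\<^sub>R w) * E w \<partial>lborel) / ennreal N * E z \<partial>lborel) / ennreal N"
    by (intro gauss) measurable
  also have "(\<integral>\<^sup>+z. (\<integral>\<^sup>+w. g (x + s *\<^sub>R z + t *\<^sub>R w) * E w \<partial>lborel) / ennreal N * E z \<partial>lborel)
      = (\<integral>\<^sup>+z. (\<integral>\<^sup>+y. (c / ennreal N) * (g (x + r *\<^sub>R y) * (E y * E (A y z))) \<partial>lborel) \<partial>lborel)"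
  proof (rule nn_integral_cong)
    fix z
    have "(\<integral>\<^sup>+w. g (x + s *\<^sub>R z + t *\<^sub>R w) * E w \<partial>lborel) = c * (\<integral>\<^sup>+y. g (x + s *\<^sub>R z + t *\<^sub>R A z y) * E (A z y) \<partial>lborel)"
      by (rule affine) measurable
    also have "\<dots> = c * (\<integral>\<^sup>+y. g (x + r *\<^sub>R y) * E (A z y) \<partial>lborel)" by (simp only: shift)
    finally have "(\<integral>\<^sup>+w. g (x + s *\<^sub>R z + t *\<^sub>R w) * E w \<partial>lborel) / ennreal N * E z
      = (c / ennreal N * E z) * (\<integral>\<^sup>+y. g (x + r *\<^sub>R y) * E (A z y) \<partial>lborel)"
      by (simp add: divide_ennreal_def mult_ac)
    also have "\<dots> = (\<integral>\<^sup>+y. (c / ennreal N * E z) * (g (x + r *\<^sub>R y) * E (A z y)) \<partial>lborel)"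
      by (rule nn_integral_cmult[symmetric]) (simp add: A_def)
    also have "\<dots> = (\<integral>\<^sup>+y. (c / ennreal N) * (g (x + r *\<^sub>R y) * (E z * E (A z y))) \<partial>lborel)"
      by (intro nn_integral_cong) (simp add: mult_ac)
    finally show "(\<integral>\<^sup>+w. g (x + s *\<^sub>R z + t *\<^sub>R w) * E w \<partial>lborel) / ennreal N * E z
      = (\<integral>\<^sup>+y. (c / ennreal N) * (g (x + r *\<^sub>R y) * (E y * E (A y z))) \<partial>lborel)"
      by (simp only: exponent[of z])
  qed
  also have "\<dots> = (\<integral>\<^sup>+y. (\<integral>\<^sup>+z. (c / ennreal N) * (g (x + r *\<^sub>R y) * (E y * E (A y z))) \<partial>lborel) \<partial>lborel)"
    by (rule lborel_pair.Fubini') (simp add: A_def split_beta')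
  also have "\<dots> = (\<integral>\<^sup>+y. g (x + r *\<^sub>R y) * E y \<partial>lborel)"
  proof (rule nn_integral_cong)
    fix y
    have "(\<integral>\<^sup>+z. (c / ennreal N) * (g (x + r *\<^sub>R y) * (E y * E (A y z))) \<partial>lborel)
      = (\<integral>\<^sup>+z. (g (x + r *\<^sub>R y) * E y / ennreal N) * (c * E (A y z)) \<partial>lborel)"
      by (intro nn_integral_cong) (simp add: divide_ennreal_def mult_ac)
    also have "\<dots> = (g (x + r *\<^sub>R y) * E y / ennreal N) * (\<integral>\<^sup>+z. c * E (A y z) \<partial>lborel)"
      by (rule nn_integral_cmult) (simp add: A_def)
    also have "(\<integral>\<^sup>+z. c * E (A y z) \<partial>lborel) = c * (\<integral>\<^sup>+z. E (A y z) \<partial>lborel)"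
      by (rule nn_integral_cmult) (simp add: A_def)
    also have "\<dots> = ennreal N"
      using affine[of E y] total by simp
    also have "(g (x + r *\<^sub>R y) * E y / ennreal N) * ennreal N = g (x + r *\<^sub>R y) * E y"
      using N by (simp add: ennreal_divide_times ennreal_mult_divide_eq)
    finally show "(\<integral>\<^sup>+z. (c / ennreal N) * (g (x + r *\<^sub>R y) * (E y * E (A y z))) \<partial>lborel) = g (x + r *\<^sub>R y) * E y" .
  qed
  also have "\<dots> / ennreal N = (\<integral>\<^sup>+z. g (x + r *\<^sub>R z) \<partial>gaussian)"
    by (intro gauss[symmetric]) measurable
  finally show ?thesis by (simp add: r_def)
qed

context convex_laplacian
begin

text \<open>
  The spherical summands are replaced one at a time; the Gaussian vector that stands for those already
  replaced only shifts the centre \<open>x\<close>, which is why the claim is made for all \<open>x\<close>.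
\<close>

lemma sum_sphere_mean_le_gaussian_mean:
  fixes a :: "'i \<Rightarrow> real"
  assumes "finite I"
  shows "(\<integral>\<^sup>+y. ennreal (f (x + (\<Sum>i\<in>I. a i *\<^sub>R y i))) \<partial>(\<Pi>\<^sub>M i\<in>I. uniform_sphere))
    \<le> (\<integral>\<^sup>+z. ennreal (f (x + sqrt ((\<Sum>i\<in>I. (a i)\<^sup>2) / DIM('a)) *\<^sub>R z)) \<partial>gaussian)"
  using assms
proof (induction I arbitrary: x)
  case empty
  interpret g: prob_space "gaussian :: 'a measure" by (rule prob_space_gaussian)
  show ?case using g.emeasure_space_1 by (simp add: PiM_empty nn_integral_count_space_finite)
next
  case (insert j I)
  interpret S: prob_space "uniform_sphere :: 'a measure" by (rule prob_space_uniform_sphere)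
  interpret G: prob_space "gaussian :: 'a measure" by (rule prob_space_gaussian)
  interpret P: product_sigma_finite "\<lambda>_::'i. uniform_sphere :: 'a measure" ..
  interpret SG: pair_sigma_finite "gaussian :: 'a measure" "uniform_sphere :: 'a measure" ..
  define s where "s = sqrt ((\<Sum>i\<in>I. (a i)\<^sup>2) / DIM('a))"
  have s: "s \<ge> 0" by (simp add: s_def sum_nonneg)
  have "(\<integral>\<^sup>+y. ennreal (f (x + (\<Sum>i\<in>insert j I. a i *\<^sub>R y i))) \<partial>(\<Pi>\<^sub>M i\<in>insert j I. uniform_sphere))
     = (\<integral>\<^sup>+u. \<integral>\<^sup>+y. ennreal (f (x + (\<Sum>i\<in>insert j I. a i *\<^sub>R (y(j := u)) i))) \<partial>(\<Pi>\<^sub>M i\<in>I. uniform_sphere) \<partial>uniform_sphere)"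
    using insert.hyps by (intro P.product_nn_integral_insert_rev) measurable
  also have "\<dots> = (\<integral>\<^sup>+u. \<integral>\<^sup>+y. ennreal (f ((x + a j *\<^sub>R u) + (\<Sum>i\<in>I. a i *\<^sub>R y i))) \<partial>(\<Pi>\<^sub>M i\<in>I. uniform_sphere) \<partial>uniform_sphere)"
  proof -
    have "(\<Sum>i\<in>insert j I. a i *\<^sub>R (y(j := u)) i) = a j *\<^sub>R u + (\<Sum>i\<in>I. a i *\<^sub>R y i)" for y :: "'i \<Rightarrow> 'a" and u
    proof -
      have "(\<Sum>i\<in>I. a i *\<^sub>R (y(j := u)) i) = (\<Sum>i\<in>I. a i *\<^sub>R y i)"
        using insert.hyps by (intro sum.cong) auto
      then show ?thesis using insert.hyps by simp
    qed
    then show ?thesis by (simp only: add.assoc)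
  qed
  also have "\<dots> \<le> (\<integral>\<^sup>+u. \<integral>\<^sup>+z. ennreal (f ((x + a j *\<^sub>R u) + s *\<^sub>R z)) \<partial>gaussian \<partial>uniform_sphere)"
    unfolding s_def by (intro nn_integral_mono insert.IH)
  also have "\<dots> = (\<integral>\<^sup>+z. \<integral>\<^sup>+u. ennreal (f ((x + a j *\<^sub>R u) + s *\<^sub>R z)) \<partial>uniform_sphere \<partial>gaussian)"
    by (rule SG.Fubini') measurable
  also have "\<dots> = (\<integral>\<^sup>+z. \<integral>\<^sup>+u. ennreal (f ((x + s *\<^sub>R z) + a j *\<^sub>R u)) \<partial>uniform_sphere \<partial>gaussian)"
    by (simp only: add.assoc add.commute[of "s *\<^sub>R _"])
  also have "\<dots> \<le> (\<integral>\<^sup>+z. \<integral>\<^sup>+w. ennreal (f (x + s *\<^sub>R z + (a j / sqrt DIM('a)) *\<^sub>R w)) \<partial>gaussian \<partial>gaussian)"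
    by (intro nn_integral_mono sphere_mean_le_gaussian_mean)
  also have "\<dots> = (\<integral>\<^sup>+z. ennreal (f (x + sqrt (s\<^sup>2 + (a j / sqrt DIM('a))\<^sup>2) *\<^sub>R z)) \<partial>gaussian)"
    by (rule gaussian_convolution[OF _ s]) measurable
  also have "s\<^sup>2 + (a j / sqrt DIM('a))\<^sup>2 = (\<Sum>i\<in>insert j I. (a i)\<^sup>2) / DIM('a)"
    using insert.hyps by (simp add: s_def sum_nonneg power_divide add_divide_distrib)
  finally show ?case .
qed

end

section \<open>Two families of test functions\<close>

lemma convex_laplacian_norm_power2:
  "convex_laplacian (\<lambda>y::'a::euclidean_space. (norm y)\<^sup>2) (\<lambda>y. 2 *\<^sub>R y) (\<lambda>y w. 2 *\<^sub>R w) (\<lambda>y. 2 * real DIM('a))"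
proof
  show "((\<lambda>y::'a. (norm y)\<^sup>2) has_derivative (\<lambda>w. (2 *\<^sub>R y) \<bullet> w)) (at y)" for y
    unfolding power2_norm_eq_inner by (auto intro!: derivative_eq_intros simp: inner_commute)
  show "((\<lambda>y::'a. 2 *\<^sub>R y) has_derivative (\<lambda>w. 2 *\<^sub>R w)) (at y)" for y
    by (auto intro!: derivative_eq_intros)
  show "convex_on UNIV (\<lambda>y::'a. 2 * real DIM('a))" by (simp add: convex_on_const)
qed (auto intro!: exI[of _ 2])

lemma pos_part_power_deriv:
  "((\<lambda>r. (max 0 r) ^ (k + 2)) has_real_derivative real (k + 2) * (max 0 r) ^ (k + 1)) (at r)"
proof -
  consider "r > 0" | "r < 0" | "r = 0" by linarith
  then show ?thesis
  proof cases
    case 1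
    have "((\<lambda>s. s ^ (k + 2)) has_real_derivative real (k + 2) * (max 0 r) ^ (k + 1)) (at r)"
      using DERIV_pow[of "k + 2" r] 1 by (simp add: max_def)
    then show ?thesis
      by (rule has_field_derivative_transform_within_open[OF _ open_greaterThan[of 0]]) (use 1 in auto)
  next
    case 2
    have "((\<lambda>s. 0) has_real_derivative real (k + 2) * (max 0 r) ^ (k + 1)) (at r)"
      using 2 by simp
    then show ?thesis
      by (rule has_field_derivative_transform_within_open[OF _ open_lessThan[of 0]]) (use 2 in auto)
  next
    case 3
    have "((\<lambda>h::real. (max 0 h) ^ (k + 2) / h) \<longlongrightarrow> 0) (at 0)"
    proof (rule Lim_null_comparison)
      show "\<forall>\<^sub>F h::real in at 0. norm ((max 0 h) ^ (k + 2) / h) \<le> \<bar>h\<bar> ^ (k + 1)"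
      proof (intro always_eventually allI)
        fix h :: real
        show "norm ((max 0 h) ^ (k + 2) / h) \<le> \<bar>h\<bar> ^ (k + 1)"
        proof (cases "h > 0")
          case False
          then have "max 0 h = 0" by simp
          then have "norm ((max 0 h) ^ (k + 2) / h) = 0" by simp
          then show ?thesis by (simp only: zero_le_power abs_ge_zero)
        qed simp
      qed
      have "((\<lambda>h::real. \<bar>h\<bar> ^ (k + 1)) \<longlongrightarrow> \<bar>0\<bar> ^ (k + 1)) (at 0)" by (intro tendsto_intros)
      then show "((\<lambda>h::real. \<bar>h\<bar> ^ (k + 1)) \<longlongrightarrow> 0) (at 0)" by simp
    qed
    then show ?thesis unfolding 3 DERIV_def by simp
  qed
qed

lemma convex_on_comp_norm:
  fixes H :: "real \<Rightarrow> real"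
  assumes H: "convex_on {0..} H" and mono: "\<And>r s. 0 \<le> r \<Longrightarrow> r \<le> s \<Longrightarrow> H r \<le> H s"
  shows "convex_on UNIV (\<lambda>y::'a::real_normed_vector. H (norm y))"
proof (rule convex_onI)
  fix \<theta> :: real and y z :: 'a
  assume \<theta>: "0 < \<theta>" "\<theta> < 1"
  have "norm ((1 - \<theta>) *\<^sub>R y + \<theta> *\<^sub>R z) \<le> (1 - \<theta>) * norm y + \<theta> * norm z"
    using norm_triangle_ineq[of "(1 - \<theta>) *\<^sub>R y" "\<theta> *\<^sub>R z"] \<theta> by simp
  then have "H (norm ((1 - \<theta>) *\<^sub>R y + \<theta> *\<^sub>R z)) \<le> H ((1 - \<theta>) *\<^sub>R norm y + \<theta> *\<^sub>R norm z)"
    by (intro mono) auto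
  also have "\<dots> \<le> (1 - \<theta>) * H (norm y) + \<theta> * H (norm z)"
    using \<theta> by (intro convex_onD[OF H]) auto
  finally show "H (norm ((1 - \<theta>) *\<^sub>R y + \<theta> *\<^sub>R z)) \<le> (1 - \<theta>) * H (norm y) + \<theta> * H (norm z)" .
qed simp

lemma convex_on_pos_part: "convex_on UNIV (\<lambda>r::real. max 0 (r - t))"
proof (rule convex_onI)
  fix \<theta> r s :: real
  assume \<theta>: "0 < \<theta>" "\<theta> < 1"
  have "(1 - \<theta>) * (r - t) + \<theta> * (s - t) \<le> (1 - \<theta>) * max 0 (r - t) + \<theta> * max 0 (s - t)"
    using \<theta> by (intro add_mono mult_left_mono) auto
  moreover have "0 \<le> (1 - \<theta>) * max 0 (r - t) + \<theta> * max 0 (s - t)" using \<theta> by simp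
  moreover have "((1 - \<theta>) *\<^sub>R r + \<theta> *\<^sub>R s) - t = (1 - \<theta>) * (r - t) + \<theta> * (s - t)"
    by (simp add: algebra_simps)
  ultimately show "max 0 (((1 - \<theta>) *\<^sub>R r + \<theta> *\<^sub>R s) - t) \<le> (1 - \<theta>) * max 0 (r - t) + \<theta> * max 0 (s - t)"
    by simp
qed simp

text \<open>
  Up to the factor 3, this is the part of the Laplacian of \<open>(max 0 (norm y - t)) ^ 3\<close> that is
  multiplied by \<open>d - 1\<close>.  For \<open>r > t > 0\<close> it equals \<open>r - 2 t + t\<^sup>2 / r\<close>, and it joins
  the value 0 on \<open>r \<le> t\<close> with slope 0.
\<close>

definition ramp_quot :: "real \<Rightarrow> real \<Rightarrow> real" where "ramp_quot t r = (max 0 (r - t))\<^sup>2 / r"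
definition ramp_quot' :: "real \<Rightarrow> real \<Rightarrow> real" where
  "ramp_quot' t r = 2 * max 0 (r - t) / r - (max 0 (r - t))\<^sup>2 / r\<^sup>2"

context
  fixes t :: real assumes t: "t > 0"
begin

lemma ramp_quot_deriv: "(ramp_quot t has_real_derivative ramp_quot' t r) (at r)"
proof (cases "r > 0")
  case True
  have "((\<lambda>r. (max 0 (r - t)) ^ (0 + 2)) has_real_derivative real (0 + 2) * (max 0 (r - t)) ^ (0 + 1) * 1) (at r)"
    by (rule DERIV_chain2[OF pos_part_power_deriv]) (auto intro!: derivative_eq_intros)
  from DERIV_divide[OF this DERIV_ident] have
    "((\<lambda>r. (max 0 (r - t))\<^sup>2 / r) has_real_derivative (2 * max 0 (r - t) * r - (max 0 (r - t))\<^sup>2) / (r * r)) (at r)"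
    using True by (simp add: power2_eq_square)
  moreover have "(2 * max 0 (r - t) * r - (max 0 (r - t))\<^sup>2) / (r * r) = ramp_quot' t r"
    using True by (simp add: ramp_quot'_def diff_divide_distrib power2_eq_square)
  ultimately show ?thesis by (simp add: ramp_quot_def[abs_def])
next
  case False
  then have "r \<in> {..<t}" using t by simp
  have "((\<lambda>s. 0) has_real_derivative ramp_quot' t r) (at r)"
    using False t by (simp add: ramp_quot'_def max_def)
  then show ?thesis
    by (rule has_field_derivative_transform_within_open[OF _ open_lessThan \<open>r \<in> {..<t}\<close>])
      (simp add: ramp_quot_def max_def)
qed

lemma ramp_quot'_eq: "ramp_quot' t r = (if r \<le> t then 0 else 1 - t\<^sup>2 / r\<^sup>2)"
proof (cases "r \<le> t")
  case False
  then have r: "r > 0" using t by simp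
  have "ramp_quot' t r = (2 * (r - t) * r - (r - t)\<^sup>2) / r\<^sup>2"
    using False r by (simp add: ramp_quot'_def max_def diff_divide_distrib power2_eq_square)
  also have "2 * (r - t) * r - (r - t)\<^sup>2 = r\<^sup>2 - t\<^sup>2" by (simp add: power2_eq_square algebra_simps)
  also have "(r\<^sup>2 - t\<^sup>2) / r\<^sup>2 = 1 - t\<^sup>2 / r\<^sup>2" using r by (simp add: diff_divide_distrib)
  finally show ?thesis using False by simp
qed (simp add: ramp_quot'_def max_def)

lemma ramp_quot'_nonneg: "ramp_quot' t r \<ge> 0"
proof -
  have "t\<^sup>2 \<le> r\<^sup>2" if "\<not> r \<le> t" using that t by (intro power_mono) auto
  then show ?thesis using t by (auto simp: ramp_quot'_eq)
qed

lemma ramp_quot'_mono: "r \<le> s \<Longrightarrow> ramp_quot' t r \<le> ramp_quot' t s"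
proof (cases "r \<le> t")
  case True
  then show ?thesis using ramp_quot'_nonneg by (simp add: ramp_quot'_eq)
next
  case False
  assume rs: "r \<le> s"
  have "t\<^sup>2 / s\<^sup>2 \<le> t\<^sup>2 / r\<^sup>2"
    using False rs t by (intro divide_left_mono power_mono) auto
  then show ?thesis using False rs by (simp add: ramp_quot'_eq)
qed

lemma convex_ramp_quot: "convex_on UNIV (ramp_quot t)"
  by (rule convex_on_realI[OF _ ramp_quot_deriv]) (auto intro: ramp_quot'_mono)

lemma ramp_quot_mono: "r \<le> s \<Longrightarrow> ramp_quot t r \<le> ramp_quot t s"
  by (rule DERIV_nonneg_imp_nondecreasing) (use ramp_quot_deriv ramp_quot'_nonneg in blast)+

lemma ramp_quot_le: "r \<ge> 0 \<Longrightarrow> 0 \<le> ramp_quot t r \<and> ramp_quot t r \<le> r"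
proof -
  assume r: "r \<ge> 0"
  have "(max 0 (r - t))\<^sup>2 \<le> r\<^sup>2" using r t by (intro power_mono) auto
  then have "(max 0 (r - t))\<^sup>2 / r \<le> r\<^sup>2 / r" using r by (intro divide_right_mono) auto
  then show ?thesis using r by (simp add: ramp_quot_def power2_eq_square)
qed

text \<open>
  Since \<open>t > 0\<close>, the function vanishes near the origin, where the norm is not differentiable.  Its
  Laplacian is a convex increasing function of the norm.
\<close>

lemma convex_laplacian_ramp_cube:
  "convex_laplacian (\<lambda>y::'a::euclidean_space. (max 0 (norm y - t)) ^ 3)
    (\<lambda>y. (3 * max 0 (norm y - t) ^ 2 / norm y) *\<^sub>R y)
    (\<lambda>y w. (3 * max 0 (norm y - t) ^ 2 / norm y) *\<^sub>R w
        + ((6 * max 0 (norm y - t) / norm y - 3 * max 0 (norm y - t) ^ 2 / (norm y)\<^sup>2) * (w \<bullet> sgn y)) *\<^sub>R y)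
    (\<lambda>y. 6 * max 0 (norm y - t) + 3 * (real DIM('a) - 1) * ramp_quot t (norm y))"
    (is "convex_laplacian ?f ?P ?P' ?h")
proof
  fix y :: 'a
  show "(?f has_derivative (\<lambda>w. ?P y \<bullet> w)) (at y)"
  proof (cases "y = 0")
    case True
    have "(?f has_derivative (\<lambda>w. 0)) (at 0)"
      by (rule has_derivative_transform_within_open[OF has_derivative_const[of 0] open_ball[of 0 t]])
        (use t in \<open>auto simp: max_def\<close>)
    then show ?thesis using True by simp
  next
    case False
    have 1: "((\<lambda>r. (max 0 r) ^ (1 + 2)) has_derivative (\<lambda>h. (real (1 + 2) * (max 0 (norm y - t)) ^ (1 + 1)) * h)) (at (norm y - t))"
      using pos_part_power_deriv[of 1 "norm y - t"] by (simp add: has_field_derivative_def)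
    have 2: "((\<lambda>y::'a. norm y - t) has_derivative (\<lambda>w. w \<bullet> sgn y)) (at y)"
      using has_derivative_diff[OF has_derivative_norm[OF False] has_derivative_const[of t]] by simp
    have "(?f has_derivative (\<lambda>w. 3 * (max 0 (norm y - t))\<^sup>2 * (w \<bullet> sgn y))) (at y)"
      using has_derivative_compose[OF 2 1] by (simp add: numeral_3_eq_3 power2_eq_square)
    moreover have "3 * (max 0 (norm y - t))\<^sup>2 * (w \<bullet> sgn y) = ?P y \<bullet> w" for w
      by (simp add: sgn_div_norm inner_commute divide_inverse)
    ultimately show ?thesis by (simp only:)
  qed
  show "(?P has_derivative ?P' y) (at y)"
  proof (cases "y = 0")
    case True
    have "(?P has_derivative (\<lambda>w. 0)) (at 0)"
      by (rule has_derivative_transform_within_open[OF has_derivative_const[of 0] open_ball[of 0 t]])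
        (use t in \<open>auto simp: max_def\<close>)
    then show ?thesis using True by simp
  next
    case False
    have 1: "(ramp_quot t has_derivative (\<lambda>h. ramp_quot' t (norm y) * h)) (at (norm y))"
      using ramp_quot_deriv by (simp add: has_field_derivative_def)
    have 2: "((\<lambda>y::'a. ramp_quot t (norm y)) has_derivative (\<lambda>w. ramp_quot' t (norm y) * (w \<bullet> sgn y))) (at y)"
      by (rule has_derivative_compose[OF has_derivative_norm[OF False] 1])
    have 3: "((\<lambda>y::'a. (3 * ramp_quot t (norm y)) *\<^sub>R y) has_derivative
        (\<lambda>w. (3 * ramp_quot t (norm y)) *\<^sub>R w + (3 * (ramp_quot' t (norm y) * (w \<bullet> sgn y))) *\<^sub>R y)) (at y)"
      by (rule has_derivative_scaleR[OF has_derivative_mult_right[OF 2] has_derivative_ident])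
    have c: "6 * max 0 (norm y - t) / norm y - 3 * max 0 (norm y - t) ^ 2 / (norm y)\<^sup>2 = 3 * ramp_quot' t (norm y)"
      by (simp add: ramp_quot'_def)
    show ?thesis unfolding c using 3 by (simp add: ramp_quot_def mult.assoc)
  qed
  have c: "6 * max 0 (norm y - t) / norm y - 3 * max 0 (norm y - t) ^ 2 / (norm y)\<^sup>2 = 3 * ramp_quot' t (norm y)" for y :: 'a
    by (simp add: ramp_quot'_def)
  have k: "3 * max 0 (norm y - t) ^ 2 / norm y = 3 * ramp_quot t (norm y)" for y :: 'a
    by (simp add: ramp_quot_def)
  show "\<exists>C. \<forall>y. norm y \<le> R \<longrightarrow> (\<forall>w. norm (?P' y w) \<le> C * norm w)" for R
  proof (intro exI[of _ "6 * R"] allI impI)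
    fix y w :: 'a assume y: "norm y \<le> R"
    have "0 \<le> ramp_quot' t (norm y)" "ramp_quot' t (norm y) \<le> 1"
      using ramp_quot'_nonneg by (auto simp: ramp_quot'_eq)
    then have a: "3 * ramp_quot' t (norm y) \<le> 3" "0 \<le> 3 * ramp_quot' t (norm y)" by auto
    have "\<bar>w \<bullet> sgn y\<bar> \<le> norm w * norm (sgn y)" by (rule Cauchy_Schwarz_ineq2)
    also have "\<dots> \<le> norm w * 1" by (intro mult_left_mono) (auto simp: norm_sgn)
    finally have b: "\<bar>w \<bullet> sgn y\<bar> \<le> norm w" by simp
    have "norm (?P' y w) \<le> norm ((3 * ramp_quot t (norm y)) *\<^sub>R w) + norm ((3 * ramp_quot' t (norm y) * (w \<bullet> sgn y)) *\<^sub>R y)"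
      unfolding c k by (rule norm_triangle_ineq)
    also have "norm ((3 * ramp_quot t (norm y)) *\<^sub>R w) \<le> 3 * R * norm w"
      using ramp_quot_le[of "norm y"] y by (simp add: mult_right_mono)
    also have "norm ((3 * ramp_quot' t (norm y) * (w \<bullet> sgn y)) *\<^sub>R y) = (3 * ramp_quot' t (norm y)) * \<bar>w \<bullet> sgn y\<bar> * norm y"
      using a by (simp add: abs_mult)
    also have "\<dots> \<le> 3 * norm w * R"
      using a b y by (intro mult_mono) auto
    finally show "norm (?P' y w) \<le> 6 * R * norm w" by (simp add: algebra_simps)
  qed
  show "(\<lambda>y. ?P' y e) \<in> borel_measurable borel" for e
    unfolding sgn_div_norm by measurable
  show "?h y = (\<Sum>e\<in>Basis. ?P' y e \<bullet> e)"
  proof -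
    have "(\<Sum>e\<in>Basis. ?P' y e \<bullet> e) = (\<Sum>e\<in>Basis. 3 * ramp_quot t (norm y) * (e \<bullet> e) + 3 * ramp_quot' t (norm y) * ((y \<bullet> e) * (sgn y \<bullet> e)))"
      unfolding c k by (intro sum.cong refl) (simp add: inner_add_left inner_commute[of "sgn y"] mult_ac)
    also have "\<dots> = 3 * ramp_quot t (norm y) * DIM('a) + 3 * ramp_quot' t (norm y) * (\<Sum>e\<in>Basis. (y \<bullet> e) * (sgn y \<bullet> e))"
      by (simp add: sum.distrib sum_distrib_left mult_ac)
    also have "(\<Sum>e\<in>Basis. (y \<bullet> e) * (sgn y \<bullet> e)) = norm y"
      unfolding euclidean_inner[symmetric]
      by (cases "y = 0") (simp_all add: sgn_div_norm power2_norm_eq_inner[symmetric] power2_eq_square)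
    also have "3 * ramp_quot' t (norm y) * norm y = 6 * max 0 (norm y - t) - 3 * ramp_quot t (norm y)"
      by (cases "y = 0") (use t in \<open>auto simp: ramp_quot'_def ramp_quot_def max_def field_simps power2_eq_square\<close>)
    finally show ?thesis by (simp add: algebra_simps)
  qed
  have d: "real DIM('a) \<ge> 1" by (simp add: Suc_leI)
  show "convex_on UNIV ?h"
  proof (rule convex_on_comp_norm[where H = "\<lambda>r. 6 * max 0 (r - t) + 3 * (real DIM('a) - 1) * ramp_quot t r"])
    show "convex_on {0..} (\<lambda>r. 6 * max 0 (r - t) + 3 * (real DIM('a) - 1) * ramp_quot t r)"
      using d by (intro convex_on_add convex_on_cmul convex_on_subset[OF convex_on_pos_part] convex_on_subset[OF convex_ramp_quot]) auto
    show "6 * max 0 (r - t) + 3 * (real DIM('a) - 1) * ramp_quot t r \<le> 6 * max 0 (s - t) + 3 * (real DIM('a) - 1) * ramp_quot t s"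
      if "0 \<le> r" "r \<le> s" for r s
      using d that by (intro add_mono mult_left_mono ramp_quot_mono) auto
  qed
qed auto

end

section \<open>Log-concavity of the Gaussian norm tail\<close>

lemma gauss_tail_deriv:
  "(gauss_tail k has_real_derivative - (u ^ k * exp (- u\<^sup>2 / 2))) (at u)"
proof -
  let ?g = "\<lambda>x::real. x ^ k * exp (- x\<^sup>2 / 2)"
  have eq: "gauss_tail k s = integral {s..u + 1} ?g + gauss_tail k (u + 1)" if "s \<in> {u - 1<..<u + 1}" for s
  proof -
    have i: "integrable lborel (\<lambda>x. indicator {s..u + 1} x *\<^sub>R ?g x)"
      by (rule borel_integrable_compact) (auto intro!: continuous_intros)
    have "gauss_tail k s = (\<integral>x. indicator {s..u + 1} x *\<^sub>R ?g x + indicator {u + 1<..} x * ?g x \<partial>lborel)"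
      unfolding gauss_tail_def
      by (intro integral_cong_AE eventually_mono[OF AE_lborel_singleton[of s]]) (use that in \<open>auto simp: indicator_def\<close>)
    also have "\<dots> = (\<integral>x. indicator {s..u + 1} x *\<^sub>R ?g x \<partial>lborel) + gauss_tail k (u + 1)"
      unfolding gauss_tail_def by (intro Bochner_Integration.integral_add i integrable_gauss_tail)
    also have "(\<integral>x. indicator {s..u + 1} x *\<^sub>R ?g x \<partial>lborel) = integral {s..u + 1} ?g"
      using set_borel_integral_eq_integral(2)[of "{s..u + 1}" ?g] i
      by (simp add: set_integrable_def set_lebesgue_integral_def)
    finally show ?thesis .
  qed
  have "((\<lambda>s. integral {s..u + 1} ?g) has_real_derivative - ?g u) (at u within {u - 1..u + 1})"
    by (rule integral_has_real_derivative') (auto intro!: continuous_intros)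
  then have "((\<lambda>s. integral {s..u + 1} ?g) has_real_derivative - ?g u) (at u)"
    by (simp add: at_within_Icc_at)
  then have "((\<lambda>s. integral {s..u + 1} ?g + gauss_tail k (u + 1)) has_real_derivative - ?g u + 0) (at u)"
    by (rule DERIV_add) simp
  then have "((\<lambda>s. integral {s..u + 1} ?g + gauss_tail k (u + 1)) has_real_derivative - ?g u) (at u)"
    by simp
  then show ?thesis
    by (rule has_field_derivative_transform_within_open[OF _ open_greaterThanLessThan[of "u - 1" "u + 1"]])
      (use eq in auto)
qed

lemma gauss_tail_shift: "gauss_tail k u = (\<integral>s. indicator {0<..} s * ((u + s) ^ k * exp (- (u + s)\<^sup>2 / 2)) \<partial>lborel)"
proof -
  have "(\<lambda>x. indicator {u<..} x * (x ^ k * exp (- x\<^sup>2 / 2)) :: real) \<in> borel_measurable borel"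
    using integrable_gauss_tail by measurable
  from integral_lborel_affine[OF this, of 1 u] show ?thesis
    by (simp add: gauss_tail_def indicator_def)
qed

text \<open>
  The hazard rate of the density \<open>p x = x ^ k * exp (- x\<^sup>2 / 2)\<close> increases: writing the tail as the
  integral of \<open>p (u + s)\<close> over \<open>s > 0\<close>, this is \<open>p u * p (v + s) \<le> p v * p (u + s)\<close> for every \<open>s\<close>.
\<close>

lemma gauss_hazard_mono:
  assumes "0 \<le> u" "u \<le> v"
  shows "u ^ k * exp (- u\<^sup>2 / 2) * gauss_tail k v \<le> v ^ k * exp (- v\<^sup>2 / 2) * gauss_tail k u"
proof -
  let ?p = "\<lambda>x::real. x ^ k * exp (- x\<^sup>2 / 2)"
  have int: "integrable lborel (\<lambda>s. indicator {0<..} s * ?p (w + s))" for w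
  proof -
    have "integrable lborel (\<lambda>x. indicator {w<..} (w + 1 * x) * ?p (w + 1 * x))"
      by (rule lborel_integrable_real_affine[OF integrable_gauss_tail]) simp
    moreover have "(indicator {w<..} (w + 1 * x) :: real) = indicator {0<..} x" for x
      by (simp add: indicator_def)
    ultimately show ?thesis by simp
  qed
  have "?p u * gauss_tail k v = (\<integral>s. ?p u * (indicator {0<..} s * ?p (v + s)) \<partial>lborel)"
    unfolding gauss_tail_shift[of k v] by (rule integral_mult_right_zero[symmetric])
  also have "\<dots> \<le> (\<integral>s. ?p v * (indicator {0<..} s * ?p (u + s)) \<partial>lborel)"
  proof (intro integral_mono integrable_mult_right int)
    fix s :: real
    show "?p u * (indicator {0<..} s * ?p (v + s)) \<le> ?p v * (indicator {0<..} s * ?p (u + s))"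
    proof (cases "s > 0")
      case True
      have "u * (v + s) \<le> v * (u + s)" using assms True by (simp add: algebra_simps mult_right_mono)
      then have 1: "u ^ k * (v + s) ^ k \<le> v ^ k * (u + s) ^ k"
        unfolding power_mult_distrib[symmetric] using assms True by (intro power_mono) auto
      have "- u\<^sup>2 / 2 + - (v + s)\<^sup>2 / 2 \<le> - v\<^sup>2 / 2 + - (u + s)\<^sup>2 / 2"
      proof -
        have "v\<^sup>2 + (u + s)\<^sup>2 \<le> u\<^sup>2 + (v + s)\<^sup>2"
          using mult_left_mono[OF assms(2), of s] True by (simp add: power2_eq_square algebra_simps)
        then show ?thesis by (simp only: minus_divide_left[symmetric] add_divide_distrib[symmetric])
      qed
      then have 2: "exp (- u\<^sup>2 / 2) * exp (- (v + s)\<^sup>2 / 2) \<le> exp (- v\<^sup>2 / 2) * exp (- (u + s)\<^sup>2 / 2)"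
        unfolding exp_add[symmetric] by simp
      have "(u ^ k * (v + s) ^ k) * (exp (- u\<^sup>2 / 2) * exp (- (v + s)\<^sup>2 / 2)) \<le> (v ^ k * (u + s) ^ k) * (exp (- v\<^sup>2 / 2) * exp (- (u + s)\<^sup>2 / 2))"
        by (rule mult_mono[OF 1 2]) (use assms True in auto)
      then show ?thesis using True by (simp add: mult_ac)
    qed simp
  qed
  also have "\<dots> = ?p v * gauss_tail k u"
    unfolding gauss_tail_shift[of k u] by (rule integral_mult_right_zero)
  finally show ?thesis .
qed

definition gauss_hazard :: "nat \<Rightarrow> real \<Rightarrow> real" where
  "gauss_hazard k u = u ^ k * exp (- u\<^sup>2 / 2) / gauss_tail k u"

text \<open>
  The logarithm of the tail has the derivative \<open>- gauss_hazard k\<close>, so it is concave and lies below its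
  tangent at \<open>u\<close>.
\<close>

lemma gauss_tail_le_exponential:
  assumes u: "u \<ge> 0" and x: "x \<ge> 0"
  shows "gauss_tail k x \<le> gauss_tail k u * exp (gauss_hazard k u * (u - x))"
proof -
  define l where "l = gauss_hazard k u"
  define \<phi> where "\<phi> x = ln (gauss_tail k x) + l * x" for x
  have deriv: "(\<phi> has_real_derivative (l - gauss_hazard k x)) (at x)" if "x \<ge> 0" for x
  proof -
    have "((\<lambda>x. ln (gauss_tail k x)) has_real_derivative inverse (gauss_tail k x) * - (x ^ k * exp (- x\<^sup>2 / 2))) (at x)"
      by (rule DERIV_chain2[OF DERIV_ln[OF gauss_tail_pos[OF that]] gauss_tail_deriv])
    moreover have "((\<lambda>x. l * x) has_real_derivative l) (at x)"
      by (auto intro!: derivative_eq_intros)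
    ultimately have "(\<phi> has_real_derivative (inverse (gauss_tail k x) * - (x ^ k * exp (- x\<^sup>2 / 2)) + l)) (at x)"
      unfolding \<phi>_def[abs_def] by (rule DERIV_add)
    then show ?thesis by (simp add: gauss_hazard_def inverse_eq_divide)
  qed
  have mono: "gauss_hazard k v \<le> gauss_hazard k w" if "0 \<le> v" "v \<le> w" for v w
  proof -
    have "a / b \<le> c / d" if "b > 0" "d > 0" "a * d \<le> c * b" for a b c d :: real
      using that by (simp add: field_simps)
    from this[OF gauss_tail_pos gauss_tail_pos gauss_hazard_mono[OF that]] show ?thesis
      unfolding gauss_hazard_def using that by simp
  qed
  have "\<phi> x \<le> \<phi> u"
  proof (cases "x \<le> u")
    case True
    show ?thesis
    proof (rule DERIV_nonneg_imp_nondecreasing[OF True])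
      fix y assume "x \<le> y" "y \<le> u"
      then show "\<exists>D. (\<phi> has_real_derivative D) (at y) \<and> 0 \<le> D"
        using deriv[of y] mono[of y u] x by (intro exI[of _ "l - gauss_hazard k y"]) (auto simp: l_def)
    qed
  next
    case False
    show ?thesis
    proof (rule DERIV_nonpos_imp_nonincreasing[of u x])
      fix y assume "u \<le> y" "y \<le> x"
      then show "\<exists>D. (\<phi> has_real_derivative D) (at y) \<and> D \<le> 0"
        using deriv[of y] mono[of u y] u by (intro exI[of _ "l - gauss_hazard k y"]) (auto simp: l_def)
    qed (use False in simp)
  qed
  then have "ln (gauss_tail k x) \<le> ln (gauss_tail k u) + l * (u - x)"
    by (simp add: \<phi>_def algebra_simps)
  then have "exp (ln (gauss_tail k x)) \<le> exp (ln (gauss_tail k u) + l * (u - x))" by simp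
  then show ?thesis
    using gauss_tail_pos[OF u, of k] gauss_tail_pos[OF x, of k] by (simp add: exp_add l_def)
qed

definition norm_tail :: "'a::euclidean_space itself \<Rightarrow> real \<Rightarrow> real" where
  "norm_tail _ u = measure gaussian {z::'a. norm z > u}"

text \<open>
  Here the normalising constant of the density of the norm has cancelled.
\<close>

definition norm_hazard :: "'a::euclidean_space itself \<Rightarrow> real \<Rightarrow> real" where
  "norm_hazard _ u = gauss_hazard (DIM('a) - 1) u"

lemma norm_tail_eq: "u \<ge> 0 \<Longrightarrow> norm_tail TYPE('a::euclidean_space) u = gauss_tail (DIM('a) - 1) u / gauss_tail (DIM('a) - 1) 0"
  unfolding norm_tail_def measure_def
  using gauss_tail_pos[of u "DIM('a) - 1"] gauss_tail_pos[of 0 "DIM('a) - 1"]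
  by (simp add: gaussian_norm_tail)

lemma norm_tail_pos: "u \<ge> 0 \<Longrightarrow> norm_tail TYPE('a::euclidean_space) u > 0"
  using gauss_tail_pos[of u "DIM('a) - 1"] gauss_tail_pos[of 0 "DIM('a) - 1"] by (simp add: norm_tail_eq)

lemma norm_tail_0: "norm_tail TYPE('a::euclidean_space) 0 = 1"
  using gauss_tail_pos[of 0 "DIM('a) - 1"] by (simp add: norm_tail_eq)

lemma norm_hazard_pos: "u > 0 \<Longrightarrow> norm_hazard TYPE('a::euclidean_space) u > 0"
  using gauss_tail_pos[of u "DIM('a) - 1"] by (simp add: norm_hazard_def gauss_hazard_def)

lemma norm_hazard_nonneg: "u \<ge> 0 \<Longrightarrow> norm_hazard TYPE('a::euclidean_space) u \<ge> 0"
  using gauss_tail_pos[of u "DIM('a) - 1"] by (simp add: norm_hazard_def gauss_hazard_def)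

lemma norm_tail_le_exponential:
  assumes "u \<ge> 0" "x \<ge> 0"
  shows "norm_tail TYPE('a::euclidean_space) x \<le> norm_tail TYPE('a) u * exp (norm_hazard TYPE('a) u * (u - x))"
  using divide_right_mono[OF gauss_tail_le_exponential[OF assms, of "DIM('a) - 1"], of "gauss_tail (DIM('a) - 1) 0"]
    gauss_tail_pos[of 0 "DIM('a) - 1"] assms
  by (simp add: norm_tail_eq norm_hazard_def)

lemma pos_part_power_layer_cake:
  "ennreal ((max 0 r) ^ Suc m) = (\<integral>\<^sup>+y. ennreal (real (Suc m) * y ^ m) * indicator {0..} y * indicator {..<r} y \<partial>lborel)"
proof (cases "r > 0")
  case True
  have "(\<integral>\<^sup>+y. ennreal (real (Suc m) * y ^ m) * indicator {0..} y * indicator {..<r} y \<partial>lborel)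
     = (\<integral>\<^sup>+y. ennreal (real (Suc m) * y ^ m) * indicator {0..r} y \<partial>lborel)"
    by (intro nn_integral_cong_AE eventually_mono[OF AE_lborel_singleton[of r]]) (auto simp: indicator_def)
  also have "\<dots> = ennreal (r ^ Suc m - 0 ^ Suc m)"
  proof (rule nn_integral_FTC_Icc)
    show "((\<lambda>x. x ^ Suc m) has_real_derivative real (Suc m) * y ^ m) (at y)" for y :: real
      using DERIV_pow[of "Suc m" y] by simp
  qed (use True in auto)
  finally show ?thesis using True by (simp add: max_def)
next
  case False
  have "(\<integral>\<^sup>+y. ennreal (real (Suc m) * y ^ m) * indicator {0..} y * indicator {..<r} y \<partial>lborel) = (\<integral>\<^sup>+y. 0 \<partial>(lborel :: real measure))"
    using False by (intro nn_integral_cong) (auto simp: indicator_def)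
  then show ?thesis using False by (simp add: max_def)
qed

text \<open>
  The moment is the integral of the tail against \<open>k * y ^ (k - 1)\<close> with \<open>k = Suc m\<close>.  With the
  exponential bound in place of the tail, the integrand is a multiple of an Erlang density.
\<close>

lemma gaussian_pos_part_moment_le:
  assumes u: "u > 0" and t: "t \<ge> 0"
  defines "l \<equiv> norm_hazard TYPE('a::euclidean_space) u"
  shows "(\<integral>\<^sup>+z. ennreal ((max 0 (norm z - t)) ^ Suc m) \<partial>(gaussian :: 'a measure))
    \<le> ennreal (norm_tail TYPE('a) u * exp (l * (u - t)) * fact (Suc m) / l ^ Suc m)"
proof -
  interpret G: prob_space "gaussian :: 'a measure" by (rule prob_space_gaussian)
  have l: "l > 0" unfolding l_def by (rule norm_hazard_pos[OF u])
  interpret GL: pair_sigma_finite "gaussian :: 'a measure" "lborel :: real measure" ..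
  define q where "q = norm_tail TYPE('a)"
  define w where "w y = ennreal (real (Suc m) * y ^ m) * indicator {0..} y" for y :: real
  have wm[measurable]: "w \<in> borel_measurable borel" unfolding w_def by measurable
  have "(\<integral>\<^sup>+z. ennreal ((max 0 (norm z - t)) ^ Suc m) \<partial>(gaussian :: 'a measure))
      = (\<integral>\<^sup>+z. (\<integral>\<^sup>+y. w y * indicator {p. snd p < norm (fst p) - t} (z, y) \<partial>lborel) \<partial>(gaussian :: 'a measure))"
    unfolding pos_part_power_layer_cake w_def by (intro nn_integral_cong) (auto simp: indicator_def)
  also have "\<dots> = (\<integral>\<^sup>+y. (\<integral>\<^sup>+z. w y * indicator {p. snd p < norm (fst p) - t} (z, y) \<partial>(gaussian :: 'a measure)) \<partial>lborel)"
    by (rule GL.Fubini'[symmetric]) measurable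
  also have "\<dots> \<le> (\<integral>\<^sup>+y. ennreal (q u * exp (l * (u - t)) * fact (Suc m) / l ^ Suc m) * ennreal (erlang_density m l y) \<partial>lborel)"
  proof (rule nn_integral_mono)
    fix y :: real
    have "(\<integral>\<^sup>+z. w y * indicator {p. snd p < norm (fst p) - t} (z, y) \<partial>(gaussian :: 'a measure))
        = (\<integral>\<^sup>+z. w y * indicator {z. t + y < norm z} z \<partial>(gaussian :: 'a measure))"
      by (intro nn_integral_cong) (auto simp: indicator_def)
    also have "\<dots> = w y * emeasure gaussian {z::'a. t + y < norm z}"
      by (rule nn_integral_cmult_indicator) simp
    also have "\<dots> \<le> ennreal (q u * exp (l * (u - t)) * fact (Suc m) / l ^ Suc m) * ennreal (erlang_density m l y)"
    proof (cases "y \<ge> 0")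
      case True
      have "emeasure gaussian {z::'a. t + y < norm z} = ennreal (q (t + y))"
        unfolding q_def norm_tail_def by (rule G.emeasure_eq_measure)
      also have "\<dots> \<le> ennreal (q u * exp (l * (u - (t + y))))"
        unfolding q_def l_def using u t True by (intro ennreal_leI norm_tail_le_exponential) auto
      finally have "w y * emeasure gaussian {z::'a. t + y < norm z} \<le> ennreal (real (Suc m) * y ^ m) * ennreal (q u * exp (l * (u - (t + y))))"
        using True unfolding w_def by (simp add: mult_left_mono)
      also have "\<dots> = ennreal ((real (Suc m) * y ^ m) * (q u * exp (l * (u - (t + y)))))"
        using True by (intro ennreal_mult'[symmetric]) auto
      also have "(real (Suc m) * y ^ m) * (q u * exp (l * (u - (t + y)))) = (q u * exp (l * (u - t)) * fact (Suc m) / l ^ Suc m) * erlang_density m l y"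
      proof -
        have "exp (l * (u - (t + y))) = exp (l * (u - t)) * exp (- l * y)"
          by (simp add: exp_add[symmetric] algebra_simps)
        then show ?thesis using l True by (simp add: erlang_density_def)
      qed
      also have "ennreal \<dots> = ennreal (q u * exp (l * (u - t)) * fact (Suc m) / l ^ Suc m) * ennreal (erlang_density m l y)"
        using l u norm_tail_pos[of u, where 'a='a] by (intro ennreal_mult) (auto simp: q_def)
      finally show ?thesis .
    qed (simp add: w_def)
    finally show "(\<integral>\<^sup>+z. w y * indicator {p. snd p < norm (fst p) - t} (z, y) \<partial>(gaussian :: 'a measure)) \<le> \<dots>" .
  qed
  also have "\<dots> = ennreal (q u * exp (l * (u - t)) * fact (Suc m) / l ^ Suc m) * (\<integral>\<^sup>+y. ennreal (erlang_density m l y) \<partial>lborel)"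
    by (rule nn_integral_cmult) measurable
  also have "(\<integral>\<^sup>+y. ennreal (erlang_density m l y) \<partial>lborel) = 1"
    using prob_space.emeasure_space_1[OF prob_space_erlang_density[OF l, of m]] by (simp add: emeasure_density)
  finally show ?thesis by (simp add: q_def)
qed

text \<open>
  Equality holds at \<open>y = 3\<close>.  Taking square roots, the claim is \<open>exp ((y - 3) / 2) \<le> y / 3\<close>: a convex
  function against a linear one, so it suffices to check the end points.  At \<open>y = 7 / 5\<close> it says
  \<open>exp (8 / 5) \<ge> 225 / 49\<close>; this is about \<open>4.95 \<ge> 4.59\<close>.
\<close>

lemma exp_div_power2_le:
  fixes y :: real
  assumes "7/5 \<le> y" "y \<le> 3"
  shows "2 * exp y / y\<^sup>2 \<le> 2 * exp 3 / 9"
proof -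
  have e: "exp (8/5::real) \<ge> 225/49"
  proof -
    \<comment> \<open>The left-hand side is about 4.76, the bound to be shown about 4.59.\<close>
    have "(1 + 1/20 :: real) ^ 32 \<le> exp (1/20) ^ 32" by (intro power_mono exp_ge_add_one_self) auto
    also have "\<dots> = exp (8/5)" by (simp add: exp_of_nat_mult[symmetric])
    finally show ?thesis by (simp add: power_divide)
  qed
  define \<theta> where "\<theta> = (3 - y) / (8/5)"
  have \<theta>: "0 \<le> \<theta>" "\<theta> \<le> 1" using assms by (auto simp: \<theta>_def)
  have "exp (- 4/5 :: real) \<le> 7/15"
  proof -
    have "(exp (- 4/5 :: real))\<^sup>2 = exp (- 8/5)" by (simp add: exp_double[symmetric])
    also have "\<dots> = inverse (exp (8/5))" by (simp add: exp_minus)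
    also have "\<dots> \<le> inverse (225/49)" using e by (intro le_imp_inverse_le) auto
    also have "\<dots> = (7/15 :: real)\<^sup>2" by (simp add: power2_eq_square)
    finally show ?thesis by (rule power2_le_imp_le) simp
  qed
  then have "\<theta> * exp (- 4/5) \<le> \<theta> * (7/15)" using \<theta> by (intro mult_left_mono) auto
  moreover have "exp ((1 - \<theta>) *\<^sub>R 0 + \<theta> *\<^sub>R (- 4/5 :: real)) \<le> (1 - \<theta>) * exp 0 + \<theta> * exp (- 4/5)"
    using \<theta> by (intro convex_onD[OF exp_convex]) auto
  moreover have "(1 - \<theta>) *\<^sub>R 0 + \<theta> *\<^sub>R (- 4/5 :: real) = (y - 3) / 2"
    by (simp add: \<theta>_def field_simps)
  ultimately have "exp ((y - 3) / 2) \<le> (1 - \<theta>) + \<theta> * (7/15)"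
    by (simp only: exp_zero mult_1_right)
  also have "\<dots> = y / 3" by (simp add: \<theta>_def field_simps)
  finally have "(exp ((y - 3) / 2))\<^sup>2 \<le> (y / 3)\<^sup>2" by (intro power_mono) auto
  also have "(exp ((y - 3) / 2))\<^sup>2 = exp (y - 3)" by (simp add: exp_double[symmetric])
  finally have "exp y / exp 3 \<le> y\<^sup>2 / 9" by (simp add: exp_diff power_divide)
  then show ?thesis using assms by (simp add: field_simps)
qed

section \<open>From moments to tails\<close>

text \<open>
  Markov's inequality is strict here because \<open>X > u\<close> is a strict inequality: equality would force the
  event to be null, and then the left-hand side is 0.
\<close>

lemma (in prob_space) prob_greater_pos_part_moment_less:
  fixes X :: "'a \<Rightarrow> real"
  assumes X[measurable]: "X \<in> borel_measurable M" and tu: "t < u" and C: "C > 0"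
    and moment: "(\<integral>\<^sup>+\<omega>. ennreal ((max 0 (X \<omega> - t)) ^ Suc m) \<partial>M) \<le> ennreal C"
  shows "prob {\<omega> \<in> space M. X \<omega> > u} * (u - t) ^ Suc m < C"
proof -
  define A where "A = {\<omega> \<in> space M. X \<omega> > u}"
  have A[measurable]: "A \<in> sets M" unfolding A_def by measurable
  define Y where "Y \<omega> = (max 0 (X \<omega> - t)) ^ Suc m" for \<omega>
  have Ym[measurable]: "Y \<in> borel_measurable M" unfolding Y_def by measurable
  have Y0: "Y \<omega> \<ge> 0" for \<omega> by (simp add: Y_def)
  have fin: "(\<integral>\<^sup>+\<omega>. ennreal (Y \<omega>) \<partial>M) \<le> ennreal C" using moment by (simp add: Y_def)
  have Yint: "integrable M Y"
    by (rule integrableI_nonneg) (use Y0 fin in \<open>auto simp: le_less_trans\<close>)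
  have "ennreal (expectation Y) \<le> ennreal C"
    using fin nn_integral_eq_integral[OF Yint] Y0 by simp
  then have EY: "expectation Y \<le> C" using C by simp
  define D where "D \<omega> = Y \<omega> - (u - t) ^ Suc m * indicator A \<omega>" for \<omega>
  have Dint: "integrable M D" unfolding D_def
    by (intro Bochner_Integration.integrable_diff Yint integrable_mult_right) (simp add: emeasure_eq_measure)
  have strict: "(u - t) ^ Suc m < Y \<omega>" if "\<omega> \<in> A" for \<omega>
    using that tu unfolding Y_def A_def by (intro power_strict_mono) auto
  have D0: "D \<omega> \<ge> 0" for \<omega>
    using strict[of \<omega>] Y0[of \<omega>] by (cases "\<omega> \<in> A") (auto simp: D_def)
  have ED: "expectation D = expectation Y - prob A * (u - t) ^ Suc m"
    unfolding D_def using Yint by (simp add: Bochner_Integration.integral_diff emeasure_eq_measure mult.commute)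
  show ?thesis
  proof (cases "prob A = 0")
    case True
    then show ?thesis using C by (simp add: A_def)
  next
    case False
    have "expectation D \<noteq> 0"
    proof
      assume "expectation D = 0"
      then have "AE \<omega> in M. D \<omega> = 0"
        using D0 by (subst (asm) integral_nonneg_eq_0_iff_AE[OF Dint]) auto
      then have "AE \<omega> in M. \<omega> \<notin> A"
      proof eventually_elim
        case (elim \<omega>)
        then show ?case using strict[of \<omega>] by (auto simp: D_def)
      qed
      then have "prob A = 0" by (subst (asm) AE_iff_measurable[OF A]) (auto simp: emeasure_eq_measure A_def)
      then show False using False by simp
    qed
    moreover have "expectation D \<ge> 0" using D0 by simp
    ultimately have "prob A * (u - t) ^ Suc m < expectation Y" using ED by simp
    then show ?thesis using EY by (simp add: A_def)
  qed
qed

text \<open>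
  Let \<open>q\<close> be the Gaussian tail and \<open>l\<close> the hazard rate at \<open>u\<close>.  The choice \<open>t = u - 3 / l\<close> minimises the
  bound from the third moment but is available only for \<open>l u > 3\<close>; the other two cases fill the gap.
\<close>

lemma (in prob_space) tail_less_gaussian_norm_tail:
  fixes X :: "'a \<Rightarrow> real"
  assumes X[measurable]: "X \<in> borel_measurable M" and X0: "\<And>\<omega>. X \<omega> \<ge> 0"
    and moment2: "(\<integral>\<^sup>+\<omega>. ennreal ((X \<omega>)\<^sup>2) \<partial>M) \<le> (\<integral>\<^sup>+z. ennreal ((norm z)\<^sup>2) \<partial>(gaussian :: 'b::euclidean_space measure))"
    and moment3: "\<And>t. t > 0 \<Longrightarrow> (\<integral>\<^sup>+\<omega>. ennreal ((max 0 (X \<omega> - t)) ^ 3) \<partial>M)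
        \<le> (\<integral>\<^sup>+z. ennreal ((max 0 (norm z - t)) ^ 3) \<partial>(gaussian :: 'b measure))"
    and u: "u \<ge> 0"
  shows "prob {\<omega> \<in> space M. X \<omega> > u} < 2 * exp 3 / 9 * norm_tail TYPE('b) u"
proof -
  define q where "q = norm_tail TYPE('b) u"
  define l where "l = norm_hazard TYPE('b) u"
  define p where "p = prob {\<omega> \<in> space M. X \<omega> > u}"
  have q: "q > 0" unfolding q_def by (rule norm_tail_pos[OF u])
  have l0: "l \<ge> 0" unfolding l_def by (rule norm_hazard_nonneg[OF u])
  consider "l * u \<le> 7/5" | "7/5 \<le> l * u" "l * u \<le> 3" | "3 < l * u" by linarith
  then have "p < 2 * exp 3 / 9 * q"
  proof cases
    case 1
    have "p \<le> 1" unfolding p_def by (rule prob_le_1)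
    also have "1 \<le> q * exp (l * (u - 0))"
      using norm_tail_le_exponential[OF u, of 0, where 'a='b] by (simp add: norm_tail_0 q_def l_def)
    also have "\<dots> \<le> q * exp (7/5)" using 1 q by (intro mult_left_mono) auto
    also have "exp (7/5 :: real) < 2 * exp 3 / 9"
    proof -
      have "2 * exp (7/5 :: real) / (7/5)\<^sup>2 \<le> 2 * exp 3 / 9" by (rule exp_div_power2_le) auto
      moreover have "2 * exp (7/5 :: real) / (7/5)\<^sup>2 = exp (7/5) * (50 / 49)" by (simp add: power2_eq_square)
      moreover have "exp (7/5 :: real) * 1 < exp (7/5) * (50 / 49)" by (intro mult_strict_left_mono) auto
      ultimately show ?thesis by linarith
    qed
    finally show ?thesis using q by (simp add: mult.commute)
  next
    case 2
    have pos: "u > 0" using 2(1) u by (cases "u = 0") auto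
    have lpos: "l > 0" using 2(1) l0 by (cases "l = 0") auto
    have "(\<integral>\<^sup>+\<omega>. ennreal ((max 0 (X \<omega> - 0)) ^ Suc 1) \<partial>M) \<le> (\<integral>\<^sup>+z. ennreal ((max 0 (norm z - 0)) ^ Suc 1) \<partial>(gaussian :: 'b measure))"
      using moment2 X0 by (simp add: max_absorb2 power2_eq_square)
    also have "\<dots> \<le> ennreal (q * exp (l * (u - 0)) * fact (Suc 1) / l ^ Suc 1)"
      unfolding q_def l_def by (rule gaussian_pos_part_moment_le[OF pos]) simp
    finally have "p * (u - 0) ^ Suc 1 < q * exp (l * (u - 0)) * fact (Suc 1) / l ^ Suc 1"
      unfolding p_def using pos lpos q by (intro prob_greater_pos_part_moment_less X) auto
    then have "p * u\<^sup>2 < q * exp (l * u) * 2 / l\<^sup>2" by (simp add: power2_eq_square)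
    then have "p < q * (2 * exp (l * u) / (l * u)\<^sup>2)"
      using pos lpos by (simp add: field_simps power2_eq_square)
    also have "\<dots> \<le> q * (2 * exp 3 / 9)"
      using q by (intro mult_left_mono exp_div_power2_le 2) auto
    finally show ?thesis by (simp add: mult.commute)
  next
    case 3
    have pos: "u > 0" using 3 u by (cases "u = 0") auto
    have lpos: "l > 0" using 3 l0 by (cases "l = 0") auto
    define t where "t = u - 3 / l"
    have t: "t > 0" using 3 lpos by (simp add: t_def field_simps)
    have ut: "u - t = 3 / l" by (simp add: t_def)
    have "(\<integral>\<^sup>+\<omega>. ennreal ((max 0 (X \<omega> - t)) ^ Suc 2) \<partial>M) \<le> (\<integral>\<^sup>+z. ennreal ((max 0 (norm z - t)) ^ Suc 2) \<partial>(gaussian :: 'b measure))"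
      using moment3[OF t] by (simp add: numeral_3_eq_3 numeral_2_eq_2)
    also have "\<dots> \<le> ennreal (q * exp (l * (u - t)) * fact (Suc 2) / l ^ Suc 2)"
      unfolding q_def l_def using t by (intro gaussian_pos_part_moment_le[OF pos]) simp
    finally have "p * (u - t) ^ Suc 2 < q * exp (l * (u - t)) * fact (Suc 2) / l ^ Suc 2"
      unfolding p_def using lpos q by (intro prob_greater_pos_part_moment_less X) (auto simp: t_def)
    then have "p * (27 / l ^ 3) < q * exp 3 * 6 / l ^ 3"
      unfolding ut using lpos by (simp add: fact_numeral eval_nat_numeral)
    then have "p * 27 < q * exp 3 * 6" using lpos by (simp add: divide_less_cancel)
    then show ?thesis by (simp add: mult_ac)
  qed
  then show ?thesis by (simp add: p_def q_def)
qed

lemma (in convex_laplacian) indep_sum_sphere_mean_le_gaussian_mean: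
  fixes M :: "'w measure" and U :: "'i \<Rightarrow> 'w \<Rightarrow> 'a" and b :: "'i \<Rightarrow> real"
  assumes M: "prob_space M" and I: "finite I" "I \<noteq> {}"
    and indep: "prob_space.indep_vars M (\<lambda>_. borel) U I"
    and dist: "\<And>i. i \<in> I \<Longrightarrow> distr M borel (U i) = uniform_sphere"
    and b: "(\<Sum>i\<in>I. (b i)\<^sup>2) = DIM('a)"
  shows "(\<integral>\<^sup>+\<omega>. ennreal (f (\<Sum>i\<in>I. b i *\<^sub>R U i \<omega>)) \<partial>M) \<le> (\<integral>\<^sup>+z. ennreal (f z) \<partial>gaussian)"
proof -
  interpret prob_space M by (rule M)
  have rv: "random_variable borel (U i)" if "i \<in> I" for i
    using indep that unfolding indep_vars_def by auto
  have "(\<integral>\<^sup>+\<omega>. ennreal (f (\<Sum>i\<in>I. b i *\<^sub>R U i \<omega>)) \<partial>M)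
     = (\<integral>\<^sup>+\<omega>. ennreal (f (0 + (\<Sum>i\<in>I. b i *\<^sub>R (\<lambda>i\<in>I. U i \<omega>) i))) \<partial>M)"
    by (simp cong: sum.cong)
  also have "\<dots> = (\<integral>\<^sup>+y. ennreal (f (0 + (\<Sum>i\<in>I. b i *\<^sub>R y i))) \<partial>distr M (\<Pi>\<^sub>M i\<in>I. borel) (\<lambda>\<omega>. \<lambda>i\<in>I. U i \<omega>))"
    by (rule nn_integral_distr[symmetric]) (use rv in measurable)
  also have "distr M (\<Pi>\<^sub>M i\<in>I. borel) (\<lambda>\<omega>. \<lambda>i\<in>I. U i \<omega>) = (\<Pi>\<^sub>M i\<in>I. distr M borel (U i))"
    using indep_vars_iff_distr_eq_PiM'[OF I(2) rv] indep by simp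
  also have "\<dots> = (\<Pi>\<^sub>M i\<in>I. uniform_sphere)"
    by (intro PiM_cong refl dist)
  also have "(\<integral>\<^sup>+y. ennreal (f (0 + (\<Sum>i\<in>I. b i *\<^sub>R y i))) \<partial>(\<Pi>\<^sub>M i\<in>I. uniform_sphere))
     \<le> (\<integral>\<^sup>+z. ennreal (f (0 + sqrt ((\<Sum>i\<in>I. (b i)\<^sup>2) / DIM('a)) *\<^sub>R z)) \<partial>gaussian)"
    by (rule sum_sphere_mean_le_gaussian_mean[OF I(1)])
  also have "\<dots> = (\<integral>\<^sup>+z. ennreal (f z) \<partial>gaussian)" by (simp add: b)
  finally show ?thesis .
qed

lemma measurable_vec_lambda_PiM [measurable]:
  "(\<lambda>f. \<chi> i. f i) \<in> borel_measurable (\<Pi>\<^sub>M i\<in>(UNIV :: 'd::finite set). (borel :: real measure))"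
proof (subst borel_measurable_euclidean_space, rule ballI)
  fix b :: "real ^ 'd" assume "b \<in> Basis"
  then obtain j where j: "b = axis j 1" by (auto simp: Basis_vec_def)
  have "(\<lambda>f::'d \<Rightarrow> real. (\<chi> i. f i) \<bullet> b) = (\<lambda>f. f j)" by (simp add: j inner_axis fun_eq_iff)
  then show "(\<lambda>f::'d \<Rightarrow> real. (\<chi> i. f i) \<bullet> b) \<in> borel_measurable (\<Pi>\<^sub>M i\<in>UNIV. borel)" by simp
qed

lemma lborel_eq_distr_PiM_cart:
  "(lborel :: (real ^ 'd::finite) measure) = distr (\<Pi>\<^sub>M i\<in>UNIV. lborel) borel (\<lambda>f. \<chi> i. f i)"
proof (rule lborel_eqI)
  interpret product_sigma_finite "\<lambda>_::'d. lborel :: real measure" ..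
  fix l u :: "real ^ 'd" assume lu: "\<And>b. b \<in> Basis \<Longrightarrow> l \<bullet> b \<le> u \<bullet> b"
  have le: "l $ i \<le> u $ i" for i using lu[of "axis i 1"] by (simp add: inner_axis)
  have m: "(\<lambda>f. \<chi> i. f i) \<in> measurable (\<Pi>\<^sub>M i\<in>(UNIV :: 'd set). (lborel :: real measure)) borel"
    by (subst measurable_cong_sets[OF sets_PiM_cong[OF refl sets_lborel] refl]) (rule measurable_vec_lambda_PiM)
  have "(\<lambda>f. \<chi> i. f i) -` box l u \<inter> space (\<Pi>\<^sub>M i\<in>UNIV. lborel) = (\<Pi>\<^sub>E i\<in>UNIV. {l $ i<..<u $ i})"
    by (auto simp: space_PiM mem_box_cart PiE_UNIV_domain Pi_iff)
  then have "emeasure (distr (\<Pi>\<^sub>M i\<in>UNIV. lborel) borel (\<lambda>f. \<chi> i. f i)) (box l u) = (\<Prod>i\<in>UNIV. emeasure lborel {l $ i<..<u $ i})"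
    by (subst emeasure_distr[OF m]) (auto simp: emeasure_PiM)
  also have "\<dots> = ennreal (\<Prod>i\<in>UNIV. u $ i - l $ i)"
    using le by (simp add: prod_ennreal)
  also have "(\<Prod>i\<in>UNIV. u $ i - l $ i) = (\<Prod>b\<in>Basis. (u - l) \<bullet> b)"
    by (simp add: Basis_vec_def cart_eq_inner_axis axis_eq_axis prod.UNION_disjoint inner_diff_left)
  finally show "emeasure (distr (\<Pi>\<^sub>M i\<in>UNIV. lborel) borel (\<lambda>f. \<chi> i. f i)) (box l u) = (\<Prod>b\<in>Basis. (u - l) \<bullet> b)" .
qed simp

text \<open>
  The product density is \<open>exp (- (norm z)\<^sup>2 / 2)\<close> up to a constant factor, and the constant is determined
  by the total mass 1.
\<close>

lemma distr_std_normal_vector: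
  fixes Z :: "'w \<Rightarrow> real ^ 'd::finite"
  assumes M: "prob_space M" and Z: "std_normal_vector M Z"
  shows "Z \<in> borel_measurable M" "distr M borel Z = gaussian"
proof -
  interpret prob_space M by (rule M)
  let ?\<nu> = "density lborel (\<lambda>x. ennreal (std_normal_density x)) :: real measure"
  interpret nu: prob_space ?\<nu> by (rule prob_space_normal_density) simp
  interpret P: product_sigma_finite "\<lambda>_::'d. lborel :: real measure" ..
  interpret Pn: product_sigma_finite "\<lambda>_::'d. ?\<nu>" ..
  have indep: "indep_vars (\<lambda>_. borel) (\<lambda>j \<omega>. Z \<omega> $ j) UNIV"
    and dens: "distributed M lborel (\<lambda>\<omega>. Z \<omega> $ j) std_normal_density" for j
    using Z unfolding std_normal_vector_def by auto
  have rv[measurable]: "random_variable borel (\<lambda>\<omega>. Z \<omega> $ j)" for j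
    using distributed_measurable[OF dens[of j]] by simp
  show Zm[measurable]: "Z \<in> borel_measurable M"
  proof (subst borel_measurable_euclidean_space, rule ballI)
    fix b :: "real ^ 'd" assume "b \<in> Basis"
    then obtain j where "b = axis j 1" by (auto simp: Basis_vec_def)
    then show "(\<lambda>\<omega>. Z \<omega> \<bullet> b) \<in> borel_measurable M" by (simp add: inner_axis)
  qed
  have marg: "distr M borel (\<lambda>\<omega>. Z \<omega> $ j) = ?\<nu>" for j
    using distributed_distr_eq_density[OF dens[of j]] by (simp cong: distr_cong)
  have "distr M borel Z = distr M borel (\<lambda>\<omega>. \<chi> j. (\<lambda>j\<in>UNIV. Z \<omega> $ j) j)"
    by (simp add: vec_lambda_eta)
  also have "\<dots> = distr (distr M (\<Pi>\<^sub>M j\<in>UNIV. borel) (\<lambda>\<omega>. \<lambda>j\<in>UNIV. Z \<omega> $ j)) borel (\<lambda>f. \<chi> j. f j)"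
    by (subst distr_distr) (auto simp: comp_def)
  also have "distr M (\<Pi>\<^sub>M j\<in>UNIV. borel) (\<lambda>\<omega>. \<lambda>j\<in>UNIV. Z \<omega> $ j) = (\<Pi>\<^sub>M j\<in>UNIV. ?\<nu>)"
    using indep_vars_iff_distr_eq_PiM'[where I = UNIV and M' = "\<lambda>_. borel" and X = "\<lambda>j \<omega>. Z \<omega> $ j"] indep rv marg by simp
  also have "\<dots> = density (\<Pi>\<^sub>M j\<in>UNIV. lborel) (\<lambda>f. \<Prod>j\<in>UNIV. ennreal (std_normal_density (f j)))"
  proof (rule Pn.PiM_eqI[symmetric])
    fix A :: "'d \<Rightarrow> real set" assume A: "\<And>i. i \<in> UNIV \<Longrightarrow> A i \<in> sets ?\<nu>"
    then have Am[measurable]: "A i \<in> sets borel" for i by simp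
    have "emeasure (density (\<Pi>\<^sub>M j\<in>UNIV. lborel) (\<lambda>f. \<Prod>j\<in>UNIV. ennreal (std_normal_density (f j)))) (Pi\<^sub>E UNIV A)
       = (\<integral>\<^sup>+f. (\<Prod>j\<in>UNIV. ennreal (std_normal_density (f j))) * indicator (Pi\<^sub>E UNIV A) f \<partial>(\<Pi>\<^sub>M j\<in>UNIV. lborel))"
      by (rule emeasure_density) (auto intro!: sets_PiM_I_finite)
    also have "\<dots> = (\<integral>\<^sup>+f. (\<Prod>j\<in>UNIV. ennreal (std_normal_density (f j)) * indicator (A j) (f j)) \<partial>(\<Pi>\<^sub>M j\<in>UNIV. lborel))"
    proof (rule nn_integral_cong)
      fix f :: "'d \<Rightarrow> real"
      have "(indicator (Pi\<^sub>E UNIV A) f :: ennreal) = (\<Prod>j\<in>UNIV. indicator (A j) (f j))"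
        by (simp add: indicator_def PiE_UNIV_domain prod_eq_1_iff Pi_iff prod_zero_iff) 
      then show "(\<Prod>j\<in>UNIV. ennreal (std_normal_density (f j))) * indicator (Pi\<^sub>E UNIV A) f
          = (\<Prod>j\<in>UNIV. ennreal (std_normal_density (f j)) * indicator (A j) (f j))"
        by (simp add: prod.distrib)
    qed
    also have "\<dots> = (\<Prod>j\<in>UNIV. \<integral>\<^sup>+x. ennreal (std_normal_density x) * indicator (A j) x \<partial>lborel)"
      by (rule P.product_nn_integral_prod) auto
    also have "\<dots> = (\<Prod>j\<in>UNIV. emeasure ?\<nu> (A j))"
      by (intro prod.cong refl emeasure_density[symmetric]) auto
    finally show "emeasure (density (\<Pi>\<^sub>M j\<in>UNIV. lborel) (\<lambda>f. \<Prod>j\<in>UNIV. ennreal (std_normal_density (f j)))) (Pi\<^sub>E UNIV A)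
       = (\<Prod>j\<in>UNIV. emeasure ?\<nu> (A j))" .
  qed (auto intro!: sets_PiM_cong)
  also have "distr \<dots> borel (\<lambda>f. \<chi> j. f j)
     = distr (density (\<Pi>\<^sub>M j\<in>UNIV. lborel) (\<lambda>f. \<Prod>j\<in>UNIV. ennreal (std_normal_density ((\<chi> j. f j) $ j)))) borel (\<lambda>f. \<chi> j. f j)"
    by simp
  also have "\<dots> = density (distr (\<Pi>\<^sub>M j\<in>UNIV. lborel) borel (\<lambda>f. \<chi> j. f j)) (\<lambda>z. \<Prod>j\<in>UNIV. ennreal (std_normal_density (z $ j)))"
  proof (rule density_distr[symmetric])
    show "(\<lambda>f. \<chi> i. f i) \<in> measurable (\<Pi>\<^sub>M i\<in>(UNIV :: 'd set). (lborel :: real measure)) borel"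
      by (subst measurable_cong_sets[OF sets_PiM_cong[OF refl sets_lborel] refl]) (rule measurable_vec_lambda_PiM)
  qed measurable
  also have "\<dots> = density lborel (\<lambda>z. \<Prod>j\<in>UNIV. ennreal (std_normal_density (z $ j)))"
    by (simp only: lborel_eq_distr_PiM_cart[symmetric])
  also have "(\<lambda>z :: real ^ 'd. \<Prod>j\<in>UNIV. ennreal (std_normal_density (z $ j)))
     = (\<lambda>z. ennreal ((1 / sqrt (2 * pi)) ^ CARD('d) * exp (- (norm z)\<^sup>2 / 2)))"
  proof
    fix z :: "real ^ 'd"
    have "(\<Prod>j\<in>UNIV. ennreal (std_normal_density (z $ j))) = ennreal (\<Prod>j\<in>UNIV. std_normal_density (z $ j))"
      by (rule prod_ennreal) simp
    also have "(\<Prod>j\<in>UNIV. std_normal_density (z $ j)) = (1 / sqrt (2 * pi)) ^ CARD('d) * exp (\<Sum>j\<in>UNIV. - (z $ j)\<^sup>2 / 2)"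
      by (simp add: std_normal_density_def exp_sum prod_dividef power_one_over field_simps)
    also have "(\<Sum>j\<in>UNIV. - (z $ j)\<^sup>2 / 2) = - (norm z)\<^sup>2 / 2"
      by (simp add: norm_vec_def L2_set_def sum_nonneg sum_negf sum_divide_distrib)
    finally show "(\<Prod>j\<in>UNIV. ennreal (std_normal_density (z $ j))) = ennreal ((1 / sqrt (2 * pi)) ^ CARD('d) * exp (- (norm z)\<^sup>2 / 2))" .
  qed
  finally have law: "distr M borel Z = density lborel (\<lambda>z. ennreal ((1 / sqrt (2 * pi)) ^ CARD('d) * exp (- (norm z)\<^sup>2 / 2)))" .
  define K where "K = (1 / sqrt (2 * pi)) ^ CARD('d)"
  define N where "N = gauss_normalizer TYPE(real ^ 'd)"
  have K: "K > 0" by (simp add: K_def)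
  have N: "N > 0" unfolding N_def by (rule gauss_normalizer_pos)
  have "prob_space (distr M borel Z)" by (rule prob_space_distr) simp
  then have "1 = emeasure (density lborel (\<lambda>z::real ^ 'd. ennreal (K * exp (- (norm z)\<^sup>2 / 2)))) UNIV"
    unfolding law K_def using prob_space.emeasure_space_1 by fastforce
  also have "\<dots> = (\<integral>\<^sup>+z. ennreal K * ennreal (exp (- (norm z)\<^sup>2 / 2)) \<partial>(lborel :: (real ^ 'd) measure))"
    using K by (subst emeasure_density) (auto simp: ennreal_mult intro!: nn_integral_cong)
  also have "\<dots> = ennreal K * ennreal N"
    by (subst nn_integral_cmult) (auto simp only: nn_integral_gauss N_def, measurable)
  also have "\<dots> = ennreal (K * N)" using K by (simp add: ennreal_mult')
  finally have "K * N = 1" using K N by (simp add: ennreal_eq_1)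
  then have "K = 1 / N" using N by (simp add: field_simps)
  then show "distr M borel Z = gaussian"
    unfolding law gaussian_def K_def[symmetric] N_def[symmetric] by simp
qed

theorem theorem1:
  fixes M :: "'w measure"
    and U :: "nat \<Rightarrow> 'w \<Rightarrow> real ^ 'd::finite"
    and Z :: "'w \<Rightarrow> real ^ 'd"
    and as :: "nat \<Rightarrow> real"
    and n :: nat
    and a c :: real
  assumes "prob_space M"
    and "n \<ge> 1"
    and "prob_space.indep_vars M (\<lambda>_. borel) U {1..n}"
    and "\<forall>i\<in>{1..n}. distr M borel (U i) = uniform_sphere"
    and "std_normal_vector M Z"
    and "a = sqrt ((\<Sum>i=1..n. (as i)\<^sup>2) / real CARD('d))"
    and "c = 2 * exp 3 / 9"
  shows "(\<forall>u::real. \<P>(\<omega> in M. norm (\<Sum>i=1..n. as i *\<^sub>R U i \<omega>) > u)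
                   \<le> c * \<P>(\<omega> in M. a * norm (Z \<omega>) > u))
       \<and> (\<forall>u::real. (\<exists>i\<in>{1..n}. as i \<noteq> 0) \<or> u < 0 \<longrightarrow>
                     \<P>(\<omega> in M. norm (\<Sum>i=1..n. as i *\<^sub>R U i \<omega>) > u)
                   < c * \<P>(\<omega> in M. a * norm (Z \<omega>) > u))"
proof -
  interpret prob_space M by (rule assms(1))
  note Zm[measurable] = distr_std_normal_vector(1)[OF assms(1,5)]
  note Zlaw = distr_std_normal_vector(2)[OF assms(1,5)]
  have Um: "random_variable borel (U i)" if "i \<in> {1..n}" for i
    using assms(3) that unfolding indep_vars_def by auto
  let ?S = "\<lambda>\<omega>. \<Sum>i=1..n. as i *\<^sub>R U i \<omega>"
  have a0: "a \<ge> 0" by (simp add: assms(6) sum_nonneg)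
  have c: "c > 1"
  proof -
    have "(2::real) ^ 3 \<le> exp 1 ^ 3" using exp_ge_add_one_self[of 1] by (intro power_mono) auto
    also have "exp 1 ^ 3 = exp (3::real)" by (simp add: exp_of_nat_mult[symmetric])
    finally show ?thesis by (simp add: assms(7))
  qed
  have neg: "prob {\<omega> \<in> space M. norm (?S \<omega>) > u} < c * prob {\<omega> \<in> space M. a * norm (Z \<omega>) > u}" if u: "u < 0" for u
  proof -
    have "{\<omega> \<in> space M. a * norm (Z \<omega>) > u} = space M"
      using a0 u by (auto intro: less_le_trans)
    then show ?thesis using le_less_trans[OF prob_le_1 c] by (simp add: prob_space)
  qed
  have pos: "prob {\<omega> \<in> space M. norm (?S \<omega>) > u} < c * prob {\<omega> \<in> space M. a * norm (Z \<omega>) > u}"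
    if u: "u \<ge> 0" and nz: "\<exists>i\<in>{1..n}. as i \<noteq> 0" for u
  proof -
    obtain j where j: "j \<in> {1..n}" "as j \<noteq> 0" using nz by blast
    have "(\<Sum>i=1..n. (as i)\<^sup>2) > 0"
      by (rule sum_pos2[OF _ j(1)]) (use j(2) in auto)
    then have a: "a > 0" by (simp add: assms(6))
    have a2: "a\<^sup>2 * CARD('d) = (\<Sum>i=1..n. (as i)\<^sup>2)" by (simp add: assms(6) sum_nonneg)
    define b where "b i = as i / a" for i
    have b2: "(\<Sum>i\<in>{1..n}. (b i)\<^sup>2) = DIM(real ^ 'd)"
      using a a2 by (simp add: b_def power_divide sum_divide_distrib[symmetric] field_simps)
    define X where "X \<omega> = norm (\<Sum>i=1..n. b i *\<^sub>R U i \<omega>)" for \<omega>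
    have Xm[measurable]: "X \<in> borel_measurable M"
      unfolding X_def using Um by measurable
    have SX: "norm (?S \<omega>) = a * X \<omega>" for \<omega>
    proof -
      have "?S \<omega> = a *\<^sub>R (\<Sum>i=1..n. b i *\<^sub>R U i \<omega>)"
        using a by (simp add: scaleR_sum_right b_def)
      then show ?thesis using a by (simp add: X_def)
    qed
    have mean: "(\<integral>\<^sup>+\<omega>. ennreal (f (\<Sum>i\<in>{1..n}. b i *\<^sub>R U i \<omega>)) \<partial>M) \<le> (\<integral>\<^sup>+z. ennreal (f z) \<partial>gaussian)"
      if "convex_laplacian f P P' h" for f P P' h
      using assms(2-4) b2
      by (intro convex_laplacian.indep_sum_sphere_mean_le_gaussian_mean[OF that assms(1)]) auto
    have "prob {\<omega> \<in> space M. X \<omega> > u / a} < 2 * exp 3 / 9 * norm_tail TYPE(real ^ 'd) (u / a)"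
    proof (rule tail_less_gaussian_norm_tail[OF Xm])
      show "(\<integral>\<^sup>+\<omega>. ennreal ((X \<omega>)\<^sup>2) \<partial>M) \<le> (\<integral>\<^sup>+z. ennreal ((norm z)\<^sup>2) \<partial>(gaussian :: (real ^ 'd) measure))"
        unfolding X_def by (rule mean[OF convex_laplacian_norm_power2])
      show "(\<integral>\<^sup>+\<omega>. ennreal ((max 0 (X \<omega> - t)) ^ 3) \<partial>M) \<le> (\<integral>\<^sup>+z. ennreal ((max 0 (norm z - t)) ^ 3) \<partial>(gaussian :: (real ^ 'd) measure))"
        if "t > 0" for t
        unfolding X_def by (rule mean[OF convex_laplacian_ramp_cube[OF that]])
    qed (use u a in \<open>auto simp: X_def\<close>)
    also have "norm_tail TYPE(real ^ 'd) (u / a) = prob {\<omega> \<in> space M. norm (Z \<omega>) > u / a}"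
      unfolding norm_tail_def Zlaw[symmetric] by (subst measure_distr) (auto intro!: arg_cong[where f = prob])
    finally show ?thesis
      unfolding SX using a by (simp add: divide_less_eq mult.commute assms(7))
  qed
  have "prob {\<omega> \<in> space M. norm (?S \<omega>) > u} \<le> c * prob {\<omega> \<in> space M. a * norm (Z \<omega>) > u}" for u
  proof (cases "(\<exists>i\<in>{1..n}. as i \<noteq> 0) \<or> u < 0")
    case True
    then show ?thesis using neg[of u] pos[of u] by fastforce
  next
    case False
    then have "?S \<omega> = 0" for \<omega> by (intro sum.neutral) auto
    then have "{\<omega> \<in> space M. norm (?S \<omega>) > u} = {}" using False by auto
    then show ?thesis using c by (simp only: measure_empty) simp
  qed
  moreover have "prob {\<omega> \<in> space M. norm (?S \<omega>) > u} < c * prob {\<omega> \<in> space M. a * norm (Z \<omega>) > u}"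
    if "(\<exists>i\<in>{1..n}. as i \<noteq> 0) \<or> u < 0" for u
    using that neg[of u] pos[of u] by (cases "u < 0") auto
  ultimately show ?thesis by blast
qed

end
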